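(* For every smooth Riemannian metric $\gamma$ on $\mathbb S^n$, there exist a complete Riemannian metric $g$ on $\mathbb R^{n+1}$ with negative curvature operator and a smooth isometric embedding $$X\colon(\mathbb S^n,\gamma)\hookrightarrow(\mathbb R^{n+1},g).$$ Moreover, $g$ has constant negative sectional curvature outside a compact set, and the second fundamental form of $X(\mathbb S^n)$ with respect to the inward normal is positive definite.
   Context: Here $n\ge1$. Second fundamental form: for a hypersurface with unit normal $\nu$, $\mathrm{II}(X,Y)=\langle\nabla_XY,\nu\rangle$; the inward normal is the unit normal pointing into the bounded component of $\mathbb R^{n+1}\setminus X(\mathbb S^n)$. Curvature operator: with $R(X,Y)Z=\nabla_X\nabla_YZ-\nabla_Y\nabla_XZ-\nabla_{[X,Y]}Z$, the symmetric bilinear form $\mathrm{Rm}(X\wedge Y,Z\wedge W)=\langle R(X,Y)W,Z\rangle$ on bivectors defines the curvature operator $\mathcal R$ by $\langle\mathcal R\alpha,\beta\rangle=\mathrm{Rm}(\alpha,\beta)$, where bivectors carry the inner product induced by $g$. It is negative if all its eigenvalues are negative at every point. *)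

theory Defs
  imports "HOL-Analysis.Analysis"
begin

section \<open>Smooth maps\<close>

primrec C_k_on :: "nat \<Rightarrow> ('a::real_normed_vector \<Rightarrow> 'b::real_normed_vector) \<Rightarrow> 'a set \<Rightarrow> bool" where
  "C_k_on 0 f U \<longleftrightarrow> continuous_on U f"
| "C_k_on (Suc k) f U \<longleftrightarrow>
     (\<forall>x\<in>U. f differentiable (at x)) \<and>
     (\<forall>v. C_k_on k (\<lambda>x. frechet_derivative f (at x) v) U)"

definition C_inf_on :: "('a::real_normed_vector \<Rightarrow> 'b::real_normed_vector) \<Rightarrow> 'a set \<Rightarrow> bool" where
  "C_inf_on f U \<longleftrightarrow> (\<forall>k. C_k_on k f U)"

text \<open>Smoothness on an arbitrary subset of Euclidean space means local extendability to a smooth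
  map on an open set. For a submanifold this agrees with smoothness in charts, and for an open set
  with the preceding definition.\<close>

definition smooth_map :: "'a set \<Rightarrow> ('a::real_normed_vector \<Rightarrow> 'b::real_normed_vector) \<Rightarrow> bool" where
  "smooth_map M f \<longleftrightarrow>
     (\<forall>x\<in>M. \<exists>U F. open U \<and> x \<in> U \<and> C_inf_on F U \<and> (\<forall>y\<in>M \<inter> U. F y = f y))"

section \<open>Riemannian metrics\<close>

text \<open>A manifold is given as a subset \<open>M\<close> of Euclidean space together with its tangent spaces
  \<open>T x\<close>, regarded as linear subspaces. The values of \<open>g x\<close> outside \<open>T x\<close> are irrelevant.\<close>

definition tangent_field :: "'a set \<Rightarrow> ('a \<Rightarrow> 'a set) \<Rightarrow> ('a::real_normed_vector \<Rightarrow> 'a) \<Rightarrow> bool" where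
  "tangent_field M T V \<longleftrightarrow> smooth_map M V \<and> (\<forall>x\<in>M. V x \<in> T x)"

definition riemannian_metric ::
  "'a set \<Rightarrow> ('a \<Rightarrow> 'a set) \<Rightarrow> ('a::real_normed_vector \<Rightarrow> 'a \<Rightarrow> 'a \<Rightarrow> real) \<Rightarrow> bool" where
  "riemannian_metric M T g \<longleftrightarrow>
     (\<forall>x\<in>M.
        (\<forall>u\<in>T x. \<forall>v\<in>T x. \<forall>w\<in>T x. \<forall>a b.
           g x (a *\<^sub>R u + b *\<^sub>R v) w = a * g x u w + b * g x v w) \<and>
        (\<forall>u\<in>T x. \<forall>v\<in>T x. g x u v = g x v u) \<and>
        (\<forall>u\<in>T x. u \<noteq> 0 \<longrightarrow> g x u u > 0)) \<and>
     (\<forall>V W. tangent_field M T V \<longrightarrow> tangent_field M T W \<longrightarrow>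
        smooth_map M (\<lambda>x. g x (V x) (W x)))"

abbreviation unit_sphere :: "'a::real_normed_vector set" where
  "unit_sphere \<equiv> sphere 0 1"

definition sphere_tangent :: "'a::euclidean_space \<Rightarrow> 'a set" where
  "sphere_tangent x = {v. v \<bullet> x = 0}"

abbreviation sphere_metric :: "('a::euclidean_space \<Rightarrow> 'a \<Rightarrow> 'a \<Rightarrow> real) \<Rightarrow> bool" where
  "sphere_metric \<equiv> riemannian_metric unit_sphere sphere_tangent"

abbreviation space_metric :: "('a::euclidean_space \<Rightarrow> 'a \<Rightarrow> 'a \<Rightarrow> real) \<Rightarrow> bool" where
  "space_metric \<equiv> riemannian_metric UNIV (\<lambda>_. UNIV)"

text \<open>The library's \<^const>\<open>valid_path\<close> puts no bound on the velocity near the break points, so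
  a valid path can have infinite length. Hence \<open>has_integral\<close> rather than \<open>integral\<close>, whose
  default value 0 would otherwise enter the infimum.\<close>

definition riemannian_dist :: "('a::euclidean_space \<Rightarrow> 'a \<Rightarrow> 'a \<Rightarrow> real) \<Rightarrow> 'a \<Rightarrow> 'a \<Rightarrow> real" where
  "riemannian_dist g x y =
     Inf {L. \<exists>p. valid_path p \<and> pathstart p = x \<and> pathfinish p = y \<and>
       ((\<lambda>t. sqrt (g (p t) (vector_derivative p (at t)) (vector_derivative p (at t))))
          has_integral L) {0..1}}"

definition complete_metric :: "('a::euclidean_space \<Rightarrow> 'a \<Rightarrow> 'a \<Rightarrow> real) \<Rightarrow> bool" where
  "complete_metric g \<longleftrightarrow> Metric_space.mcomplete UNIV (riemannian_dist g)"

section \<open>Levi-Civita connection and curvature on Euclidean space\<close>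

text \<open>The Christoffel symbols \<open>\<Gamma>\<^sub>x(u,v)\<close> in the global linear coordinates, from the Koszul formula
  for the constant vector fields \<open>u\<close>, \<open>v\<close>, \<open>w\<close>.\<close>

definition christoffel :: "('a::euclidean_space \<Rightarrow> 'a \<Rightarrow> 'a \<Rightarrow> real) \<Rightarrow> 'a \<Rightarrow> 'a \<Rightarrow> 'a \<Rightarrow> 'a" where
  "christoffel g x u v = (THE c. \<forall>w. 2 * g x c w =
       frechet_derivative (\<lambda>y. g y v w) (at x) u
     + frechet_derivative (\<lambda>y. g y u w) (at x) v
     - frechet_derivative (\<lambda>y. g y u v) (at x) w)"

definition nabla ::
  "('a::euclidean_space \<Rightarrow> 'a \<Rightarrow> 'a \<Rightarrow> real) \<Rightarrow> ('a \<Rightarrow> 'a) \<Rightarrow> ('a \<Rightarrow> 'a) \<Rightarrow> 'a \<Rightarrow> 'a" where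
  "nabla g X Y x = frechet_derivative Y (at x) (X x) + christoffel g x (X x) (Y x)"

definition lie_bracket :: "('a::euclidean_space \<Rightarrow> 'a) \<Rightarrow> ('a \<Rightarrow> 'a) \<Rightarrow> 'a \<Rightarrow> 'a" where
  "lie_bracket X Y x = frechet_derivative Y (at x) (X x) - frechet_derivative X (at x) (Y x)"

definition curvature ::
  "('a::euclidean_space \<Rightarrow> 'a \<Rightarrow> 'a \<Rightarrow> real)
     \<Rightarrow> ('a \<Rightarrow> 'a) \<Rightarrow> ('a \<Rightarrow> 'a) \<Rightarrow> ('a \<Rightarrow> 'a) \<Rightarrow> 'a \<Rightarrow> 'a" where
  "curvature g X Y Z x =
     nabla g X (nabla g Y Z) x - nabla g Y (nabla g X Z) x - nabla g (lie_bracket X Y) Z x"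

text \<open>\<open>Rm g x u v z w\<close> is \<open>Rm(u \<and> v, z \<and> w) = \<langle>R(u,v)w, z\<rangle>\<close> at the point \<open>x\<close>. As \<open>R\<close> is tensorial,
  its value on tangent vectors may be computed with their constant extensions.\<close>

definition Rm :: "('a::euclidean_space \<Rightarrow> 'a \<Rightarrow> 'a \<Rightarrow> real) \<Rightarrow> 'a \<Rightarrow> 'a \<Rightarrow> 'a \<Rightarrow> 'a \<Rightarrow> 'a \<Rightarrow> real" where
  "Rm g x u v z w = g x (curvature g (\<lambda>_. u) (\<lambda>_. v) (\<lambda>_. w) x) z"

definition gram2 :: "('a \<Rightarrow> 'a \<Rightarrow> 'a \<Rightarrow> real) \<Rightarrow> 'a \<Rightarrow> 'a \<Rightarrow> 'a \<Rightarrow> 'a \<Rightarrow> 'a \<Rightarrow> real" where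
  "gram2 g x u v z w = g x u z * g x v w - g x u w * g x v z"

definition sectional_curvature :: "('a::euclidean_space \<Rightarrow> 'a \<Rightarrow> 'a \<Rightarrow> real) \<Rightarrow> 'a \<Rightarrow> 'a \<Rightarrow> 'a \<Rightarrow> real" where
  "sectional_curvature g x u v = Rm g x u v u v / gram2 g x u v u v"

definition constant_sectional_curvature_on ::
  "'a set \<Rightarrow> ('a::euclidean_space \<Rightarrow> 'a \<Rightarrow> 'a \<Rightarrow> real) \<Rightarrow> real \<Rightarrow> bool" where
  "constant_sectional_curvature_on U g \<kappa> \<longleftrightarrow>
     (\<forall>x\<in>U. \<forall>u v. u \<noteq> v \<and> independent {u, v} \<longrightarrow> sectional_curvature g x u v = \<kappa>)"

section \<open>The curvature operator\<close>

text \<open>Bivectors are represented by their skew-symmetric coefficient matrices: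
  \<open>\<alpha> = \<Sum>i<j. \<alpha>\<^sub>i\<^sub>j e\<^sub>i \<and> e\<^sub>j = \<onehalf> \<Sum>i j. \<alpha>\<^sub>i\<^sub>j e\<^sub>i \<and> e\<^sub>j\<close>.\<close>

definition bivectors :: "(real^'m^'m) set" where
  "bivectors = {\<alpha>. transpose \<alpha> = - \<alpha>}"

definition wedge :: "real^'m \<Rightarrow> real^'m \<Rightarrow> real^'m^'m" where
  "wedge u v = (\<chi> i j. u $ i * v $ j - u $ j * v $ i)"

text \<open>The bilinear form on bivectors whose value on \<open>(u \<and> v, z \<and> w)\<close> is \<open>Q u v z w\<close>.\<close>

definition bivector_form ::
  "(real^'m \<Rightarrow> real^'m \<Rightarrow> real^'m \<Rightarrow> real^'m \<Rightarrow> real) \<Rightarrow> real^'m^'m \<Rightarrow> real^'m^'m \<Rightarrow> real" where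
  "bivector_form Q \<alpha> \<beta> =
     (\<Sum>i\<in>UNIV. \<Sum>j\<in>UNIV. \<Sum>k\<in>UNIV. \<Sum>l\<in>UNIV.
        \<alpha> $ i $ j * \<beta> $ k $ l * Q (axis i 1) (axis j 1) (axis k 1) (axis l 1)) / 4"

lemma wedge_in_bivectors: "wedge u v \<in> bivectors"
  by (simp add: bivectors_def wedge_def transpose_def vec_eq_iff)

lemma bivector_form_wedge:
  fixes Q :: "real^'m \<Rightarrow> real^'m \<Rightarrow> real^'m \<Rightarrow> real^'m \<Rightarrow> real"
  assumes lin: "\<And>v z w. linear (\<lambda>u. Q u v z w)" "\<And>u z w. linear (\<lambda>v. Q u v z w)"
      "\<And>u v w. linear (\<lambda>z. Q u v z w)" "\<And>u v z. linear (\<lambda>w. Q u v z w)"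
    and alt: "\<And>u v z w. Q v u z w = - Q u v z w" "\<And>u v z w. Q u v w z = - Q u v z w"
  shows "bivector_form Q (wedge u v) (wedge z w) = Q u v z w"
proof -
  have expand: "f u = (\<Sum>i\<in>UNIV. u $ i * f (axis i 1))" if "linear f" for f :: "real^'m \<Rightarrow> real" and u
  proof -
    have "f u = f (\<Sum>i\<in>UNIV. u $ i *\<^sub>R axis i 1)"
      using basis_expansion[of u] by (simp add: scalar_mult_eq_scaleR)
    also have "\<dots> = (\<Sum>i\<in>UNIV. u $ i * f (axis i 1))"
      using that by (simp add: linear_sum linear_cmul)
    finally show ?thesis .
  qed
  have two: "(\<Sum>k\<in>UNIV. \<Sum>l\<in>UNIV. wedge z w $ k $ l * B (axis k 1) (axis l 1)) = 2 * B z w"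
    if B: "\<And>w. linear (\<lambda>z. B z w)" "\<And>z. linear (B z)" "\<And>z w. B w z = - B z w"
    for B :: "real^'m \<Rightarrow> real^'m \<Rightarrow> real" and z w
  proof -
    have BB: "B a b = (\<Sum>k\<in>UNIV. \<Sum>l\<in>UNIV. a $ k * b $ l * B (axis k 1) (axis l 1))" for a b
    proof -
      have "B a b = (\<Sum>k\<in>UNIV. a $ k * B (axis k 1) b)"
        by (rule expand[OF B(1)])
      also have "\<dots> = (\<Sum>k\<in>UNIV. a $ k * (\<Sum>l\<in>UNIV. b $ l * B (axis k 1) (axis l 1)))"
        by (intro sum.cong refl arg_cong[where f = "\<lambda>r. _ * r"] expand[OF B(2)])
      finally show ?thesis by (simp only: sum_distrib_left mult.assoc)
    qed
    have "(\<Sum>k\<in>UNIV. \<Sum>l\<in>UNIV. wedge z w $ k $ l * B (axis k 1) (axis l 1))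
        = (\<Sum>k\<in>UNIV. \<Sum>l\<in>UNIV. z $ k * w $ l * B (axis k 1) (axis l 1)
            - w $ k * z $ l * B (axis k 1) (axis l 1))"
      by (intro sum.cong refl) (simp add: wedge_def algebra_simps)
    also have "\<dots> = B z w - B w z"
      by (simp only: sum_subtractf BB[symmetric])
    finally show ?thesis using B(3)[of w z] by simp
  qed
  have "(\<Sum>i\<in>UNIV. \<Sum>j\<in>UNIV. \<Sum>k\<in>UNIV. \<Sum>l\<in>UNIV.
          wedge u v $ i $ j * wedge z w $ k $ l * Q (axis i 1) (axis j 1) (axis k 1) (axis l 1))
      = (\<Sum>i\<in>UNIV. \<Sum>j\<in>UNIV. wedge u v $ i $ j * (\<Sum>k\<in>UNIV. \<Sum>l\<in>UNIV.
          wedge z w $ k $ l * Q (axis i 1) (axis j 1) (axis k 1) (axis l 1)))"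
    by (simp only: sum_distrib_left mult.assoc)
  also have "\<dots> = (\<Sum>i\<in>UNIV. \<Sum>j\<in>UNIV. wedge u v $ i $ j * (2 * Q (axis i 1) (axis j 1) z w))"
    by (intro sum.cong refl arg_cong[where f = "\<lambda>r. _ * r"] two lin alt)
  also have "\<dots> = 2 * (\<Sum>i\<in>UNIV. \<Sum>j\<in>UNIV. wedge u v $ i $ j * Q (axis i 1) (axis j 1) z w)"
    by (simp only: sum_distrib_left mult.left_commute)
  also have "\<dots> = 2 * (2 * Q u v z w)"
    by (intro arg_cong[where f = "\<lambda>r. _ * r"] two[of "\<lambda>a b. Q a b z w"] lin alt)
  finally show ?thesis by (simp add: bivector_form_def)
qed

definition curvature_operator ::
  "(real^'m \<Rightarrow> real^'m \<Rightarrow> real^'m \<Rightarrow> real) \<Rightarrow> real^'m \<Rightarrow> real^'m^'m \<Rightarrow> real^'m^'m" where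
  "curvature_operator g x \<alpha> = (THE \<beta>. \<beta> \<in> bivectors \<and>
     (\<forall>\<eta>\<in>bivectors. bivector_form (gram2 g x) \<beta> \<eta> = bivector_form (Rm g x) \<alpha> \<eta>))"

definition negative_curvature_operator ::
  "(real^'m \<Rightarrow> real^'m \<Rightarrow> real^'m \<Rightarrow> real) \<Rightarrow> bool" where
  "negative_curvature_operator g \<longleftrightarrow>
     (\<forall>x \<mu>. (\<exists>\<alpha>\<in>bivectors. \<alpha> \<noteq> 0 \<and> curvature_operator g x \<alpha> = \<mu> *\<^sub>R \<alpha>) \<longrightarrow> \<mu> < 0)"

section \<open>Embedded spheres\<close>

text \<open>The differential of a smooth map at a point of the unit sphere. The derivative within the
  sphere is determined exactly on the tangent space, and is only ever applied to tangent vectors.\<close>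

definition sphere_diff ::
  "('a::euclidean_space \<Rightarrow> 'b::euclidean_space) \<Rightarrow> 'a \<Rightarrow> 'a \<Rightarrow> 'b" where
  "sphere_diff F x v = frechet_derivative F (at x within unit_sphere) v"

definition sphere_embedding :: "('a::euclidean_space \<Rightarrow> 'b::euclidean_space) \<Rightarrow> bool" where
  "sphere_embedding X \<longleftrightarrow>
     smooth_map unit_sphere X \<and>
     (\<forall>x\<in>unit_sphere. inj_on (sphere_diff X x) (sphere_tangent x)) \<and>
     (\<exists>Y. homeomorphism unit_sphere (X ` unit_sphere) X Y)"

definition sphere_isometric ::
  "('a::euclidean_space \<Rightarrow> 'a \<Rightarrow> 'a \<Rightarrow> real) \<Rightarrow> ('b::euclidean_space \<Rightarrow> 'b \<Rightarrow> 'b \<Rightarrow> real)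
     \<Rightarrow> ('a \<Rightarrow> 'b) \<Rightarrow> bool" where
  "sphere_isometric \<gamma> g X \<longleftrightarrow>
     (\<forall>x\<in>unit_sphere. \<forall>u\<in>sphere_tangent x. \<forall>v\<in>sphere_tangent x.
        g (X x) (sphere_diff X x u) (sphere_diff X x v) = \<gamma> x u v)"

text \<open>\<^const>\<open>inside\<close> is the union of the bounded components of the complement; for an embedded
  sphere of codimension one this is the single bounded component.\<close>

definition inward_unit_normal ::
  "('a::euclidean_space \<Rightarrow> 'a \<Rightarrow> 'a \<Rightarrow> real) \<Rightarrow> ('a \<Rightarrow> 'a) \<Rightarrow> 'a \<Rightarrow> 'a \<Rightarrow> bool" where
  "inward_unit_normal g X x \<nu> \<longleftrightarrow>
     g (X x) \<nu> \<nu> = 1 \<and>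
     (\<forall>v\<in>sphere_tangent x. g (X x) (sphere_diff X x v) \<nu> = 0) \<and>
     (\<forall>\<^sub>F t in at_right 0. X x + t *\<^sub>R \<nu> \<in> inside (X ` unit_sphere))"

text \<open>Tangent fields of the hypersurface \<open>X(S)\<close> are the fields \<open>dX(V)\<close> with \<open>V\<close> a tangent field on
  the sphere. \<open>nabla_along g X u W x\<close> is the covariant derivative at \<open>X x\<close>, in the direction
  \<open>dX(u)\<close>, of the vector field along \<open>X(S)\<close> whose value at \<open>X y\<close> is \<open>W y\<close>.\<close>

definition nabla_along ::
  "('a::euclidean_space \<Rightarrow> 'a \<Rightarrow> 'a \<Rightarrow> real) \<Rightarrow> ('a \<Rightarrow> 'a) \<Rightarrow> 'a \<Rightarrow> ('a \<Rightarrow> 'a) \<Rightarrow> 'a \<Rightarrow> 'a" where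
  "nabla_along g X u W x =
     sphere_diff W x u + christoffel g (X x) (sphere_diff X x u) (W x)"

definition second_fundamental_form ::
  "('a::euclidean_space \<Rightarrow> 'a \<Rightarrow> 'a \<Rightarrow> real) \<Rightarrow> ('a \<Rightarrow> 'a) \<Rightarrow> ('a \<Rightarrow> 'a)
     \<Rightarrow> ('a \<Rightarrow> 'a) \<Rightarrow> ('a \<Rightarrow> 'a) \<Rightarrow> 'a \<Rightarrow> real" where
  "second_fundamental_form g X \<nu> V W x =
     g (X x) (nabla_along g X (V x) (\<lambda>y. sphere_diff X y (W y)) x) (\<nu> x)"

definition positive_definite_II ::
  "('a::euclidean_space \<Rightarrow> 'a \<Rightarrow> 'a \<Rightarrow> real) \<Rightarrow> ('a \<Rightarrow> 'a) \<Rightarrow> ('a \<Rightarrow> 'a) \<Rightarrow> bool" where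
  "positive_definite_II g X \<nu> \<longleftrightarrow>
     (\<forall>V. tangent_field unit_sphere sphere_tangent V \<longrightarrow>
        (\<forall>x\<in>unit_sphere. V x \<noteq> 0 \<longrightarrow> second_fundamental_form g X \<nu> V V x > 0))"

end

theory Submission
  imports Defs
begin

text \<open>The metric lives on \<open>\<real>\<^sup>m\<close> with \<open>m = n + 1\<close>, and the embedding is the inclusion of the unit sphere.
  The hyperboloid model in its linear coordinates is the metric
  \<open>u \<bullet> v - (x \<bullet> u) (x \<bullet> v) / (\<epsilon>\<^sup>2 + x \<bullet> x)\<close>, of constant curvature \<open>- 1 / \<epsilon>\<^sup>2\<close>. On vectors tangent to a
  sphere around the origin it is the Euclidean inner product, and away from the origin it is of size
  \<open>\<epsilon>\<^sup>2\<close> in the radial direction. Extend the difference of \<open>\<gamma>\<close> and the round metric from the sphere to the punctured space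
  so that it is constant along rays and vanishes on radial vectors, multiply it by a bump function
  of \<open>ln \<bar>x\<bar> / L\<close> and add the resulting tensor \<open>P\<close> to the hyperbolic metric. The bump function is 1 on
  the unit sphere, so that \<open>\<gamma>\<close> is induced there, and \<open>P\<close> vanishes near the origin and near infinity.

  The curvature stays negative for two reasons. A large \<open>L\<close> makes the transition between the round
  metric and \<open>\<gamma>\<close> slow: one and two derivatives of \<open>P\<close> along the position vector are of order \<open>1 / L\<close>.
  A small \<open>\<epsilon>\<close> then makes everything else negligible: the hyperbolic curvature is of size \<open>1 / \<epsilon>\<^sup>2\<close>, and
  what the other derivatives of \<open>P\<close> contribute is of lower order in \<open>1 / \<epsilon>\<close>. Thus \<open>L\<close> is chosen first
  and \<open>\<epsilon>\<close> afterwards.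

  To see this without frames or polar coordinates, the Christoffel symbol is compared with that of
  the hyperbolic metric, which is \<open>- G(u, v) x / \<epsilon>\<^sup>2\<close>, a multiple of the position vector. In the difference
  \<open>Rm + gram / \<epsilon>\<^sup>2\<close> all large terms cancel (\<open>E_formula\<close>). Its value on four vectors is split according
  to how many of them are radial; the symmetries of the curvature tensor allow at most one radial vector
  in each pair, and the value with two of them involves derivatives of \<open>P\<close> in the radial direction
  only (\<open>E_tang\<close>, \<open>E_mixed1\<close>, \<open>E_mixed2\<close>, \<open>E_rad\<close>, collected in \<open>E_bound\<close>). A bound on the whole tensor, as
  opposed to one on sectional curvatures, makes the curvature operator negative
  (\<open>bivector_form_negative\<close>).

  The second fundamental form of the unit sphere is \<open>\<gamma>\<close> divided by the length of the position vector,
  as the bump function has a critical point there (\<open>positive_definite_II\<close>). The metric is complete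
  because its size at \<open>x\<close> is at least of order \<open>1 / (1 + \<bar>x\<bar>\<^sup>2)\<close>, so that \<open>ln (1 + \<bar>y - a\<bar>\<^sup>2)\<close> is bounded by a
  multiple of the distance from \<open>a\<close> to \<open>y\<close> (\<open>d_log_bound\<close>).\<close>

section \<open>Smooth functions and directional derivatives\<close>

text \<open>The direction comes first, so that iterated derivatives read \<open>D u (D v f) x\<close>.\<close>

definition D :: "'a \<Rightarrow> ('a::real_normed_vector \<Rightarrow> 'b::real_normed_vector) \<Rightarrow> 'a \<Rightarrow> 'b" where
  "D v f x = frechet_derivative f (at x) v"

lemma C_k_on_Suc_D:
  "C_k_on (Suc k) f U \<longleftrightarrow> (\<forall>x\<in>U. f differentiable (at x)) \<and> (\<forall>v. C_k_on k (D v f) U)"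
  by (simp add: D_def[abs_def] C_k_on.simps(2))

(* Unfolding would expose Frechet derivatives; C_k_on_Suc_D is used instead. *)
declare C_k_on.simps(2) [simp del]

lemma D_works: "f differentiable (at x) \<Longrightarrow> (f has_derivative (\<lambda>v. D v f x)) (at x)"
  unfolding D_def by (simp add: frechet_derivative_works[symmetric])

lemma D_eqI: "(f has_derivative f') (at x) \<Longrightarrow> D v f x = f' v"
  unfolding D_def using frechet_derivative_at by fastforce

lemma D_cong:
  assumes "open U" "x \<in> U" "\<And>y. y \<in> U \<Longrightarrow> f y = g y"
  shows "D v f x = D v g x"
proof -
  have "(f has_derivative f') (at x) \<longleftrightarrow> (g has_derivative f') (at x)" for f'
    using has_derivative_transform_within_open[of f f' x UNIV U g]
      has_derivative_transform_within_open[of g f' x UNIV U f] assms by auto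
  then show ?thesis by (simp add: D_def frechet_derivative_def)
qed

lemma C_k_on_subset: "C_k_on k f U \<Longrightarrow> V \<subseteq> U \<Longrightarrow> C_k_on k f V"
  by (induction k arbitrary: f) (auto simp: C_k_on_Suc_D intro: continuous_on_subset)

lemma C_k_on_cong:
  assumes "open U" "\<And>x. x \<in> U \<Longrightarrow> f x = g x" "C_k_on k f U"
  shows "C_k_on k g U"
  using assms(2,3)
proof (induction k arbitrary: f g)
  case 0 then show ?case by (simp cong: continuous_on_cong)
next
  case (Suc k)
  have "g differentiable (at x)" if "x \<in> U" for x
    unfolding differentiable_def
    using has_derivative_transform_within_open[OF D_works assms(1) that, of f g] Suc.prems that
    by (auto simp: C_k_on_Suc_D)
  moreover have "C_k_on k (D v g) U" for v
  proof (rule Suc.IH)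
    show "D v f x = D v g x" if "x \<in> U" for x
      using assms(1) that Suc.prems(1) by (rule D_cong)
    show "C_k_on k (D v f) U" using Suc.prems(2) by (simp add: C_k_on_Suc_D)
  qed
  ultimately show ?case by (simp add: C_k_on_Suc_D)
qed

lemma C_k_on_Suc_imp: "C_k_on (Suc k) f U \<Longrightarrow> C_k_on k f U"
proof (induction k arbitrary: f)
  case 0 then show ?case
    by (auto simp: C_k_on_Suc_D continuous_at_imp_continuous_on differentiable_imp_continuous_within)
next
  case (Suc k)
  then show ?case unfolding C_k_on_Suc_D[of "Suc k"] C_k_on_Suc_D[of k] by blast
qed

text \<open>Smoothness is later proved piecewise: near the origin and away from it, or on neighbourhoods
  supplied by local extensions from the sphere.\<close>

lemma C_k_on_local:
  assumes "\<And>x. x \<in> U \<Longrightarrow> \<exists>V. open V \<and> x \<in> V \<and> C_k_on k f V"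
  shows "C_k_on k f U"
  using assms
proof (induction k arbitrary: f)
  case 0
  have "isCont f x" if "x \<in> U" for x
    using 0[OF that] by (auto simp: continuous_on_eq_continuous_at)
  then show ?case by (simp add: continuous_at_imp_continuous_on)
next
  case (Suc k)
  have "f differentiable (at x)" if "x \<in> U" for x
    using Suc.prems[OF that] by (auto simp: C_k_on_Suc_D)
  moreover have "C_k_on k (D v f) U" for v
  proof (rule Suc.IH)
    fix x assume "x \<in> U"
    then show "\<exists>V. open V \<and> x \<in> V \<and> C_k_on k (D v f) V"
      using Suc.prems[of x] by (auto simp: C_k_on_Suc_D)
  qed
  ultimately show ?case by (simp add: C_k_on_Suc_D)
qed

lemma C_k_on_const: "C_k_on k (\<lambda>x. c) U"
proof (induction k arbitrary: c)
  case (Suc k)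
  have "D v (\<lambda>x. c) = (\<lambda>x. 0)" for v :: 'a
    by (rule ext, rule D_eqI) (rule has_derivative_const)
  then show ?case by (auto simp: C_k_on_Suc_D Suc)
qed simp

lemma C_k_on_bounded_linear_compose:
  assumes h: "bounded_linear h" and U: "open U" and "C_k_on k f U"
  shows "C_k_on k (\<lambda>x. h (f x)) U"
  using assms(3)
proof (induction k arbitrary: f)
  case 0 then show ?case using bounded_linear.continuous_on[OF h] by simp
next
  case (Suc k)
  have d: "((\<lambda>x. h (f x)) has_derivative (\<lambda>v. h (D v f x))) (at x)" if "x \<in> U" for x
    using Suc.prems that by (intro bounded_linear.has_derivative[OF h])
      (auto simp: C_k_on_Suc_D D_works)
  have "C_k_on k (D v (\<lambda>x. h (f x))) U" for v
    using Suc.prems D_eqI[OF d, of _ v]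
    by - (rule C_k_on_cong[OF U _ Suc.IH[of "D v f"]], (auto simp: C_k_on_Suc_D)+)
  then show ?case using d by (auto simp: C_k_on_Suc_D differentiable_def)
qed

lemma C_k_on_bounded_linear:
  assumes "bounded_linear h" shows "C_k_on k h U"
proof (cases k)
  case 0 then show ?thesis using linear_continuous_on[OF assms] by simp
next
  case (Suc j)
  have "D v h = (\<lambda>x. h v)" for v
    by (rule ext, rule D_eqI) (rule bounded_linear_imp_has_derivative[OF assms])
  then show ?thesis using assms
    by (auto simp: Suc C_k_on_Suc_D C_k_on_const bounded_linear_imp_differentiable)
qed

lemma C_k_on_add:
  assumes U: "open U" and "C_k_on k f U" "C_k_on k g U"
  shows "C_k_on k (\<lambda>x. f x + g x) U"
  using assms(2,3)
proof (induction k arbitrary: f g)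
  case 0 then show ?case by (simp add: continuous_on_add)
next
  case (Suc k)
  have d: "((\<lambda>x. f x + g x) has_derivative (\<lambda>v. D v f x + D v g x)) (at x)" if "x \<in> U" for x
    using Suc.prems that
    by (intro has_derivative_add) (auto simp: C_k_on_Suc_D D_works)
  have "C_k_on k (D v (\<lambda>x. f x + g x)) U" for v
    using Suc.prems D_eqI[OF d, of _ v]
    by - (rule C_k_on_cong[OF U _ Suc.IH[of "D v f" "D v g"]], (auto simp: C_k_on_Suc_D)+)
  then show ?case using d by (auto simp: C_k_on_Suc_D differentiable_def)
qed

lemma C_k_on_bilinear:
  assumes h: "bounded_bilinear h" and U: "open U" and "C_k_on k f U" "C_k_on k g U"
  shows "C_k_on k (\<lambda>x. h (f x) (g x)) U"
  using assms(3,4)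
proof (induction k arbitrary: f g)
  case 0 then show ?case using bounded_bilinear.continuous_on[OF h] by simp
next
  case (Suc k)
  have d: "((\<lambda>x. h (f x) (g x)) has_derivative (\<lambda>v. h (f x) (D v g x) + h (D v f x) (g x))) (at x)"
    if "x \<in> U" for x
    using Suc.prems that
    by (intro bounded_bilinear.FDERIV[OF h]) (auto simp: C_k_on_Suc_D D_works)
  have "C_k_on k (D v (\<lambda>x. h (f x) (g x))) U" for v
    using Suc.prems D_eqI[OF d, of _ v] C_k_on_Suc_imp[OF Suc.prems(1)] C_k_on_Suc_imp[OF Suc.prems(2)]
    by - (rule C_k_on_cong[OF U _ C_k_on_add[OF U Suc.IH[of "f" "D v g"] Suc.IH[of "D v f" "g"]]], (auto simp: C_k_on_Suc_D)+)
  then show ?case using d by (auto simp: C_k_on_Suc_D differentiable_def)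
qed

lemma C_k_on_sum:
  assumes "open U" "\<And>i. i \<in> I \<Longrightarrow> C_k_on k (f i) U"
  shows "C_k_on k (\<lambda>x. \<Sum>i\<in>I. f i x) U"
  using assms(2) by (induction I rule: infinite_finite_induct) (auto simp: C_k_on_const C_k_on_add assms(1))

text \<open>The derivative of \<open>f\<close> at \<open>h x\<close> is expanded in the basis. The derivative of the composition is then a
  sum of products whose factors \<open>D i f (h x)\<close> fall under the induction hypothesis.\<close>

lemma C_k_on_compose:
  fixes h :: "'a::real_normed_vector \<Rightarrow> 'b::euclidean_space" and f :: "'b \<Rightarrow> 'c::real_normed_vector"
  assumes U: "open U" and hV: "\<And>x. x \<in> U \<Longrightarrow> h x \<in> V"
    and "C_k_on k f V" "C_k_on k h U"
  shows "C_k_on k (\<lambda>x. f (h x)) U"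
  using assms(3,4)
proof (induction k arbitrary: f)
  case 0 then show ?case using hV continuous_on_compose2 by (metis C_k_on.simps(1) image_subsetI)
next
  case (Suc k)
  have d: "((\<lambda>x. f (h x)) has_derivative (\<lambda>v. \<Sum>i\<in>Basis. (D v h x \<bullet> i) *\<^sub>R D i f (h x))) (at x)"
    if "x \<in> U" for x
  proof -
    have hd: "(h has_derivative (\<lambda>v. D v h x)) (at x)"
      using Suc.prems that by (auto simp: C_k_on_Suc_D D_works)
    have fd: "(f has_derivative (\<lambda>v. D v f (h x))) (at (h x))"
      using Suc.prems hV[OF that] by (auto simp: C_k_on_Suc_D D_works)
    have lin: "linear (\<lambda>v. D v f (h x))" using fd by (simp add: has_derivative_linear)
    have "D w f (h x) = (\<Sum>i\<in>Basis. (w \<bullet> i) *\<^sub>R D i f (h x))" for w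
    proof -
      have "D w f (h x) = D (\<Sum>i\<in>Basis. (w \<bullet> i) *\<^sub>R i) f (h x)"
        by (simp only: euclidean_representation)
      also have "\<dots> = (\<Sum>i\<in>Basis. (w \<bullet> i) *\<^sub>R D i f (h x))"
        by (simp only: linear_sum[OF lin] linear_cmul[OF lin])
      finally show ?thesis .
    qed
    then have "(\<lambda>v. D (D v h x) f (h x)) = (\<lambda>v. \<Sum>i\<in>Basis. (D v h x \<bullet> i) *\<^sub>R D i f (h x))"
      by blast
    then show ?thesis
      using has_derivative_compose[OF hd fd] by (simp only:)
  qed
  have "C_k_on k (D v (\<lambda>x. f (h x))) U" for v
  proof (rule C_k_on_cong[OF U])
    show "(\<Sum>i\<in>Basis. (D v h x \<bullet> i) *\<^sub>R D i f (h x)) = D v (\<lambda>x. f (h x)) x" if "x \<in> U" for x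
      by (rule D_eqI[OF d[OF that], symmetric])
    show "C_k_on k (\<lambda>x. \<Sum>i\<in>Basis. (D v h x \<bullet> i) *\<^sub>R D i f (h x)) U"
      using Suc.prems C_k_on_Suc_imp[OF Suc.prems(2)]
      by (intro C_k_on_sum U C_k_on_bilinear[OF bounded_bilinear_scaleR]
          C_k_on_bounded_linear_compose[OF bounded_linear_inner_left] Suc.IH)
        (auto simp: C_k_on_Suc_D)
  qed
  then show ?case using d by (auto simp: C_k_on_Suc_D differentiable_def)
qed

lemma C_k_on_SucI_field:
  fixes f f' :: "real \<Rightarrow> real"
  assumes U: "open U" and d: "\<And>x. x \<in> U \<Longrightarrow> (f has_field_derivative f' x) (at x)" and "C_k_on k f' U"
  shows "C_k_on (Suc k) f U"
proof -
  have "C_k_on k (D v f) U" for v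
  proof (rule C_k_on_cong[OF U])
    show "f' x * v = D v f x" if "x \<in> U" for x
      using D_eqI d[OF that, unfolded has_field_derivative_def] by metis
    show "C_k_on k (\<lambda>x. f' x * v) U"
      using C_k_on_bounded_linear_compose[OF bounded_linear_mult_left U assms(3)] .
  qed
  moreover have "f differentiable (at x)" if "x \<in> U" for x
    using d[OF that] has_field_derivative_imp_has_derivative differentiable_def by blast
  ultimately show ?thesis by (simp add: C_k_on_Suc_D)
qed

lemma C_inf_on_inverse: "C_inf_on (inverse :: real \<Rightarrow> real) (- {0})"
  unfolding C_inf_on_def
proof
  fix k show "C_k_on k (inverse :: real \<Rightarrow> real) (- {0})"
  proof (induction k)
    case (Suc k)
    have "C_k_on k (\<lambda>x. (- 1) * (inverse x * inverse x) :: real) (- {0})"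
      by (intro C_k_on_bilinear[OF bounded_bilinear_mult] C_k_on_const Suc open_Compl closed_singleton)
    then show ?case
      by (intro C_k_on_SucI_field[where f' = "\<lambda>x. - 1 * (inverse x * inverse x)"])
        (auto intro!: derivative_eq_intros simp: open_Compl)
  qed (simp add: continuous_on_inverse[OF continuous_on_id])
qed

lemma C_inf_on_ln: "C_inf_on (ln :: real \<Rightarrow> real) {0<..}"
  unfolding C_inf_on_def
proof
  fix k show "C_k_on k (ln :: real \<Rightarrow> real) {0<..}"
  proof (cases k)
    case (Suc j)
    have "C_k_on j (inverse :: real \<Rightarrow> real) {0<..}"
      using C_inf_on_inverse by (auto simp: C_inf_on_def intro: C_k_on_subset[of j _ "- {0}"])
    then show ?thesis unfolding Suc
      by (intro C_k_on_SucI_field[where f' = inverse])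
        (auto intro!: derivative_eq_intros simp: divide_inverse)
  qed (auto intro!: continuous_on_ln[OF continuous_on_id])
qed

lemma C_inf_on_sqrt: "C_inf_on sqrt {0<..}"
  unfolding C_inf_on_def
proof
  fix k show "C_k_on k sqrt {0<..}"
  proof (induction k)
    case (Suc k)
    have "C_k_on k (\<lambda>x. inverse (sqrt x)) {0<..}"
      using C_inf_on_inverse unfolding C_inf_on_def
      by (intro C_k_on_compose[of "{0<..}" sqrt "- {0}" k inverse, OF _ _ _ Suc]) auto
    then have "C_k_on k (\<lambda>x. (1/2) * inverse (sqrt x)) {0<..}"
      by (rule C_k_on_bilinear[OF bounded_bilinear_mult open_greaterThan C_k_on_const])
    then show ?case
      by (intro C_k_on_SucI_field[where f' = "\<lambda>x. (1/2) * inverse (sqrt x)"])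
        (auto intro!: derivative_eq_intros simp: divide_simps)
  qed (simp add: continuous_on_real_sqrt)
qed

lemma C_inf_on_subset: "C_inf_on f U \<Longrightarrow> V \<subseteq> U \<Longrightarrow> C_inf_on f V"
  unfolding C_inf_on_def by (metis C_k_on_subset)

lemma C_inf_on_cong:
  "open U \<Longrightarrow> (\<And>x. x \<in> U \<Longrightarrow> f x = g x) \<Longrightarrow> C_inf_on f U \<Longrightarrow> C_inf_on g U"
  using C_k_on_cong by (metis C_inf_on_def)

lemma C_inf_on_local:
  "(\<And>x. x \<in> U \<Longrightarrow> \<exists>V. open V \<and> x \<in> V \<and> C_inf_on f V) \<Longrightarrow> C_inf_on f U"
  unfolding C_inf_on_def by (metis C_k_on_local)

lemma C_inf_on_const: "C_inf_on (\<lambda>x. c) U"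
  by (simp add: C_inf_on_def C_k_on_const)

lemma C_inf_on_bounded_linear: "bounded_linear h \<Longrightarrow> C_inf_on h U"
  by (simp add: C_inf_on_def C_k_on_bounded_linear)

lemma C_inf_on_id: "C_inf_on (\<lambda>x. x) U"
  by (intro C_inf_on_bounded_linear bounded_linear_ident)

lemma C_inf_on_add: "open U \<Longrightarrow> C_inf_on f U \<Longrightarrow> C_inf_on g U \<Longrightarrow> C_inf_on (\<lambda>x. f x + g x) U"
  by (simp add: C_inf_on_def C_k_on_add)

lemma C_inf_on_bilinear:
  "bounded_bilinear h \<Longrightarrow> open U \<Longrightarrow> C_inf_on f U \<Longrightarrow> C_inf_on g U \<Longrightarrow> C_inf_on (\<lambda>x. h (f x) (g x)) U"
  by (simp add: C_inf_on_def C_k_on_bilinear)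

lemmas C_inf_on_mult = C_inf_on_bilinear[OF bounded_bilinear_mult]
lemmas C_inf_on_scaleR = C_inf_on_bilinear[OF bounded_bilinear_scaleR]
lemmas C_inf_on_inner = C_inf_on_bilinear[OF bounded_bilinear_inner]

lemma C_inf_on_diff:
  fixes f g :: "_ \<Rightarrow> 'b::real_normed_vector"
  assumes "open U" "C_inf_on f U" "C_inf_on g U" shows "C_inf_on (\<lambda>x. f x - g x) U"
proof -
  have "C_inf_on (\<lambda>x. f x + (-1) *\<^sub>R g x) U"
    by (intro C_inf_on_add C_inf_on_scaleR C_inf_on_const assms)
  then show ?thesis by simp
qed

lemma C_inf_on_sum:
  "open U \<Longrightarrow> (\<And>i. i \<in> I \<Longrightarrow> C_inf_on (f i) U) \<Longrightarrow> C_inf_on (\<lambda>x. \<Sum>i\<in>I. f i x) U"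
  by (simp add: C_inf_on_def C_k_on_sum)

lemma C_inf_on_compose:
  fixes h :: "'a::real_normed_vector \<Rightarrow> 'b::euclidean_space"
  shows "C_inf_on f V \<Longrightarrow> open U \<Longrightarrow> C_inf_on h U \<Longrightarrow> (\<And>x. x \<in> U \<Longrightarrow> h x \<in> V) \<Longrightarrow> C_inf_on (\<lambda>x. f (h x)) U"
  by (auto simp: C_inf_on_def intro: C_k_on_compose)

lemma C_inf_on_divide:
  fixes f g :: "_ \<Rightarrow> real"
  assumes "open U" "C_inf_on f U" "C_inf_on g U" "\<And>x. x \<in> U \<Longrightarrow> g x \<noteq> 0"
  shows "C_inf_on (\<lambda>x. f x / g x) U"
  unfolding divide_inverse
  by (intro C_inf_on_mult C_inf_on_compose[OF C_inf_on_inverse assms(1) assms(3)] assms(1,2)) (auto simp: assms(4))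

lemma C_inf_on_norm:
  "C_inf_on (norm :: 'a::euclidean_space \<Rightarrow> real) (- {0})"
  unfolding norm_eq_sqrt_inner[abs_def]
  by (rule C_inf_on_compose[OF C_inf_on_sqrt _ C_inf_on_inner[OF _ C_inf_on_id C_inf_on_id]]) auto

lemma C_inf_on_D: "C_inf_on f U \<Longrightarrow> C_inf_on (D v f) U"
  unfolding C_inf_on_def using C_k_on_Suc_D by blast

lemma C_inf_on_has_derivative:
  "C_inf_on f U \<Longrightarrow> x \<in> U \<Longrightarrow> (f has_derivative (\<lambda>v. D v f x)) (at x)"
  unfolding C_inf_on_def using C_k_on_Suc_D D_works by metis

lemma C_inf_on_continuous: "C_inf_on f U \<Longrightarrow> continuous_on U f"
  by (drule C_inf_on_def[THEN iffD1], drule spec[of _ 0], simp)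

lemma smooth_map_UNIV: "smooth_map UNIV f \<longleftrightarrow> C_inf_on f UNIV"
proof
  assume "smooth_map UNIV f"
  have "\<exists>U. open U \<and> x \<in> U \<and> C_inf_on f U" for x
  proof -
    from \<open>smooth_map UNIV f\<close> obtain U F where "open U" "x \<in> U" "C_inf_on F U" "\<forall>y\<in>UNIV \<inter> U. F y = f y"
      unfolding smooth_map_def by (meson UNIV_I)
    then show ?thesis using C_inf_on_cong[of U F f] by auto
  qed
  then show "C_inf_on f UNIV" by (intro C_inf_on_local)
next
  assume "C_inf_on f UNIV"
  then show "smooth_map UNIV f" unfolding smooth_map_def by (intro ballI exI[of _ UNIV] exI[of _ f]) simp
qed

text \<open>The mean value theorem, applied in the direction \<open>u\<close> to a difference in the direction \<open>v\<close> and then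
  in the direction \<open>v\<close>.\<close>

lemma second_difference_mean_value:
  fixes f :: "'a::real_normed_vector \<Rightarrow> real"
  assumes f: "C_inf_on f UNIV" and t: "0 < t"
  shows "\<exists>a b. 0 < a \<and> a < t \<and> 0 < b \<and> b < t \<and>
    f (x + t *\<^sub>R u + t *\<^sub>R v) - f (x + t *\<^sub>R u) - f (x + t *\<^sub>R v) + f x
      = t * t * D v (D u f) (x + a *\<^sub>R u + b *\<^sub>R v)"
proof -
  have ray: "((\<lambda>s. h (y + s *\<^sub>R w)) has_field_derivative D w h (y + s *\<^sub>R w)) (at s)"
    if h: "C_inf_on h UNIV" for h :: "'a \<Rightarrow> real" and y w s
  proof -
    have "((\<lambda>s. y + s *\<^sub>R w) has_derivative (\<lambda>r. r *\<^sub>R w)) (at s)"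
      by (auto intro!: derivative_eq_intros)
    from has_derivative_compose[OF this C_inf_on_has_derivative[OF h UNIV_I]]
    have "((\<lambda>s. h (y + s *\<^sub>R w)) has_derivative (\<lambda>r. D (r *\<^sub>R w) h (y + s *\<^sub>R w))) (at s)" .
    moreover have "D (r *\<^sub>R w) h z = D w h z * r" for r z
      using linear_cmul[OF has_derivative_linear[OF C_inf_on_has_derivative[OF h, of z]]] by simp
    ultimately show ?thesis by (simp add: has_field_derivative_def)
  qed
  define k where "k s = f ((x + t *\<^sub>R v) + s *\<^sub>R u) - f (x + s *\<^sub>R u)" for s
  have "(k has_field_derivative D u f ((x + t *\<^sub>R v) + s *\<^sub>R u) - D u f (x + s *\<^sub>R u)) (at s)" for s
    unfolding k_def by (intro DERIV_diff ray f)
  from MVT2[OF t this] obtain a where a: "0 < a" "a < t"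
    "k t - k 0 = t * (D u f ((x + t *\<^sub>R v) + a *\<^sub>R u) - D u f (x + a *\<^sub>R u))" by auto
  from MVT2[OF t ray[OF C_inf_on_D[OF f, of u], of "x + a *\<^sub>R u" v]]
  obtain b where b: "0 < b" "b < t"
    "D u f (x + a *\<^sub>R u + t *\<^sub>R v) - D u f (x + a *\<^sub>R u) = t * D v (D u f) (x + a *\<^sub>R u + b *\<^sub>R v)"
    by auto
  have "k t - k 0 = t * t * D v (D u f) (x + a *\<^sub>R u + b *\<^sub>R v)"
    using a(3) b(3) by (simp add: add.commute add.left_commute)
  then show ?thesis using a b unfolding k_def
    by (intro exI[of _ a] exI[of _ b]) (simp add: add.commute add.left_commute)
qed

text \<open>The second difference is symmetric in \<open>u\<close> and \<open>v\<close>, so each mixed derivative attains the same value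
  near \<open>x\<close>; by continuity the values at \<open>x\<close> agree as the step tends to 0.\<close>

lemma D_commute:
  fixes f :: "'a::real_normed_vector \<Rightarrow> real"
  assumes f: "C_inf_on f UNIV"
  shows "D u (D v f) x = D v (D u f) x"
proof -
  define t where "t n = 1 / real (Suc n)" for n
  have t: "0 < t n" for n by (simp add: t_def)
  have t0: "t \<longlonglongrightarrow> 0" unfolding t_def using LIMSEQ_inverse_real_of_nat by (simp add: inverse_eq_divide)
  have "\<forall>n. \<exists>a b. 0 < a \<and> a < t n \<and> 0 < b \<and> b < t n \<and>
      f (x + t n *\<^sub>R u + t n *\<^sub>R v) - f (x + t n *\<^sub>R u) - f (x + t n *\<^sub>R v) + f x
      = t n * t n * D v (D u f) (x + a *\<^sub>R u + b *\<^sub>R v)"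
    by (intro allI second_difference_mean_value[OF f t])
  then obtain a b where ab:
    "\<And>n. 0 < a n \<and> a n < t n \<and> 0 < b n \<and> b n < t n \<and>
      f (x + t n *\<^sub>R u + t n *\<^sub>R v) - f (x + t n *\<^sub>R u) - f (x + t n *\<^sub>R v) + f x
      = t n * t n * D v (D u f) (x + a n *\<^sub>R u + b n *\<^sub>R v)" by metis
  have "\<forall>n. \<exists>a b. 0 < a \<and> a < t n \<and> 0 < b \<and> b < t n \<and>
      f (x + t n *\<^sub>R v + t n *\<^sub>R u) - f (x + t n *\<^sub>R v) - f (x + t n *\<^sub>R u) + f x
      = t n * t n * D u (D v f) (x + a *\<^sub>R v + b *\<^sub>R u)"
    by (intro allI second_difference_mean_value[OF f t])
  then obtain a' b' where ab':
    "\<And>n. 0 < a' n \<and> a' n < t n \<and> 0 < b' n \<and> b' n < t n \<and>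
      f (x + t n *\<^sub>R v + t n *\<^sub>R u) - f (x + t n *\<^sub>R v) - f (x + t n *\<^sub>R u) + f x
      = t n * t n * D u (D v f) (x + a' n *\<^sub>R v + b' n *\<^sub>R u)" by metis
  have eq: "D v (D u f) (x + a n *\<^sub>R u + b n *\<^sub>R v) = D u (D v f) (x + a' n *\<^sub>R v + b' n *\<^sub>R u)" for n
  proof -
    have "x + t n *\<^sub>R v + t n *\<^sub>R u = x + t n *\<^sub>R u + t n *\<^sub>R v" by simp
    with ab'[of n] have "f (x + t n *\<^sub>R u + t n *\<^sub>R v) - f (x + t n *\<^sub>R v) - f (x + t n *\<^sub>R u) + f x
      = t n * t n * D u (D v f) (x + a' n *\<^sub>R v + b' n *\<^sub>R u)" by (simp only:)
    with ab[of n] have "t n * t n * D v (D u f) (x + a n *\<^sub>R u + b n *\<^sub>R v)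
        = t n * t n * D u (D v f) (x + a' n *\<^sub>R v + b' n *\<^sub>R u)"
      by linarith
    then show ?thesis using t[of n] by simp
  qed
  have lim0: "s \<longlonglongrightarrow> 0" if "\<And>n. 0 < s n \<and> s n < t n" for s :: "nat \<Rightarrow> real"
    by (rule tendsto_sandwich[OF _ _ tendsto_const t0]) (auto simp: that less_imp_le)
  have "a \<longlonglongrightarrow> 0" "b \<longlonglongrightarrow> 0" "a' \<longlonglongrightarrow> 0" "b' \<longlonglongrightarrow> 0" using ab ab' by (auto intro!: lim0)
  then have l: "(\<lambda>n. x + a n *\<^sub>R u + b n *\<^sub>R v) \<longlonglongrightarrow> x + 0 *\<^sub>R u + 0 *\<^sub>R v"
    "(\<lambda>n. x + a' n *\<^sub>R v + b' n *\<^sub>R u) \<longlonglongrightarrow> x + 0 *\<^sub>R v + 0 *\<^sub>R u"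
    by - (intro tendsto_intros; assumption)+
  have c: "isCont (D w (D z f)) y" for w z y
    using C_inf_on_continuous[OF C_inf_on_D[OF C_inf_on_D[OF f]]]
    by (simp add: continuous_on_eq_continuous_at)
  have "(\<lambda>n. D v (D u f) (x + a n *\<^sub>R u + b n *\<^sub>R v)) \<longlonglongrightarrow> D v (D u f) x"
    using isCont_tendsto_compose[OF c l(1)] by simp
  moreover have "(\<lambda>n. D v (D u f) (x + a n *\<^sub>R u + b n *\<^sub>R v)) \<longlonglongrightarrow> D u (D v f) x"
    unfolding eq using isCont_tendsto_compose[OF c l(2)] by simp
  ultimately show ?thesis using LIMSEQ_unique by blast
qed

section \<open>Inner products and curvature operators at one point\<close>

lemma matrix_inv_right: "invertible M \<Longrightarrow> M ** matrix_inv M = mat 1"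
  for M :: "real^'m^'m"
  unfolding invertible_def matrix_inv_def by (drule someI_ex) (rule conjunct1)

locale pos_form =
  fixes b :: "real^'m \<Rightarrow> real^'m \<Rightarrow> real"
  assumes linear_left: "linear (\<lambda>u. b u w)"
    and sym: "b u v = b v u"
    and pos: "u \<noteq> 0 \<Longrightarrow> b u u > 0"
begin

lemma linear_right: "linear (b u)"
proof -
  have "b u = (\<lambda>w. b w u)" by (rule ext) (rule sym)
  then show ?thesis using linear_left[of u] by (simp only:)
qed

lemma bilinear_simps:
  "b (u + v) w = b u w + b v w" "b (u - v) w = b u w - b v w" "b (c *\<^sub>R u) w = c * b u w" "b 0 w = 0" "b (- u) w = - b u w"
  "b w (u + v) = b w u + b w v" "b w (u - v) = b w u - b w v" "b w (c *\<^sub>R u) = c * b w u" "b w 0 = 0" "b w (- u) = - b w u"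
  "b (\<Sum>i\<in>I. f i) w = (\<Sum>i\<in>I. b (f i) w)" "b w (\<Sum>i\<in>I. f i) = (\<Sum>i\<in>I. b w (f i))"
  by (simp_all add: linear_add[OF linear_right] linear_diff[OF linear_right] linear_cmul[OF linear_right]
      linear_0[OF linear_right] linear_neg[OF linear_right] linear_sum[OF linear_right]
      linear_add[OF linear_left] linear_diff[OF linear_left] linear_cmul[OF linear_left]
      linear_0[OF linear_left] linear_neg[OF linear_left] linear_sum[OF linear_left])

lemma nonneg: "b u u \<ge> 0"
  by (cases "u = 0") (auto simp: bilinear_simps less_imp_le pos)

lemma eq_0_iff: "b u u = 0 \<longleftrightarrow> u = 0"
  using pos[of u] by (cases "u = 0") (auto simp: bilinear_simps)

text \<open>Gram-Schmidt. The family is indexed by coordinates, so that the full index set gives a frame: as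
  long as an index is missing, the vectors found so far are too few to span the space.\<close>

lemma orthonormal_family: "\<exists>e. \<forall>i\<in>(I::'m set). \<forall>j\<in>I. b (e i) (e j) = (if i = j then 1 else 0)"
  using finite[of I]
proof (induction I rule: finite_induct)
  case (insert i I)
  from insert.IH obtain e where e: "\<And>i j. i \<in> I \<Longrightarrow> j \<in> I \<Longrightarrow> b (e i) (e j) = (if i = j then 1 else 0)" by auto
  have "card (e ` I) \<le> card I" by (rule card_image_le) simp
  also have "\<dots> < CARD('m)" using \<open>i \<notin> I\<close> by (intro psubset_card_mono) auto
  finally have "dim (span (e ` I)) \<noteq> dim (UNIV :: (real^'m) set)"
    using dim_le_card'[of "e ` I"] by simp
  then obtain v where v: "v \<notin> span (e ` I)" by (metis UNIV_eq_I)
  define w where "w = v - (\<Sum>j\<in>I. b v (e j) *\<^sub>R e j)"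
  have "(\<Sum>j\<in>I. b v (e j) *\<^sub>R e j) \<in> span (e ` I)" by (intro span_sum span_scale span_base) auto
  then have "w \<noteq> 0" using v by (auto simp: w_def)
  then have w: "b w w > 0" by (rule pos)
  have ejw: "b (e j) w = 0" if j: "j \<in> I" for j
  proof -
    have "(\<Sum>k\<in>I. b v (e k) * b (e j) (e k)) = (\<Sum>k\<in>I. if k = j then b v (e j) else 0)"
      using e[OF j] by (intro sum.cong) auto
    then show ?thesis using j by (simp add: w_def bilinear_simps sym[of "e j" v])
  qed
  then have "b w (e j) = 0" if "j \<in> I" for j
    using that sym by metis
  with ejw have "\<forall>k\<in>insert i I. \<forall>j\<in>insert i I.
      b ((e(i := w /\<^sub>R sqrt (b w w))) k) ((e(i := w /\<^sub>R sqrt (b w w))) j) = (if k = j then 1 else 0)"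
    using w e \<open>i \<notin> I\<close> by (auto simp: bilinear_simps field_simps)
  then show ?case by (rule exI[of _ "e(i := w /\<^sub>R sqrt (b w w))"])
qed simp

text \<open>In such a frame the form becomes the standard inner product; all facts about curvature operators are
  proved there.\<close>

lemma orthonormal_matrix: "\<exists>M :: real^'m^'m. invertible M \<and> (\<forall>u v. b (M *v u) (M *v v) = u \<bullet> v)"
proof -
  from orthonormal_family[of UNIV] obtain e :: "'m \<Rightarrow> real^'m" where "\<forall>i\<in>UNIV. \<forall>j\<in>UNIV. b (e i) (e j) = (if i = j then 1 else 0)" ..
  then have e: "\<And>i j. b (e i) (e j) = (if i = j then 1 else 0)" by blast
  define M where "M = (\<chi> i j. e j $ i)"
  have M: "M *v u = (\<Sum>j\<in>UNIV. u $ j *\<^sub>R e j)" for u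
    by (simp add: M_def vec_eq_iff matrix_vector_mult_def mult.commute)
  have *: "b (M *v u) (M *v v) = u \<bullet> v" for u v
    by (simp add: M bilinear_simps e inner_vec_def if_distrib mult.commute cong: if_cong)
  have "M *v u = 0 \<Longrightarrow> u = 0" for u
    using *[of u u] by (simp add: bilinear_simps)
  then have "invertible M" using matrix_left_invertible_ker[of M] invertible_left_inverse[of M] by blast
  with * show ?thesis by blast
qed

lemma riesz: assumes l: "linear l" shows "\<exists>!c. \<forall>w. b c w = l w"
proof -
  from orthonormal_matrix obtain M :: "real^'m^'m" where M: "invertible M" "\<And>u v. b (M *v u) (M *v v) = u \<bullet> v" by blast
  define c where "c = (\<chi> i. l (M *v axis i 1))"
  have c: "b (M *v c) w = l w" for w
  proof -
    define v where "v = matrix_inv M *v w"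
    have w: "w = M *v v" using M(1)
      by (simp add: v_def matrix_vector_mul_assoc matrix_inv_right)
    have "l (M *v v) = l (M *v (\<Sum>i\<in>UNIV. v $ i *\<^sub>R axis i 1))"
      using basis_expansion[of v] by (simp add: scalar_mult_eq_scaleR)
    also have "\<dots> = (\<Sum>i\<in>UNIV. v $ i * l (M *v axis i 1))"
      by (simp add: linear_sum[OF matrix_vector_mul_linear] linear_sum[OF l]
          linear_cmul[OF matrix_vector_mul_linear] linear_cmul[OF l])
    finally show ?thesis unfolding w M(2) by (simp add: inner_vec_def c_def mult.commute)
  qed
  show ?thesis
  proof (rule ex1I[of _ "M *v c"])
    fix c' assume c': "\<forall>w. b c' w = l w"
    have "b (c' - M *v c) (c' - M *v c) = 0" using c' c by (simp add: bilinear_simps)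
    then show "c' = M *v c" by (simp add: eq_0_iff)
  qed (simp add: c)
qed

lemma cauchy_schwarz: "\<bar>b u v\<bar> \<le> sqrt (b u u) * sqrt (b v v)"
proof -
  from orthonormal_matrix obtain M :: "real^'m^'m" where M: "invertible M" "\<And>u v. b (M *v u) (M *v v) = u \<bullet> v" by blast
  have "M *v (matrix_inv M *v w) = w" for w using M(1)
    by (simp add: matrix_vector_mul_assoc matrix_inv_right)
  then show ?thesis using Cauchy_Schwarz_ineq2[of "matrix_inv M *v u" "matrix_inv M *v v"]
    by (simp add: M(2)[symmetric] norm_eq_sqrt_inner)
qed

end

definition multilinear4 :: "('a::real_vector \<Rightarrow> 'a \<Rightarrow> 'a \<Rightarrow> 'a \<Rightarrow> real) \<Rightarrow> bool" where
  "multilinear4 Q \<longleftrightarrow> (\<forall>v z w. linear (\<lambda>u. Q u v z w)) \<and> (\<forall>u z w. linear (\<lambda>v. Q u v z w)) \<and>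
     (\<forall>u v w. linear (\<lambda>z. Q u v z w)) \<and> (\<forall>u v z. linear (\<lambda>w. Q u v z w))"

lemma sum_swap_pairs:
  "(\<Sum>k\<in>A. \<Sum>l\<in>B. \<Sum>i\<in>I. \<Sum>j\<in>J. f i j k l) = (\<Sum>i\<in>I. \<Sum>j\<in>J. \<Sum>k\<in>A. \<Sum>l\<in>B. f i j k l)"
proof -
  have "(\<Sum>k\<in>A. \<Sum>l\<in>B. \<Sum>i\<in>I. \<Sum>j\<in>J. f i j k l) = (\<Sum>k\<in>A. \<Sum>i\<in>I. \<Sum>l\<in>B. \<Sum>j\<in>J. f i j k l)"
    by (rule sum.cong[OF refl sum.swap])
  also have "\<dots> = (\<Sum>i\<in>I. \<Sum>k\<in>A. \<Sum>j\<in>J. \<Sum>l\<in>B. f i j k l)"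
    by (rule trans[OF sum.swap sum.cong[OF refl sum.cong[OF refl sum.swap]]])
  also have "\<dots> = (\<Sum>i\<in>I. \<Sum>j\<in>J. \<Sum>k\<in>A. \<Sum>l\<in>B. f i j k l)"
    by (rule sum.cong[OF refl sum.swap])
  finally show ?thesis .
qed

text \<open>A change of frame by \<open>M\<close> acts on the coefficient matrix of a bivector by congruence.\<close>

lemma matrix_congruence_sum:
  fixes M \<alpha> :: "real^'m^'m" and B :: "real^'m \<Rightarrow> real^'m \<Rightarrow> real"
  assumes B: "\<And>w. linear (\<lambda>z. B z w)" "\<And>z. linear (B z)"
  shows "(\<Sum>i\<in>UNIV. \<Sum>j\<in>UNIV. (M ** \<alpha> ** transpose M) $ i $ j * B (axis i 1) (axis j 1))
    = (\<Sum>a\<in>UNIV. \<Sum>c\<in>UNIV. \<alpha> $ a $ c * B (M *v axis a 1) (M *v axis c 1))"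
proof -
  have ex: "f (M *v axis a 1) = (\<Sum>i\<in>UNIV. M $ i $ a * f (axis i 1))" if f: "linear f" for f :: "real^'m \<Rightarrow> real" and a
  proof -
    have "f (M *v axis a 1) = f (\<Sum>i\<in>UNIV. (M *v axis a 1) $ i *\<^sub>R axis i 1)"
      using basis_expansion[of "M *v axis a 1"] by (simp add: scalar_mult_eq_scaleR)
    then show ?thesis
      by (simp add: linear_sum[OF f] linear_cmul[OF f] matrix_vector_mul_component
          inner_axis column_def)
  qed
  have exB: "B (M *v axis a 1) (M *v axis c 1) = (\<Sum>i\<in>UNIV. \<Sum>j\<in>UNIV. M $ i $ a * M $ j $ c * B (axis i 1) (axis j 1))" for a c
    by (subst ex[OF B(1)], subst ex[OF B(2)]) (simp add: sum_distrib_left mult.assoc)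
  have "(M ** \<alpha> ** transpose M) $ i $ j = (\<Sum>a\<in>UNIV. \<Sum>c\<in>UNIV. \<alpha> $ a $ c * (M $ i $ a * M $ j $ c))" for i j
  proof -
    have "(M ** \<alpha> ** transpose M) $ i $ j = (\<Sum>c\<in>UNIV. \<Sum>a\<in>UNIV. \<alpha> $ a $ c * (M $ i $ a * M $ j $ c))"
      by (simp add: matrix_matrix_mult_def transpose_def sum_distrib_left sum_distrib_right mult_ac)
    then show ?thesis by (subst sum.swap)
  qed
  then have "(\<Sum>i\<in>UNIV. \<Sum>j\<in>UNIV. (M ** \<alpha> ** transpose M) $ i $ j * B (axis i 1) (axis j 1))
     = (\<Sum>i\<in>UNIV. \<Sum>j\<in>UNIV. \<Sum>a\<in>UNIV. \<Sum>c\<in>UNIV. \<alpha> $ a $ c * (M $ i $ a * M $ j $ c * B (axis i 1) (axis j 1)))"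
    by (simp add: sum_distrib_right mult.assoc)
  also have "\<dots> = (\<Sum>a\<in>UNIV. \<Sum>c\<in>UNIV. \<Sum>i\<in>UNIV. \<Sum>j\<in>UNIV. \<alpha> $ a $ c * (M $ i $ a * M $ j $ c * B (axis i 1) (axis j 1)))"
    by (rule sum_swap_pairs)
  finally show ?thesis by (simp add: exB sum_distrib_left mult.assoc)
qed

lemma bivector_form_congruence:
  fixes M \<alpha> \<beta> :: "real^'m^'m"
  assumes Q: "multilinear4 Q"
  shows "bivector_form Q (M ** \<alpha> ** transpose M) (M ** \<beta> ** transpose M)
    = bivector_form (\<lambda>u v z w. Q (M *v u) (M *v v) (M *v z) (M *v w)) \<alpha> \<beta>"
proof -
  let ?A = "M ** \<alpha> ** transpose M" and ?B = "M ** \<beta> ** transpose M"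
  define S where "S u v = (\<Sum>k\<in>UNIV. \<Sum>l\<in>UNIV. ?B $ k $ l * Q u v (axis k 1) (axis l 1))" for u v
  have S: "S u v = (\<Sum>k\<in>UNIV. \<Sum>l\<in>UNIV. \<beta> $ k $ l * Q u v (M *v axis k 1) (M *v axis l 1))" for u v
    unfolding S_def using Q by (intro matrix_congruence_sum) (auto simp: multilinear4_def)
  have lin: "linear (\<lambda>z. S z w)" "linear (S z)" for w z
    unfolding S_def[abs_def] using Q
    by (auto simp: multilinear4_def
        intro!: linear_compose_sum linear_compose_scale_right[where 'b = real, unfolded real_scaleR_def])
  have "bivector_form Q ?A ?B = (\<Sum>i\<in>UNIV. \<Sum>j\<in>UNIV. ?A $ i $ j * S (axis i 1) (axis j 1)) / 4"
    by (simp add: bivector_form_def S_def sum_distrib_left mult.assoc)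
  also have "(\<Sum>i\<in>UNIV. \<Sum>j\<in>UNIV. ?A $ i $ j * S (axis i 1) (axis j 1))
      = (\<Sum>i\<in>UNIV. \<Sum>j\<in>UNIV. \<alpha> $ i $ j * S (M *v axis i 1) (M *v axis j 1))"
    by (intro matrix_congruence_sum lin)
  finally show ?thesis by (simp add: bivector_form_def S sum_distrib_left mult.assoc)
qed

lemma bivectors_iff: "\<alpha> \<in> bivectors \<longleftrightarrow> (\<forall>i j. \<alpha> $ j $ i = - (\<alpha> $ i $ j))"
  by (auto simp: bivectors_def vec_eq_iff transpose_def)

lemma bivectors_congruence:
  fixes M \<alpha> :: "real^'m^'m"
  shows "\<alpha> \<in> bivectors \<Longrightarrow> M ** \<alpha> ** transpose M \<in> bivectors"
proof -
  assume \<alpha>: "\<alpha> \<in> bivectors"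
  have E: "(M ** \<alpha> ** transpose M) $ i $ j = (\<Sum>a\<in>UNIV. \<Sum>c\<in>UNIV. M $ i $ a * \<alpha> $ a $ c * M $ j $ c)" for i j
    unfolding matrix_matrix_mult_def transpose_def
    by (simp add: sum_distrib_right) (rule sum.swap)
  have "(M ** \<alpha> ** transpose M) $ j $ i = - ((M ** \<alpha> ** transpose M) $ i $ j)" for i j
  proof -
    have "(\<Sum>a\<in>UNIV. \<Sum>c\<in>UNIV. M $ j $ a * \<alpha> $ a $ c * M $ i $ c) = (\<Sum>a\<in>UNIV. \<Sum>c\<in>UNIV. M $ j $ c * \<alpha> $ c $ a * M $ i $ a)"
      by (rule sum.swap)
    also have "\<dots> = (\<Sum>a\<in>UNIV. \<Sum>c\<in>UNIV. - (M $ i $ a * \<alpha> $ a $ c * M $ j $ c))"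
    proof (intro sum.cong refl)
      fix a c
      have "\<alpha> $ c $ a = - (\<alpha> $ a $ c)" using \<alpha> unfolding bivectors_iff by blast
      then show "M $ j $ c * \<alpha> $ c $ a * M $ i $ a = - (M $ i $ a * \<alpha> $ a $ c * M $ j $ c)"
        by (simp only:) (simp add: mult_ac)
    qed
    finally show ?thesis unfolding E by (simp add: sum_negf)
  qed
  then show ?thesis unfolding bivectors_iff by blast
qed

lemma congruence_inverse:
  fixes M \<alpha> :: "real^'m^'m" assumes "invertible M"
  shows "M ** (matrix_inv M ** \<alpha> ** transpose (matrix_inv M)) ** transpose M = \<alpha>"
proof -
  have "transpose (matrix_inv M) ** transpose M = mat 1"
    by (simp add: matrix_transpose_mul[symmetric] matrix_inv_right[OF assms] transpose_mat)
  moreover have "M ** (matrix_inv M ** \<alpha> ** transpose (matrix_inv M)) ** transpose M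
    = (M ** matrix_inv M) ** \<alpha> ** (transpose (matrix_inv M) ** transpose M)"
    by (simp add: matrix_mul_assoc)
  ultimately show ?thesis by (simp add: matrix_inv_right[OF assms])
qed

text \<open>The division by 4 counts every \<open>e\<^sub>i \<and> e\<^sub>j\<close> once in each argument; the Gram form pairs every basis bivector
  with two index pairs, which leaves a factor \<open>1 / 2\<close>.\<close>

lemma bivector_form_standard_gram:
  fixes \<alpha> \<beta> :: "real^'m^'m"
  assumes "\<beta> \<in> bivectors"
  shows "bivector_form (\<lambda>u v z w. (u \<bullet> z) * (v \<bullet> w) - (u \<bullet> w) * (v \<bullet> z)) \<alpha> \<beta>
    = (\<Sum>i\<in>UNIV. \<Sum>j\<in>UNIV. \<alpha> $ i $ j * \<beta> $ i $ j) / 2"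
proof -
  have "(\<Sum>k\<in>UNIV. \<Sum>l\<in>UNIV. \<beta> $ k $ l *
        ((axis i 1 \<bullet> (axis k 1 :: real^'m)) * (axis j 1 \<bullet> (axis l 1 :: real^'m)) - (axis i 1 \<bullet> (axis l 1 :: real^'m)) * (axis j 1 \<bullet> (axis k 1 :: real^'m))))
      = 2 * \<beta> $ i $ j" for i j
  proof -
    have "(\<Sum>k\<in>UNIV. \<Sum>l\<in>UNIV. \<beta> $ k $ l *
        ((axis i 1 \<bullet> (axis k 1 :: real^'m)) * (axis j 1 \<bullet> (axis l 1 :: real^'m)) - (axis i 1 \<bullet> (axis l 1 :: real^'m)) * (axis j 1 \<bullet> (axis k 1 :: real^'m))))
      = (\<Sum>k\<in>UNIV. \<Sum>l\<in>UNIV. (if l = j then if k = i then \<beta> $ k $ l else 0 else 0) - (if l = i then if k = j then \<beta> $ k $ l else 0 else 0))"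
      by (intro sum.cong refl) (auto simp: inner_axis_axis)
    also have "\<dots> = \<beta> $ i $ j - \<beta> $ j $ i" by (simp add: sum_subtractf)
    also have "\<beta> $ j $ i = - (\<beta> $ i $ j)" using assms unfolding bivectors_iff by blast
    finally show ?thesis by simp
  qed
  note inner_sum = this
  have "bivector_form (\<lambda>u v z w. (u \<bullet> z) * (v \<bullet> w) - (u \<bullet> w) * (v \<bullet> z)) \<alpha> \<beta>
      = (\<Sum>i\<in>UNIV. \<Sum>j\<in>UNIV. \<alpha> $ i $ j * (2 * \<beta> $ i $ j)) / 4"
    unfolding inner_sum[symmetric] by (simp only: bivector_form_def sum_distrib_left mult.assoc)
  also have "(\<Sum>i\<in>UNIV. \<Sum>j\<in>UNIV. \<alpha> $ i $ j * (2 * \<beta> $ i $ j)) = 2 * (\<Sum>i\<in>UNIV. \<Sum>j\<in>UNIV. \<alpha> $ i $ j * \<beta> $ i $ j)"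
    by (simp only: mult.left_commute[of _ 2] sum_distrib_left[symmetric])
  finally show ?thesis by simp
qed

lemma multilinear4_gram:
  assumes "pos_form b" shows "multilinear4 (\<lambda>u v z w. b u z * b v w - b u w * b v z)"
proof -
  interpret pos_form b by fact
  show ?thesis unfolding multilinear4_def
    by (auto intro!: linearI simp: bilinear_simps algebra_simps)
qed

text \<open>In an orthonormal frame the Gram form is half the entrywise product of skew-symmetric matrices. The
  equation that characterises the curvature operator therefore has exactly one solution, the
  skew-symmetric part of the coefficients of \<open>Rm(\<alpha>, _)\<close>.\<close>

lemma curvature_operator_works:
  fixes g :: "real^'m \<Rightarrow> real^'m \<Rightarrow> real^'m \<Rightarrow> real"
  assumes g: "pos_form (g x)" and Q: "multilinear4 (Rm g x)" and \<alpha>: "\<alpha> \<in> bivectors" and \<eta>: "\<eta> \<in> bivectors"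
  shows "bivector_form (gram2 g x) (curvature_operator g x \<alpha>) \<eta> = bivector_form (Rm g x) \<alpha> \<eta>"
proof -
  interpret pos_form "g x" by fact
  from orthonormal_matrix obtain M :: "real^'m^'m" where M: "invertible M" "\<And>u v. g x (M *v u) (M *v v) = u \<bullet> v" by blast
  let ?c = "\<lambda>\<alpha>. M ** \<alpha> ** transpose M" and ?i = "\<lambda>\<alpha>. matrix_inv M ** \<alpha> ** transpose (matrix_inv M)"
  have ci: "?c (?i \<alpha>) = \<alpha>" for \<alpha> by (rule congruence_inverse[OF M(1)])
  have gr: "gram2 g x = (\<lambda>u v z w. g x u z * g x v w - g x u w * g x v z)"
    by (intro ext) (simp add: gram2_def)
  have gram: "bivector_form (gram2 g x) (?c \<beta>) (?c \<eta>) = (\<Sum>i\<in>UNIV. \<Sum>j\<in>UNIV. \<beta> $ i $ j * \<eta> $ i $ j) / 2"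
    if "\<eta> \<in> bivectors" for \<beta> \<eta>
    unfolding gr bivector_form_congruence[OF multilinear4_gram[OF g]] M(2)
    by (rule bivector_form_standard_gram[OF that])
  define R where "R i j k l = Rm g x (M *v axis i 1) (M *v axis j 1) (M *v axis k 1) (M *v axis l 1)" for i j k l
  define \<beta> where "\<beta> = (\<chi> k l. (\<Sum>i\<in>UNIV. \<Sum>j\<in>UNIV. ?i \<alpha> $ i $ j * (R i j k l - R i j l k)) / 4)"
  have \<beta>: "\<beta> \<in> bivectors" unfolding bivectors_iff \<beta>_def
    by (simp add: right_diff_distrib sum_subtractf diff_divide_distrib)
  have sol: "bivector_form (gram2 g x) (?c \<beta>) \<eta> = bivector_form (Rm g x) \<alpha> \<eta>" if "\<eta> \<in> bivectors" for \<eta>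
  proof -
    define \<eta>' where "\<eta>' = ?i \<eta>"
    have \<eta>': "\<eta>' \<in> bivectors" unfolding \<eta>'_def by (rule bivectors_congruence[OF that])
    have sw: "(\<Sum>k\<in>UNIV. \<Sum>l\<in>UNIV. (R i j k l - R i j l k) * \<eta>' $ k $ l) = 2 * (\<Sum>k\<in>UNIV. \<Sum>l\<in>UNIV. \<eta>' $ k $ l * R i j k l)" for i j
    proof -
      have "(\<Sum>k\<in>UNIV. \<Sum>l\<in>UNIV. \<eta>' $ k $ l * R i j l k) = (\<Sum>k\<in>UNIV. \<Sum>l\<in>UNIV. \<eta>' $ l $ k * R i j k l)"
        by (rule sum.swap)
      also have "\<dots> = - (\<Sum>k\<in>UNIV. \<Sum>l\<in>UNIV. \<eta>' $ k $ l * R i j k l)"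
        unfolding sum_negf[symmetric]
      proof (intro sum.cong refl)
        fix k l
        have "\<eta>' $ l $ k = - (\<eta>' $ k $ l)" using \<eta>' unfolding bivectors_iff by blast
        then show "\<eta>' $ l $ k * R i j k l = - (\<eta>' $ k $ l * R i j k l)" by (simp only: minus_mult_left)
      qed
      finally show ?thesis by (simp add: right_diff_distrib sum_subtractf mult.commute[of _ "\<eta>' $ _ $ _"])
    qed
    have "(\<Sum>k\<in>UNIV. \<Sum>l\<in>UNIV. \<beta> $ k $ l * \<eta>' $ k $ l)
      = (\<Sum>k\<in>UNIV. \<Sum>l\<in>UNIV. \<Sum>i\<in>UNIV. \<Sum>j\<in>UNIV. ?i \<alpha> $ i $ j * ((R i j k l - R i j l k) * \<eta>' $ k $ l)) / 4"
      by (simp add: \<beta>_def sum_distrib_right sum_divide_distrib mult.assoc)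
    also have "(\<Sum>k\<in>UNIV. \<Sum>l\<in>UNIV. \<Sum>i\<in>UNIV. \<Sum>j\<in>UNIV. ?i \<alpha> $ i $ j * ((R i j k l - R i j l k) * \<eta>' $ k $ l))
      = (\<Sum>i\<in>UNIV. \<Sum>j\<in>UNIV. \<Sum>k\<in>UNIV. \<Sum>l\<in>UNIV. ?i \<alpha> $ i $ j * ((R i j k l - R i j l k) * \<eta>' $ k $ l))"
      by (rule sum_swap_pairs)
    also have "\<dots> = (\<Sum>i\<in>UNIV. \<Sum>j\<in>UNIV. ?i \<alpha> $ i $ j * (2 * (\<Sum>k\<in>UNIV. \<Sum>l\<in>UNIV. \<eta>' $ k $ l * R i j k l)))"
      by (simp only: sum_distrib_left[symmetric] sw)
    also have "\<dots> = 2 * (\<Sum>i\<in>UNIV. \<Sum>j\<in>UNIV. ?i \<alpha> $ i $ j * (\<Sum>k\<in>UNIV. \<Sum>l\<in>UNIV. \<eta>' $ k $ l * R i j k l))"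
      by (simp only: sum_distrib_left mult.left_commute)
    finally have Z: "(\<Sum>k\<in>UNIV. \<Sum>l\<in>UNIV. \<beta> $ k $ l * \<eta>' $ k $ l)
      = 2 * (\<Sum>i\<in>UNIV. \<Sum>j\<in>UNIV. ?i \<alpha> $ i $ j * (\<Sum>k\<in>UNIV. \<Sum>l\<in>UNIV. \<eta>' $ k $ l * R i j k l)) / 4" .
    have "bivector_form (Rm g x) (?c (?i \<alpha>)) (?c \<eta>')
      = (\<Sum>i\<in>UNIV. \<Sum>j\<in>UNIV. ?i \<alpha> $ i $ j * (\<Sum>k\<in>UNIV. \<Sum>l\<in>UNIV. \<eta>' $ k $ l * R i j k l)) / 4"
      unfolding bivector_form_congruence[OF Q]
      by (simp only: bivector_form_def R_def sum_distrib_left mult.assoc)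
    then have "bivector_form (gram2 g x) (?c \<beta>) (?c \<eta>') = bivector_form (Rm g x) (?c (?i \<alpha>)) (?c \<eta>')"
      unfolding gram[OF \<eta>'] Z by simp
    then show ?thesis by (simp only: \<eta>'_def ci)
  qed
  have "\<exists>!\<beta>. \<beta> \<in> bivectors \<and> (\<forall>\<eta>\<in>bivectors. bivector_form (gram2 g x) \<beta> \<eta> = bivector_form (Rm g x) \<alpha> \<eta>)"
  proof (rule ex1I[of _ "?c \<beta>"])
    show "?c \<beta> \<in> bivectors \<and> (\<forall>\<eta>\<in>bivectors. bivector_form (gram2 g x) (?c \<beta>) \<eta> = bivector_form (Rm g x) \<alpha> \<eta>)"
      using sol bivectors_congruence[OF \<beta>] by blast
  next
    fix \<beta>2 assume *: "\<beta>2 \<in> bivectors \<and> (\<forall>\<eta>\<in>bivectors. bivector_form (gram2 g x) \<beta>2 \<eta> = bivector_form (Rm g x) \<alpha> \<eta>)"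
    define d where "d = ?i \<beta>2 - \<beta>"
    have b2: "?i \<beta>2 \<in> bivectors" using * by (intro bivectors_congruence) auto
    have "d $ j $ i = - (d $ i $ j)" for i j
    proof -
      have "?i \<beta>2 $ j $ i = - (?i \<beta>2 $ i $ j)" "\<beta> $ j $ i = - (\<beta> $ i $ j)"
        using b2 \<beta> unfolding bivectors_iff by blast+
      then show ?thesis unfolding d_def vector_minus_component by linarith
    qed
    then have d: "d \<in> bivectors" unfolding bivectors_iff by blast
    have "bivector_form (gram2 g x) (?c (?i \<beta>2)) (?c d) = bivector_form (gram2 g x) (?c \<beta>) (?c d)"
      using * sol bivectors_congruence[OF d] unfolding ci by simp
    then have "(\<Sum>i\<in>UNIV. \<Sum>j\<in>UNIV. ?i \<beta>2 $ i $ j * d $ i $ j) = (\<Sum>i\<in>UNIV. \<Sum>j\<in>UNIV. \<beta> $ i $ j * d $ i $ j)"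
      unfolding gram[OF d] by simp
    then have "(\<Sum>i\<in>UNIV. \<Sum>j\<in>UNIV. d $ i $ j * d $ i $ j) = 0"
      unfolding d_def by (simp add: left_diff_distrib sum_subtractf)
    then have "d = 0" by (simp add: sum_nonneg_eq_0_iff sum_nonneg vec_eq_iff)
    then show "\<beta>2 = ?c \<beta>" using ci[of \<beta>2] by (simp add: d_def)
  qed
  from theI'[OF this] show ?thesis using \<eta> unfolding curvature_operator_def by blast
qed

lemma bivector_form_gram_nonneg:
  fixes g :: "real^'m \<Rightarrow> real^'m \<Rightarrow> real^'m \<Rightarrow> real"
  assumes "pos_form (g x)" "\<alpha> \<in> bivectors"
  shows "bivector_form (gram2 g x) \<alpha> \<alpha> \<ge> 0"
proof -
  interpret pos_form "g x" by fact
  from orthonormal_matrix obtain M :: "real^'m^'m" where M: "invertible M" "\<And>u v. g x (M *v u) (M *v v) = u \<bullet> v" by blast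
  have gr: "gram2 g x = (\<lambda>u v z w. g x u z * g x v w - g x u w * g x v z)"
    by (intro ext) (simp add: gram2_def)
  let ?a = "matrix_inv M ** \<alpha> ** transpose (matrix_inv M)"
  have "bivector_form (gram2 g x) (M ** ?a ** transpose M) (M ** ?a ** transpose M)
      = (\<Sum>i\<in>UNIV. \<Sum>j\<in>UNIV. ?a $ i $ j * ?a $ i $ j) / 2"
    unfolding gr bivector_form_congruence[OF multilinear4_gram[OF assms(1)]] M(2)
    by (rule bivector_form_standard_gram[OF bivectors_congruence[OF assms(2)]])
  moreover have "(\<Sum>i\<in>UNIV. \<Sum>j\<in>UNIV. ?a $ i $ j * ?a $ i $ j) \<ge> 0" by (intro sum_nonneg) simp
  ultimately show ?thesis unfolding congruence_inverse[OF M(1)] by linarith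
qed

text \<open>An eigenvalue is the quotient of the curvature form and the Gram form on an eigenvector.\<close>

lemma negative_curvature_operatorI:
  fixes g :: "real^'m \<Rightarrow> real^'m \<Rightarrow> real^'m \<Rightarrow> real"
  assumes g: "\<And>x. pos_form (g x)" and Q: "\<And>x. multilinear4 (Rm g x)"
    and neg: "\<And>x \<alpha>. \<alpha> \<in> bivectors \<Longrightarrow> \<alpha> \<noteq> 0 \<Longrightarrow> bivector_form (Rm g x) \<alpha> \<alpha> < 0"
  shows "negative_curvature_operator g"
  unfolding negative_curvature_operator_def
proof (intro allI impI)
  fix x \<mu> assume "\<exists>\<alpha>\<in>bivectors. \<alpha> \<noteq> 0 \<and> curvature_operator g x \<alpha> = \<mu> *\<^sub>R \<alpha>"
  then obtain \<alpha> where \<alpha>: "\<alpha> \<in> bivectors" "\<alpha> \<noteq> 0" "curvature_operator g x \<alpha> = \<mu> *\<^sub>R \<alpha>" by blast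
  have "bivector_form (gram2 g x) (\<mu> *\<^sub>R \<alpha>) \<alpha> < 0"
    using curvature_operator_works[of g x, OF g Q \<alpha>(1) \<alpha>(1)] neg[OF \<alpha>(1,2), of x] \<alpha>(3) by simp
  then have "\<mu> * bivector_form (gram2 g x) \<alpha> \<alpha> < 0"
    by (simp add: bivector_form_def sum_distrib_left mult.assoc)
  then show "\<mu> < 0" using bivector_form_gram_nonneg[of g x, OF g \<alpha>(1)] by (simp add: mult_less_0_iff not_less)
qed

text \<open>In an orthonormal frame let \<open>N\<close> be the sum of the squares of the coefficients of the bivector. The
  Gram form contributes \<open>- \<kappa> N / 2\<close>. The rest is at most \<open>\<eta> \<kappa> / 4\<close> times the square of the sum of all absolute
  values of coefficients, which is at most \<open>m\<^sup>2 N\<close>.\<close>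

lemma bivector_form_negative:
  fixes b :: "real^'m \<Rightarrow> real^'m \<Rightarrow> real"
  assumes b: "pos_form b" and Q: "multilinear4 Q" and \<kappa>: "\<kappa> > 0" and \<eta>: "\<eta> * (real CARD('m))\<^sup>2 < 2"
    and bound: "\<And>u v z w. \<bar>Q u v z w + \<kappa> * (b u z * b v w - b u w * b v z)\<bar>
      \<le> \<eta> * \<kappa> * sqrt (b u u) * sqrt (b v v) * sqrt (b z z) * sqrt (b w w)"
    and \<alpha>: "\<alpha> \<in> bivectors" "\<alpha> \<noteq> 0"
  shows "bivector_form Q \<alpha> \<alpha> < 0"
proof -
  interpret pos_form b by fact
  from orthonormal_matrix obtain M :: "real^'m^'m" where M: "invertible M" "\<And>u v. b (M *v u) (M *v v) = u \<bullet> v" by blast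
  define a where "a = matrix_inv M ** \<alpha> ** transpose (matrix_inv M)"
  have a\<alpha>: "M ** a ** transpose M = \<alpha>" unfolding a_def by (rule congruence_inverse[OF M(1)])
  have a: "a \<in> bivectors" unfolding a_def by (rule bivectors_congruence[OF \<alpha>(1)])
  define R where "R i j k l = Q (M *v axis i 1) (M *v axis j 1) (M *v axis k 1) (M *v axis l 1)" for i j k l
  define G where "G i j k l = (axis i 1 \<bullet> (axis k 1 :: real^'m)) * (axis j 1 \<bullet> (axis l 1 :: real^'m)) - (axis i 1 \<bullet> (axis l 1 :: real^'m)) * (axis j 1 \<bullet> (axis k 1 :: real^'m))" for i j k l
  define N where "N = (\<Sum>i\<in>UNIV. \<Sum>j\<in>UNIV. a $ i $ j * a $ i $ j)"
  define A where "A = (\<Sum>i\<in>UNIV. \<Sum>j\<in>UNIV. \<bar>a $ i $ j\<bar>)"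
  have R: "\<bar>R i j k l + \<kappa> * G i j k l\<bar> \<le> \<eta> * \<kappa>" for i j k l
    using bound[of "M *v axis i 1" "M *v axis j 1" "M *v axis k 1" "M *v axis l 1"]
    unfolding M(2) R_def G_def by (simp add: inner_axis_axis)
  have \<eta>0: "\<eta> \<ge> 0" using R[of undefined undefined undefined undefined] \<kappa>
    by (smt (verit) mult_le_0_iff zero_le_mult_iff)
  have "N \<noteq> 0"
  proof
    assume "N = 0"
    then have "a = 0" unfolding N_def by (simp add: sum_nonneg_eq_0_iff sum_nonneg vec_eq_iff)
    then show False using a\<alpha> \<alpha>(2) by simp
  qed
  moreover have "N \<ge> 0" unfolding N_def by (intro sum_nonneg) auto
  ultimately have N: "N > 0" by simp
  have gram: "(\<Sum>i\<in>UNIV. \<Sum>j\<in>UNIV. \<Sum>k\<in>UNIV. \<Sum>l\<in>UNIV. a $ i $ j * a $ k $ l * G i j k l) = 2 * N"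
    using bivector_form_standard_gram[OF a, of a] by (simp add: bivector_form_def G_def N_def)
  have "4 * bivector_form Q \<alpha> \<alpha> = (\<Sum>i\<in>UNIV. \<Sum>j\<in>UNIV. \<Sum>k\<in>UNIV. \<Sum>l\<in>UNIV. a $ i $ j * a $ k $ l * R i j k l)"
    by (subst (1 2) a\<alpha>[symmetric], subst bivector_form_congruence[OF Q]) (simp add: bivector_form_def R_def)
  also have "\<dots> \<le> (\<Sum>i\<in>UNIV. \<Sum>j\<in>UNIV. \<Sum>k\<in>UNIV. \<Sum>l\<in>UNIV.
      (- \<kappa>) * (a $ i $ j * a $ k $ l * G i j k l) + \<bar>a $ i $ j\<bar> * \<bar>a $ k $ l\<bar> * (\<eta> * \<kappa>))"
  proof (intro sum_mono)
    fix i j k l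
    have "a $ i $ j * a $ k $ l * (R i j k l + \<kappa> * G i j k l) \<le> \<bar>a $ i $ j * a $ k $ l * (R i j k l + \<kappa> * G i j k l)\<bar>" by simp
    also have "\<dots> \<le> \<bar>a $ i $ j\<bar> * \<bar>a $ k $ l\<bar> * (\<eta> * \<kappa>)"
      unfolding abs_mult using R by (intro mult_left_mono) auto
    finally show "a $ i $ j * a $ k $ l * R i j k l \<le>
      (- \<kappa>) * (a $ i $ j * a $ k $ l * G i j k l) + \<bar>a $ i $ j\<bar> * \<bar>a $ k $ l\<bar> * (\<eta> * \<kappa>)"
      by (simp add: algebra_simps)
  qed
  also have "\<dots> = (- \<kappa>) * (2 * N) + A * A * (\<eta> * \<kappa>)"
  proof -
    have "A * A = (\<Sum>i\<in>UNIV. \<Sum>j\<in>UNIV. \<bar>a $ i $ j\<bar> * A)"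
      by (subst A_def) (simp only: sum_distrib_right)
    also have "\<dots> = (\<Sum>i\<in>UNIV. \<Sum>j\<in>UNIV. \<Sum>k\<in>UNIV. \<Sum>l\<in>UNIV. \<bar>a $ i $ j\<bar> * \<bar>a $ k $ l\<bar>)"
      by (simp only: A_def sum_distrib_left)
    finally show ?thesis
      by (simp only: gram[symmetric] sum.distrib sum_distrib_left[symmetric] sum_distrib_right[symmetric])
  qed
  finally have *: "4 * bivector_form Q \<alpha> \<alpha> \<le> (- \<kappa>) * (2 * N) + A * A * (\<eta> * \<kappa>)" .
  have "A = (\<Sum>p\<in>UNIV \<times> UNIV. \<bar>a $ fst p $ snd p\<bar>)" "N = (\<Sum>p\<in>UNIV \<times> UNIV. \<bar>a $ fst p $ snd p\<bar>\<^sup>2)"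
    unfolding A_def N_def sum.cartesian_product by (auto intro!: sum.cong simp: power2_eq_square)
  then have "A\<^sup>2 \<le> (real CARD('m))\<^sup>2 * N"
    using sum_squared_le_sum_of_squares[of "\<lambda>p. \<bar>a $ fst p $ snd p\<bar>" "UNIV \<times> UNIV"]
    by (simp add: card_cartesian_product power2_eq_square mult.commute)
  then have "A * A * (\<eta> * \<kappa>) \<le> (real CARD('m))\<^sup>2 * N * (\<eta> * \<kappa>)"
    using \<eta>0 \<kappa> by (intro mult_right_mono) (auto simp: power2_eq_square)
  also have "\<dots> = (\<eta> * (real CARD('m))\<^sup>2) * (N * \<kappa>)" by (simp add: mult_ac)
  also have "\<dots> < 2 * (N * \<kappa>)" using \<eta> N \<kappa> by (intro mult_strict_right_mono) auto
  finally show ?thesis using * by (simp add: mult_ac)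
qed

section \<open>Christoffel symbols and curvature of a smooth metric\<close>

lemma D_linear_dir: "C_inf_on f UNIV \<Longrightarrow> linear (\<lambda>a. D a f x)"
  using C_inf_on_has_derivative has_derivative_linear by blast

lemma D_add: "C_inf_on f UNIV \<Longrightarrow> C_inf_on h UNIV \<Longrightarrow> D a (\<lambda>y. f y + h y) x = D a f x + D a h x"
  by (rule D_eqI[OF has_derivative_add]) (auto intro: C_inf_on_has_derivative)

lemma D_diff: "C_inf_on f UNIV \<Longrightarrow> C_inf_on h UNIV \<Longrightarrow> D a (\<lambda>y. f y - h y) x = D a f x - D a h x"
  by (rule D_eqI[OF has_derivative_diff]) (auto intro: C_inf_on_has_derivative)

lemma D_mult:
  fixes f h :: "'a::real_normed_vector \<Rightarrow> real"
  shows "C_inf_on f UNIV \<Longrightarrow> C_inf_on h UNIV \<Longrightarrow> D a (\<lambda>y. f y * h y) x = f x * D a h x + D a f x * h x"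
  by (rule D_eqI[OF has_derivative_mult]) (auto intro: C_inf_on_has_derivative)

lemma D_cmult:
  fixes f :: "'a::real_normed_vector \<Rightarrow> real"
  shows "C_inf_on f UNIV \<Longrightarrow> D a (\<lambda>y. c * f y) x = c * D a f x"
  by (rule D_eqI[OF has_derivative_mult_right]) (auto intro: C_inf_on_has_derivative)

lemma D_const: "D a (\<lambda>y. c) x = 0"
  by (rule D_eqI[OF has_derivative_const])

lemma D_ident: "D a (\<lambda>y. y) x = a"
  by (rule D_eqI[OF has_derivative_ident])

lemma D_sum: "(\<And>i. i \<in> I \<Longrightarrow> C_inf_on (f i) UNIV) \<Longrightarrow> D a (\<lambda>y. \<Sum>i\<in>I. f i y) x = (\<Sum>i\<in>I. D a (f i) x)"
  by (rule D_eqI[OF has_derivative_sum]) (auto intro: C_inf_on_has_derivative)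

lemma D_param_linear:
  assumes "\<And>y. linear (f y)" "\<And>u. C_inf_on (\<lambda>y. f y u :: real) UNIV"
  shows "linear (\<lambda>u. D a (\<lambda>y. f y u) x)"
proof (rule linearI)
  fix u v
  show "D a (\<lambda>y. f y (u + v)) x = D a (\<lambda>y. f y u) x + D a (\<lambda>y. f y v) x"
    unfolding linear_add[OF assms(1)] by (rule D_add[OF assms(2) assms(2)])
  fix c show "D a (\<lambda>y. f y (c *\<^sub>R u)) x = c *\<^sub>R D a (\<lambda>y. f y u) x"
    unfolding linear_cmul[OF assms(1)] real_scaleR_def by (rule D_cmult[OF assms(2)])
qed

text \<open>The product rule for a linear form that depends on the point, applied to a vector field. With the
  position field \<open>c y = y\<close> it turns pointwise identities such as \<open>P y y v = 0\<close> into identities between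
  derivatives.\<close>

lemma
  fixes f :: "'b::real_normed_vector \<Rightarrow> 'a::euclidean_space \<Rightarrow> real"
  assumes f: "\<And>y. linear (f y)" "\<And>u. C_inf_on (\<lambda>y. f y u) UNIV" and c: "C_inf_on c UNIV"
  shows C_inf_on_param_linear_apply: "C_inf_on (\<lambda>y. f y (c y)) UNIV"
    and D_param_linear_apply: "D a (\<lambda>y. f y (c y)) x = D a (\<lambda>y. f y (c x)) x + f x (D a c x)"
proof -
  have ex: "f y w = (\<Sum>i\<in>Basis. (w \<bullet> i) * f y i)" for y w
  proof -
    have "f y w = f y (\<Sum>i\<in>Basis. (w \<bullet> i) *\<^sub>R i)" by (simp only: euclidean_representation)
    then show ?thesis by (simp only: linear_sum[OF f(1)] linear_cmul[OF f(1)] real_scaleR_def)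
  qed
  have ci: "C_inf_on (\<lambda>y. c y \<bullet> i) UNIV" for i
    by (intro C_inf_on_inner C_inf_on_const c open_UNIV)
  have Dci: "D a (\<lambda>y. c y \<bullet> i) x = D a c x \<bullet> i" for i
    by (rule D_eqI[OF has_derivative_inner_left]) (rule C_inf_on_has_derivative[OF c UNIV_I])
  have sm: "C_inf_on (\<lambda>y. (c y \<bullet> i) * f y i) UNIV" for i
    by (intro C_inf_on_mult ci f open_UNIV)
  have eq: "(\<lambda>y. f y (c y)) = (\<lambda>y. \<Sum>i\<in>Basis. (c y \<bullet> i) * f y i)" by (intro ext ex)
  show "C_inf_on (\<lambda>y. f y (c y)) UNIV" unfolding eq by (intro C_inf_on_sum sm open_UNIV)
  have "D a (\<lambda>y. f y (c y)) x = (\<Sum>i\<in>Basis. (c x \<bullet> i) * D a (\<lambda>y. f y i) x + (D a c x \<bullet> i) * f x i)"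
    unfolding eq by (simp only: D_sum[OF sm] D_mult[OF ci f(2)] Dci)
  also have "\<dots> = (\<Sum>i\<in>Basis. (c x \<bullet> i) * D a (\<lambda>y. f y i) x) + f x (D a c x)"
    by (simp only: sum.distrib ex[of x "D a c x"])
  also have "(\<Sum>i\<in>Basis. (c x \<bullet> i) * D a (\<lambda>y. f y i) x) = D a (\<lambda>y. f y (c x)) x"
  proof -
    have l: "linear (\<lambda>u. D a (\<lambda>y. f y u) x)" by (rule D_param_linear[OF f])
    have "D a (\<lambda>y. f y (\<Sum>i\<in>Basis. (c x \<bullet> i) *\<^sub>R i)) x = (\<Sum>i\<in>Basis. (c x \<bullet> i) * D a (\<lambda>y. f y i) x)"
      by (simp only: linear_sum[OF l] linear_cmul[OF l] real_scaleR_def)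
    then show ?thesis by (simp only: euclidean_representation)
  qed
  finally show "D a (\<lambda>y. f y (c y)) x = D a (\<lambda>y. f y (c x)) x + f x (D a c x)" .
qed

lemma C_inf_on_prod:
  fixes f :: "'i \<Rightarrow> 'a::real_normed_vector \<Rightarrow> real"
  assumes "open U" "\<And>i. i \<in> I \<Longrightarrow> C_inf_on (f i) U"
  shows "C_inf_on (\<lambda>x. \<Prod>i\<in>I. f i x) U"
  using assms(2) by (induction I rule: infinite_finite_induct) (auto intro: C_inf_on_const C_inf_on_mult assms(1))

lemma C_inf_on_det:
  fixes A :: "'a::real_normed_vector \<Rightarrow> real^'m^'m"
  assumes "open U" "\<And>i j. C_inf_on (\<lambda>x. A x $ i $ j) U"
  shows "C_inf_on (\<lambda>x. det (A x)) U"
  unfolding det_def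
  by (intro C_inf_on_sum C_inf_on_mult C_inf_on_prod C_inf_on_const assms)

lemma linear_of_axes:
  fixes l :: "real^'m \<Rightarrow> real" assumes l: "linear l"
  shows "l w = (\<Sum>j\<in>UNIV. w $ j * l (axis j 1))"
proof -
  have "l w = l (\<Sum>i\<in>UNIV. w $ i *\<^sub>R axis i 1)"
    using basis_expansion[of w] by (simp only: scalar_mult_eq_scaleR)
  then show ?thesis by (simp only: linear_sum[OF l] linear_cmul[OF l] real_scaleR_def)
qed

locale smooth_metric =
  fixes g :: "real^'m \<Rightarrow> real^'m \<Rightarrow> real^'m \<Rightarrow> real"
  assumes form: "pos_form (g x)"
    and smooth: "C_inf_on (\<lambda>y. g y u v) UNIV"
begin

abbreviation \<Gamma> where "\<Gamma> \<equiv> christoffel g"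

lemma lin1: "linear (\<lambda>u. g x u v)" and lin2: "linear (g x u)" and gsym: "g x u v = g x v u"
  using form[of x] by (auto simp: pos_form.linear_left pos_form.linear_right intro: pos_form.sym)

lemmas g_simps = pos_form.bilinear_simps[OF form]

text \<open>Koszul's expression for \<open>2 g(\<Gamma>(u, v), w)\<close>.\<close>

definition K where
  "K x u v w = D u (\<lambda>y. g y v w) x + D v (\<lambda>y. g y u w) x - D w (\<lambda>y. g y u v) x"

lemma dg_lin: "linear (\<lambda>a. D a (\<lambda>y. g y u v) x)" "linear (\<lambda>u. D a (\<lambda>y. g y u v) x)" "linear (\<lambda>v. D a (\<lambda>y. g y u v) x)"
  by (rule D_linear_dir[OF smooth] D_param_linear[OF lin1 smooth] D_param_linear[OF lin2 smooth])+

lemma K_lin: "linear (\<lambda>u. K x u v w)" "linear (\<lambda>v. K x u v w)" "linear (\<lambda>w. K x u v w)"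
  unfolding K_def by (intro linear_compose_add linear_compose_sub dg_lin)+

lemma K_smooth: "C_inf_on (\<lambda>y. K y u v w) UNIV"
  unfolding K_def by (intro C_inf_on_add C_inf_on_diff C_inf_on_D smooth open_UNIV)

lemma christoffel_spec: "g x (\<Gamma> x u v) w = K x u v w / 2"
proof -
  have "linear (\<lambda>w. K x u v w / 2)"
    using linear_compose_scale_right[OF K_lin(3), of "1/2"] by simp
  from pos_form.riesz[OF form this] have
    "\<exists>!c. \<forall>w. 2 * g x c w = K x u v w" by (simp add: field_simps)
  from theI'[OF this] have "2 * g x (\<Gamma> x u v) w = K x u v w"
    unfolding christoffel_def K_def D_def by blast
  then show ?thesis by simp
qed

lemma g_eqI: assumes "\<And>w. g x c w = g x c' w" shows "c = c'"
proof -
  have "g x (c - c') (c - c') = 0" using assms by (simp add: g_simps)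
  then show ?thesis using pos_form.eq_0_iff[OF form] by simp
qed

lemma \<Gamma>_lin1: "linear (\<lambda>u. \<Gamma> x u v)"
proof (rule linearI)
  fix a b c
  show "\<Gamma> x (a + b) v = \<Gamma> x a v + \<Gamma> x b v"
    by (rule g_eqI[of x]) (simp add: g_simps christoffel_spec linear_add[OF K_lin(1)] add_divide_distrib)
  show "\<Gamma> x (c *\<^sub>R b) v = c *\<^sub>R \<Gamma> x b v"
    by (rule g_eqI[of x]) (simp add: g_simps christoffel_spec linear_cmul[OF K_lin(1)])
qed

lemma \<Gamma>_lin2: "linear (\<Gamma> x u)"
proof (rule linearI)
  fix a b c
  show "\<Gamma> x u (a + b) = \<Gamma> x u a + \<Gamma> x u b"
    by (rule g_eqI[of x]) (simp add: g_simps christoffel_spec linear_add[OF K_lin(2)] add_divide_distrib)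
  show "\<Gamma> x u (c *\<^sub>R b) = c *\<^sub>R \<Gamma> x u b"
    by (rule g_eqI[of x]) (simp add: g_simps christoffel_spec linear_cmul[OF K_lin(2)])
qed

lemma dg: "D a (\<lambda>y. g y u v) x = g x (\<Gamma> x a u) v + g x u (\<Gamma> x a v)"
proof -
  have "g x u (\<Gamma> x a v) = g x (\<Gamma> x a v) u" by (rule gsym)
  moreover have "(\<lambda>y. g y v u) = (\<lambda>y. g y u v)" by (intro ext gsym)
  ultimately show ?thesis by (simp only: christoffel_spec K_def) (simp add: field_simps)
qed

text \<open>The Christoffel symbol solves a linear system with smooth coefficients, and Cramer's rule gives its
  components as quotients of determinants. This is what allows the curvature to differentiate it.\<close>

lemma \<Gamma>_smooth: "C_inf_on (\<lambda>y. \<Gamma> y u v) UNIV"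
proof -
  define A where "A y = (\<chi> i j. g y (axis i 1) (axis j 1))" for y
  define b where "b y = (\<chi> i. K y u v (axis i 1) / 2)" for y
  have Ac: "A y *v c = (\<chi> i. g y c (axis i 1))" for y c
    using linear_of_axes[OF lin2, of y _ c]
    by (simp add: A_def matrix_vector_mult_def vec_eq_iff gsym[of y c] mult.commute)
  have "A y *v c = 0 \<Longrightarrow> c = 0" for y c
  proof (rule g_eqI[of y])
    fix w assume "A y *v c = 0"
    then have "g y c (axis i 1) = 0" for i unfolding Ac by (simp add: vec_eq_iff)
    then show "g y c w = g y 0 w" using linear_of_axes[OF lin2, of y c w] by (simp add: g_simps)
  qed
  then have det: "det (A y) \<noteq> 0" for y
    using matrix_left_invertible_ker[of "A y"] invertible_left_inverse[of "A y"] invertible_det_nz[of "A y"] by blast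
  have "A y *v \<Gamma> y u v = b y" for y
    unfolding Ac b_def by (simp add: christoffel_spec)
  then have comp: "\<Gamma> y u v $ k = det (\<chi> i j. if j = k then b y $ i else A y $ i $ j) / det (A y)" for y k
    using cramer[OF det, of y "\<Gamma> y u v" "b y"] by simp
  have b: "C_inf_on (\<lambda>y. b y $ i) UNIV" for i
    using C_inf_on_mult[OF open_UNIV C_inf_on_const K_smooth, of "1/2" u v "axis i 1"] by (simp add: b_def)
  have Asm: "C_inf_on (\<lambda>y. A y $ i $ j) UNIV" for i j
    by (simp add: A_def smooth)
  have cs: "C_inf_on (\<lambda>y. \<Gamma> y u v $ k) UNIV" for k
    unfolding comp
  proof (intro C_inf_on_divide C_inf_on_det open_UNIV)
    fix i j
    show "C_inf_on (\<lambda>x. (\<chi> i j. if j = k then b x $ i else A x $ i $ j) $ i $ j) UNIV"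
      by (cases "j = k") (simp_all add: b Asm)
  qed (simp_all add: Asm det)
  have "(\<lambda>y. \<Gamma> y u v) = (\<lambda>y. \<Sum>k\<in>UNIV. (\<Gamma> y u v $ k) *\<^sub>R axis k 1)"
  proof
    fix y show "\<Gamma> y u v = (\<Sum>k\<in>UNIV. (\<Gamma> y u v $ k) *\<^sub>R axis k 1)"
      using basis_expansion[of "\<Gamma> y u v"] by (simp only: scalar_mult_eq_scaleR)
  qed
  moreover have "C_inf_on (\<lambda>y. \<Sum>k\<in>UNIV. (\<Gamma> y u v $ k) *\<^sub>R axis k 1) UNIV" by (intro C_inf_on_sum C_inf_on_scaleR C_inf_on_const cs open_UNIV)
  ultimately show ?thesis by (simp only:)
qed

text \<open>Differentiate \<open>g(\<Gamma>(u, v), z) = K(u, v, z) / 2\<close>; the derivative of \<open>g\<close> is replaced by means of \<open>dg\<close>.\<close>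

lemma g_D\<Gamma>:
  "g x (D a (\<lambda>y. \<Gamma> y u v) x) z
    = D a (\<lambda>y. K y u v z) x / 2 - g x (\<Gamma> x a (\<Gamma> x u v)) z - g x (\<Gamma> x u v) (\<Gamma> x a z)"
proof -
  have "D a (\<lambda>y. g y (\<Gamma> y u v) z) x = D a (\<lambda>y. g y (\<Gamma> x u v) z) x + g x (D a (\<lambda>y. \<Gamma> y u v) x) z"
    by (rule D_param_linear_apply[OF lin1 smooth \<Gamma>_smooth])
  moreover have "D a (\<lambda>y. g y (\<Gamma> y u v) z) x = D a (\<lambda>y. K y u v z) x / 2"
    using D_cmult[OF K_smooth, of a "1/2" u v z x] by (simp add: christoffel_spec)
  ultimately show ?thesis unfolding dg by linarith
qed

text \<open>All derivatives are those of the explicit expression \<open>K\<close>; the Christoffel symbol itself enters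
  algebraically.\<close>

lemma Rm_formula:
  "Rm g x u v z w = (D u (\<lambda>y. K y v w z) x - D v (\<lambda>y. K y u w z) x) / 2
     - g x (\<Gamma> x v w) (\<Gamma> x u z) + g x (\<Gamma> x u w) (\<Gamma> x v z)"
proof -
  have c: "frechet_derivative (\<lambda>_. c) (at y) = (\<lambda>_. 0)" for c y :: "real^'m"
    by (rule frechet_derivative_const)
  have n: "nabla g (\<lambda>_. v) (\<lambda>_. w) = (\<lambda>y. \<Gamma> y v w)" for v w
    by (rule ext) (simp add: nabla_def c)
  have l: "lie_bracket (\<lambda>_. u) (\<lambda>_. v) = (\<lambda>_. 0)" by (rule ext) (simp add: lie_bracket_def c)
  have 0: "\<Gamma> x 0 w = 0" by (rule linear_0[OF \<Gamma>_lin1])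
  have "curvature g (\<lambda>_. u) (\<lambda>_. v) (\<lambda>_. w) x
    = (D u (\<lambda>y. \<Gamma> y v w) x + \<Gamma> x u (\<Gamma> x v w)) - (D v (\<lambda>y. \<Gamma> y u w) x + \<Gamma> x v (\<Gamma> x u w))"
    unfolding curvature_def n l by (simp add: nabla_def c 0 D_def)
  then show ?thesis unfolding Rm_def
    by (simp only: g_simps g_D\<Gamma>) (simp add: field_simps)
qed

lemma Rm_antisym1: "Rm g x v u z w = - Rm g x u v z w"
  unfolding Rm_formula diff_divide_distrib by linarith

lemma DK: "D a (\<lambda>y. K y u v w) x = D a (D u (\<lambda>y. g y v w)) x + D a (D v (\<lambda>y. g y u w)) x - D a (D w (\<lambda>y. g y u v)) x"
  unfolding K_def by (simp only: D_add D_diff C_inf_on_D[OF smooth] C_inf_on_add[OF open_UNIV])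

text \<open>The second derivatives of \<open>g(w, z)\<close> occur in both orders and cancel by \<open>D_commute\<close>; the other terms
  change sign when \<open>w\<close> and \<open>z\<close> are exchanged.\<close>

lemma Rm_antisym2: "Rm g x u v w z = - Rm g x u v z w"
proof -
  have s: "(\<lambda>y. g y z w) = (\<lambda>y. g y w z)" by (intro ext gsym)
  have c: "D u (D v (\<lambda>y. g y w z)) x = D v (D u (\<lambda>y. g y w z)) x" by (rule D_commute[OF smooth])
  have t: "g x (\<Gamma> x v z) (\<Gamma> x u w) = g x (\<Gamma> x u w) (\<Gamma> x v z)" "g x (\<Gamma> x u z) (\<Gamma> x v w) = g x (\<Gamma> x v w) (\<Gamma> x u z)"
    by (rule gsym)+
  show ?thesis unfolding Rm_formula DK s c t diff_divide_distrib add_divide_distrib by linarith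
qed

lemma Rm_multilinear: "multilinear4 (Rm g x)"
proof -
  have G: "linear (\<lambda>u. g x (\<Gamma> x v w) (\<Gamma> x u z))" "linear (\<lambda>z. g x (\<Gamma> x v w) (\<Gamma> x u z))"
    "linear (\<lambda>v. g x (\<Gamma> x v w) (\<Gamma> x u z))" "linear (\<lambda>w. g x (\<Gamma> x v w) (\<Gamma> x u z))" for u v w z
    using linear_compose[OF \<Gamma>_lin1 lin2] linear_compose[OF \<Gamma>_lin2 lin2]
      linear_compose[OF \<Gamma>_lin1 lin1] linear_compose[OF \<Gamma>_lin2 lin1] by (simp_all only: o_def)
  have h: "linear (\<lambda>u. f u / 2)" if "linear f" for f :: "real^'m \<Rightarrow> real"
    using linear_compose_scale_right[OF that, of "1/2"] by simp
  show ?thesis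
    unfolding multilinear4_def Rm_formula
    by (intro conjI allI linear_compose_add linear_compose_sub h G D_linear_dir K_smooth
        D_param_linear K_lin)
qed

lemma space_metric: "space_metric g"
  unfolding riemannian_metric_def tangent_field_def smooth_map_UNIV
proof (intro conjI ballI allI impI)
  fix V W :: "real^'m \<Rightarrow> real^'m" assume "C_inf_on V UNIV \<and> (\<forall>x\<in>UNIV. V x \<in> UNIV)" "C_inf_on W UNIV \<and> (\<forall>x\<in>UNIV. W x \<in> UNIV)"
  then have V: "C_inf_on V UNIV" and W: "C_inf_on W UNIV" by auto
  show "C_inf_on (\<lambda>x. g x (V x) (W x)) UNIV"
    by (rule C_inf_on_param_linear_apply[OF lin1 C_inf_on_param_linear_apply[OF lin2 smooth W] V])
qed (auto simp: g_simps pos_form.pos[OF form] intro: gsym)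

end

section \<open>Radial perturbations of the hyperbolic metric\<close>

text \<open>The component of \<open>u\<close> tangent to the sphere around the origin through \<open>x\<close>.\<close>

definition tang :: "real^'m \<Rightarrow> real^'m \<Rightarrow> real^'m" where
  "tang x u = u - ((x \<bullet> u) / (x \<bullet> x)) *\<^sub>R x"

lemma tang_orth: "x \<noteq> 0 \<Longrightarrow> tang x u \<bullet> x = 0"
  by (simp add: tang_def inner_diff_left inner_commute[of u x])

lemma tang_decomp: "u = tang x u + ((x \<bullet> u) / (x \<bullet> x)) *\<^sub>R x"
  by (simp add: tang_def)

text \<open>A symmetric tensor field that vanishes on the position vector, is supported in an annulus and leaves
  the Euclidean metric positive definite on the spheres (constant \<open>c\<close>). The first and second
  derivatives along the position vector are bounded by a \<open>\<delta>\<close> of their own, as only these have to be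
  small.\<close>

locale radial_perturbation =
  fixes P :: "real^'m \<Rightarrow> real^'m \<Rightarrow> real^'m \<Rightarrow> real" and r0 r1 c M0 \<delta> :: real
  assumes P_lin1: "linear (\<lambda>u. P x u v)"
    and P_sym: "P x u v = P x v u"
    and P_smooth: "C_inf_on (\<lambda>y. P y u v) UNIV"
    and P_rad: "P x x v = 0"
    and r0: "0 < r0" "r0 \<le> r1"
    and P_supp: "norm x < r0 \<or> r1 < norm x \<Longrightarrow> P x u v = 0"
    and c: "0 < c" "c \<le> 1"
    and elliptic: "a \<bullet> x = 0 \<Longrightarrow> c * (a \<bullet> a) \<le> a \<bullet> a + P x a a"
    and P_bound: "\<bar>P x u v\<bar> \<le> M0 * norm u * norm v"
    and Q_bound: "\<bar>D x (\<lambda>y. P y u v) x\<bar> \<le> \<delta> * norm u * norm v"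
    and DQ_bound: "\<bar>D x (\<lambda>y. D y (\<lambda>z. P z u v) y) x\<bar> \<le> \<delta> * norm u * norm v"
begin

definition dP where "dP x a u v = D a (\<lambda>y. P y u v) x"
definition Q where "Q x u v = dP x x u v"

lemma P_lin2: "linear (P x u)"
proof -
  have "P x u = (\<lambda>w. P x w u)" by (rule ext) (rule P_sym)
  then show ?thesis using P_lin1[of x u] by (simp only:)
qed

lemma P_rad2: "P x v x = 0" by (subst P_sym) (rule P_rad)

lemmas P_simps = linear_add[OF P_lin1] linear_add[OF P_lin2] linear_diff[OF P_lin1] linear_diff[OF P_lin2]
  linear_cmul[OF P_lin1] linear_cmul[OF P_lin2] linear_0[OF P_lin1] linear_0[OF P_lin2] P_rad P_rad2

lemma dP_lin: "linear (\<lambda>a. dP x a u v)" "linear (\<lambda>u. dP x a u v)" "linear (\<lambda>v. dP x a u v)"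
  unfolding dP_def
  by (rule D_linear_dir[OF P_smooth] D_param_linear[OF P_lin1 P_smooth] D_param_linear[OF P_lin2 P_smooth])+

lemma dP_smooth: "C_inf_on (\<lambda>y. dP y a u v) UNIV"
  unfolding dP_def by (rule C_inf_on_D[OF P_smooth])

lemma dP_sym: "dP x a u v = dP x a v u"
proof -
  have "(\<lambda>y. P y u v) = (\<lambda>y. P y v u)" by (intro ext P_sym)
  then show ?thesis by (simp only: dP_def)
qed

text \<open>Differentiation of \<open>P y y v = 0\<close>.\<close>

lemma dP_rad: "dP x a x v = - P x a v"
  using D_param_linear_apply[OF P_lin1 P_smooth C_inf_on_id, of a v x]
  by (simp add: P_rad D_const D_ident dP_def)

lemma dP_rad2: "dP x a v x = - P x a v"
  by (subst dP_sym) (rule dP_rad)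

lemma Q_lin: "linear (\<lambda>u. Q x u v)" "linear (\<lambda>v. Q x u v)"
  unfolding Q_def by (rule dP_lin)+

lemma Q_smooth: "C_inf_on (\<lambda>y. Q y u v) UNIV"
  unfolding Q_def by (rule C_inf_on_param_linear_apply[OF dP_lin(1) dP_smooth C_inf_on_id])

lemma Q_rad: "Q x x v = 0" "Q x v x = 0"
  by (simp_all add: Q_def dP_rad dP_rad2 P_rad)

end

locale perturbed = radial_perturbation P r0 r1 c M0 \<delta>
  for P :: "real^'m \<Rightarrow> real^'m \<Rightarrow> real^'m \<Rightarrow> real" and r0 r1 c M0 \<delta> +
  fixes \<epsilon> :: real
  assumes \<epsilon>: "0 < \<epsilon>"
begin

text \<open>For \<open>P = 0\<close> the metric \<open>G\<close> is induced by \<open>x \<mapsto> (x, sqrt (\<epsilon>\<^sup>2 + x \<bullet> x))\<close> from Minkowski space, where the image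
  is a sheet of a hyperboloid of curvature \<open>- \<kappa>\<close>. The form \<open>h x\<close> is \<open>\<kappa>\<close> times the form dual to the
  position vector (\<open>\<kappa>G_x\<close>). The expression \<open>C\<close> is what \<open>P\<close> adds to \<open>- 2 G(u, v) h(w)\<close> in Koszul's formula
  (\<open>K_eq\<close>), and \<open>- S\<close> is its value on the position vector in the last slot (\<open>C_rad3\<close>).\<close>

definition q where "q y = \<epsilon>\<^sup>2 + y \<bullet> y" for y :: "real^'m"
definition h where "h y z = (y \<bullet> z) / q y" for y z :: "real^'m"
definition G where "G y u v = u \<bullet> v - (y \<bullet> u) * (y \<bullet> v) / q y + P y u v"
definition \<kappa> where "\<kappa> = 1 / \<epsilon>\<^sup>2"
definition C where "C x u v w = dP x u v w + dP x v u w - dP x w u v + 2 * P x u v * h x w"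
definition S where "S x u v = 2 * \<epsilon>\<^sup>2 * P x u v / q x + Q x u v"

lemma q_pos: "0 < q y" using \<epsilon> by (simp add: q_def add_pos_nonneg)

lemma q_smooth: "C_inf_on q UNIV"
  unfolding q_def[abs_def] by (intro C_inf_on_add C_inf_on_const C_inf_on_inner C_inf_on_id open_UNIV)

lemma q_has_derivative: "(q has_derivative (\<lambda>a. 2 * (x \<bullet> a))) (at x)"
  unfolding q_def[abs_def] by (auto intro!: derivative_eq_intros simp: inner_commute)

lemma h_smooth: "C_inf_on (\<lambda>y. h y z) UNIV"
  unfolding h_def using q_pos
  by (intro C_inf_on_divide q_smooth C_inf_on_inner C_inf_on_id C_inf_on_const open_UNIV) (simp add: less_imp_neq[symmetric])

lemma G_h: "G y u v = u \<bullet> v - q y * h y u * h y v + P y u v"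
  using q_pos[of y] by (simp add: G_def h_def)

lemma G_smooth: "C_inf_on (\<lambda>y. G y u v) UNIV"
  unfolding G_h
  by (intro C_inf_on_add C_inf_on_diff C_inf_on_mult q_smooth h_smooth C_inf_on_const P_smooth open_UNIV)

lemma G_lin1: "linear (\<lambda>u. G x u v)"
  by (rule linearI) (simp_all add: G_def P_simps inner_add_left inner_add_right field_simps add_divide_distrib)

lemma G_sym: "G x u v = G x v u"
  by (simp add: G_def inner_commute P_sym[of x u v])

lemma G_x: "G x x w = \<epsilon>\<^sup>2 * h x w"
proof -
  have "x \<bullet> w = q x * h x w" using q_pos[of x] by (simp add: h_def)
  moreover have "G x x w = x \<bullet> w - (x \<bullet> x) * h x w" by (simp add: G_def h_def P_rad)
  ultimately show ?thesis by (simp add: q_def algebra_simps)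
qed

text \<open>The tangential and the radial part are orthogonal, because \<open>P\<close> ignores radial vectors.\<close>

lemma G_decomp:
  assumes "x \<noteq> 0"
  shows "G x u u = tang x u \<bullet> tang x u + P x (tang x u) (tang x u) + ((x \<bullet> u) / (x \<bullet> x))\<^sup>2 * (\<epsilon>\<^sup>2 * (x \<bullet> x) / q x)"
proof -
  define a where "a = tang x u"
  define l where "l = (x \<bullet> u) / (x \<bullet> x)"
  have u: "u = a + l *\<^sub>R x" unfolding a_def l_def by (rule tang_decomp)
  have ax: "a \<bullet> x = 0" "x \<bullet> a = 0" unfolding a_def using tang_orth[OF assms] by (simp_all add: inner_commute)
  have "G x u u = a \<bullet> a + P x a a + l\<^sup>2 * ((x \<bullet> x) - (x \<bullet> x) * (x \<bullet> x) / q x)"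
    unfolding G_def u by (simp add: P_simps inner_add_left inner_add_right ax power2_eq_square algebra_simps)
  also have "(x \<bullet> x) - (x \<bullet> x) * (x \<bullet> x) / q x = \<epsilon>\<^sup>2 * (x \<bullet> x) / q x"
    using q_pos[of x] by (simp add: q_def field_simps)
  finally show ?thesis by (simp add: a_def l_def)
qed

lemma G_ge: "x \<noteq> 0 \<Longrightarrow> c * (tang x u \<bullet> tang x u) + ((x \<bullet> u) / (x \<bullet> x))\<^sup>2 * (\<epsilon>\<^sup>2 * (x \<bullet> x) / q x) \<le> G x u u"
  using G_decomp[of x u] elliptic[OF tang_orth, of x u] by simp

lemma G_lower: "c * \<epsilon>\<^sup>2 / q x * (u \<bullet> u) \<le> G x u u"
proof (cases "x = 0")
  case True
  have "P 0 u u = 0" using r0 by (intro P_supp) simp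
  then have "G x u u = u \<bullet> u" using True by (simp add: G_def)
  moreover have "c * \<epsilon>\<^sup>2 / q x \<le> 1" using c \<epsilon> True by (simp add: q_def)
  ultimately show ?thesis using mult_right_mono[of "c * \<epsilon>\<^sup>2 / q x" 1 "u \<bullet> u"] by simp
next
  case False
  define a where "a = tang x u"
  define l where "l = (x \<bullet> u) / (x \<bullet> x)"
  have u: "u = a + l *\<^sub>R x" unfolding a_def l_def by (rule tang_decomp)
  have ax: "a \<bullet> x = 0" "x \<bullet> a = 0" unfolding a_def using tang_orth[OF False] by (simp_all add: inner_commute)
  have uu: "u \<bullet> u = a \<bullet> a + l\<^sup>2 * (x \<bullet> x)"
    unfolding u by (simp add: inner_add_left inner_add_right ax power2_eq_square)
  have e: "\<epsilon>\<^sup>2 / q x \<le> 1" "0 \<le> \<epsilon>\<^sup>2 / q x" using q_pos[of x] by (simp_all add: q_def)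
  have "c * \<epsilon>\<^sup>2 / q x * (u \<bullet> u) = (\<epsilon>\<^sup>2 / q x) * (c * (a \<bullet> a)) + c * (l\<^sup>2 * (\<epsilon>\<^sup>2 * (x \<bullet> x) / q x))"
    unfolding uu using q_pos[of x] by (simp add: field_simps)
  also have "\<dots> \<le> 1 * (c * (a \<bullet> a)) + 1 * (l\<^sup>2 * (\<epsilon>\<^sup>2 * (x \<bullet> x) / q x))"
    using e c q_pos[of x] by (intro add_mono mult_right_mono) auto
  also have "\<dots> \<le> G x u u" using G_ge[OF False, of u] by (simp add: a_def l_def)
  finally show ?thesis .
qed

lemma G_pos_form: "pos_form (G x)"
proof (rule pos_form.intro[OF G_lin1 G_sym])
  fix u :: "real^'m" assume "u \<noteq> 0"
  then have "0 < c * \<epsilon>\<^sup>2 / q x * (u \<bullet> u)" using c \<epsilon> q_pos[of x] by simp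
  then show "0 < G x u u" using G_lower[of x u] by linarith
qed

sublocale smooth_metric G
  by (rule smooth_metric.intro[OF G_pos_form G_smooth])

lemma D_h: "D a (\<lambda>y. h y z) x = (a \<bullet> z) / q x - 2 * h x z * h x a"
proof (rule D_eqI)
  have "((\<lambda>y. y \<bullet> z) has_derivative (\<lambda>a. a \<bullet> z)) (at x)"
    by (auto intro!: derivative_eq_intros)
  with q_has_derivative have "((\<lambda>y. (y \<bullet> z) / q y) has_derivative (\<lambda>a. ((a \<bullet> z) * q x - (x \<bullet> z) * (2 * (x \<bullet> a))) / (q x * q x))) (at x)"
    using q_pos[of x] by (intro has_derivative_divide') auto
  moreover have "((a \<bullet> z) * q x - (x \<bullet> z) * (2 * (x \<bullet> a))) / (q x * q x) = (a \<bullet> z) / q x - 2 * h x z * h x a" for a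
    using q_pos[of x] by (simp add: h_def field_simps)
  ultimately show "((\<lambda>y. h y z) has_derivative (\<lambda>a. (a \<bullet> z) / q x - 2 * h x z * h x a)) (at x)"
    by (simp only: h_def[of _ z])
qed

lemma D_G: "D a (\<lambda>y. G y u v) x
   = - ((a \<bullet> u) * h x v + h x u * (a \<bullet> v)) + 2 * (x \<bullet> a) * h x u * h x v + dP x a u v"
proof -
  have s3: "C_inf_on (\<lambda>y. y \<bullet> u) UNIV" by (intro C_inf_on_inner C_inf_on_const C_inf_on_id open_UNIV)
  have s2: "C_inf_on (\<lambda>y. (y \<bullet> u) * h y v) UNIV" by (rule C_inf_on_mult[OF open_UNIV s3 h_smooth])
  have s1: "C_inf_on (\<lambda>y. u \<bullet> v - (y \<bullet> u) * h y v) UNIV"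
    by (rule C_inf_on_diff[OF open_UNIV C_inf_on_const s2])
  have eq: "(\<lambda>y. G y u v) = (\<lambda>y. (u \<bullet> v - (y \<bullet> u) * h y v) + P y u v)"
    by (simp add: G_def h_def fun_eq_iff)
  have "D a (\<lambda>y. G y u v) x = D a (\<lambda>y. u \<bullet> v - (y \<bullet> u) * h y v) x + dP x a u v"
    unfolding eq dP_def by (rule D_add[OF s1 P_smooth])
  moreover have "D a (\<lambda>y. u \<bullet> v - (y \<bullet> u) * h y v) x = 0 - ((x \<bullet> u) * D a (\<lambda>y. h y v) x + D a (\<lambda>y. y \<bullet> u) x * h x v)"
    by (simp only: D_diff[OF C_inf_on_const s2] D_const D_mult[OF s3 h_smooth])
  moreover have "D a (\<lambda>y. y \<bullet> u) x = a \<bullet> u"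
    by (rule D_eqI) (auto intro!: derivative_eq_intros)
  moreover have "x \<bullet> u = q x * h x u" using q_pos[of x] by (simp add: h_def)
  moreover have "q x * h x u * (a \<bullet> v / q x) = h x u * (a \<bullet> v)" using q_pos[of x] by simp
  moreover have "q x * h x u * (2 * h x v * h x a) = 2 * (x \<bullet> a) * h x u * h x v"
    using q_pos[of x] by (simp add: h_def[of x a])
  ultimately show ?thesis by (simp add: D_h right_diff_distrib)
qed

text \<open>For \<open>P = 0\<close> this says that the Christoffel symbol is \<open>- \<kappa> G(u, v) x\<close>.\<close>

lemma K_eq: "K x u v w = - 2 * G x u v * h x w + C x u v w"
proof -
  have *: "x \<bullet> u = q x * h x u" "x \<bullet> v = q x * h x v" "x \<bullet> w = q x * h x w" using q_pos[of x] by (simp_all add: h_def)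
  show ?thesis unfolding K_def D_G C_def unfolding G_h *
    by (simp add: inner_commute[of v u] inner_commute[of w u] inner_commute[of w v] algebra_simps)
qed

lemma C_lin: "linear (\<lambda>u. C x u v w)" "linear (\<lambda>v. C x u v w)" "linear (\<lambda>w. C x u v w)"
proof -
  have m: "linear (\<lambda>u. 2 * f u * d)" if "linear f" for f :: "real^'m \<Rightarrow> real" and d
    using linear_compose_scale_right[OF that, of "2 * d"] by (simp add: mult_ac)
  have m': "linear (\<lambda>u. 2 * d * f u)" if "linear f" for f :: "real^'m \<Rightarrow> real" and d
    using linear_compose_scale_right[OF that, of "2 * d"] by simp
  have hl: "linear (h x)" by (rule linearI) (simp_all add: h_def inner_add_right add_divide_distrib)
  show "linear (\<lambda>u. C x u v w)" "linear (\<lambda>v. C x u v w)" "linear (\<lambda>w. C x u v w)"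
    unfolding C_def by (intro linear_compose_add linear_compose_sub dP_lin m m' hl P_lin1 P_lin2)+
qed

lemma C_smooth: "C_inf_on (\<lambda>y. C y u v w) UNIV"
  unfolding C_def
  by (intro C_inf_on_add C_inf_on_diff C_inf_on_mult dP_smooth P_smooth h_smooth C_inf_on_const open_UNIV)

lemma C_sym: "C x u v w = C x v u w"
  unfolding C_def using dP_sym[of x w u v] P_sym[of x u v] by simp

text \<open>On the position vector all tangential derivatives of \<open>P\<close> disappear by \<open>dP_rad\<close>, and only the radial
  derivative \<open>Q\<close> and a term with the factor \<open>\<epsilon>\<^sup>2\<close> remain. The estimate of the curvature rests on this.\<close>

lemma C_rad2: "C x u x w = Q x u w"
  unfolding C_def by (simp add: dP_rad dP_rad2 P_simps Q_def P_sym[of x w u])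

lemma C_rad1: "C x x u w = Q x u w"
  using C_sym[of x x u w] C_rad2 by simp

lemma h_x: "h x x = 1 - \<epsilon>\<^sup>2 / q x"
  using q_pos[of x] by (simp add: h_def q_def field_simps)

lemma C_rad3: "C x u v x = - S x u v"
  unfolding C_def S_def h_x by (simp add: dP_rad2 Q_def P_sym[of x v u] algebra_simps)

text \<open>The part of the Christoffel symbol that is due to \<open>P\<close>.\<close>

definition A where "A x u v = \<Gamma> x u v + (\<kappa> * G x u v) *\<^sub>R x"

lemma \<kappa>_pos: "0 < \<kappa>" using \<epsilon> by (simp add: \<kappa>_def)

lemma \<kappa>G_x: "\<kappa> * G x x w = h x w"
  using \<epsilon> by (simp add: \<kappa>_def G_x)

lemma G_A: "G x (A x u v) w = C x u v w / 2"
proof -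
  have "G x (A x u v) w = G x (\<Gamma> x u v) w + G x u v * (\<kappa> * G x x w)"
    by (simp add: A_def g_simps mult_ac)
  then show ?thesis unfolding \<kappa>G_x christoffel_spec K_eq add_divide_distrib by linarith
qed

lemma G_\<Gamma>\<Gamma>: "G x (\<Gamma> x v w) (\<Gamma> x u z) = \<kappa>\<^sup>2 * G x x x * (G x v w * G x u z)
   + \<kappa> / 2 * G x v w * S x u z + \<kappa> / 2 * G x u z * S x v w + G x (A x v w) (A x u z)"
proof -
  have \<Gamma>: "\<Gamma> x a b = A x a b - (\<kappa> * G x a b) *\<^sub>R x" for a b by (simp add: A_def)
  have "G x (A x a b) x = - S x a b / 2" "G x x (A x a b) = - S x a b / 2" for a b
    using G_A[of x a b x] G_sym[of x x "A x a b"] by (simp_all add: C_rad3)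
  then show ?thesis unfolding \<Gamma> by (simp add: g_simps power2_eq_square algebra_simps)
qed

text \<open>The curvature tensor is twice the part of this expression that is antisymmetric in \<open>u\<close> and \<open>v\<close>. The
  summand \<open>- \<kappa> G(v, w) G(u, z)\<close> gives the hyperbolic curvature; the next one is symmetric in \<open>u\<close> and \<open>v\<close>
  and will drop out.\<close>

lemma half_DK_minus_\<Gamma>\<Gamma>:
  "D u (\<lambda>y. K y v w z) x / 2 - G x (\<Gamma> x v w) (\<Gamma> x u z)
    = - \<kappa> * (G x v w * G x u z)
      + (G x u v * h x w + G x u w * h x v + G x v w * h x u - C x u v w / 2) * h x z
      + (D u (\<lambda>y. C y v w z) x / 2 - C x u w v * h x z / 2 - \<kappa> / 2 * G x v w * Q x u z
          - \<kappa> / 2 * G x u z * S x v w - G x (A x v w) (A x u z))"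
proof -
  have 1: "D u (\<lambda>y. K y v w z) x = - 2 * (G x v w * D u (\<lambda>y. h y z) x + D u (\<lambda>y. G y v w) x * h x z) + D u (\<lambda>y. C y v w z) x"
  proof -
    have s: "C_inf_on (\<lambda>y. G y v w * h y z) UNIV" by (intro C_inf_on_mult G_smooth h_smooth open_UNIV)
    have "D u (\<lambda>y. K y v w z) x = D u (\<lambda>y. - 2 * (G y v w * h y z) + C y v w z) x"
      by (simp only: K_eq mult.assoc)
    also have "\<dots> = D u (\<lambda>y. - 2 * (G y v w * h y z)) x + D u (\<lambda>y. C y v w z) x"
      by (rule D_add[OF C_inf_on_mult[OF open_UNIV C_inf_on_const s] C_smooth])
    finally show ?thesis by (simp only: D_cmult[OF s] D_mult[OF G_smooth h_smooth])
  qed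
  have 2: "D u (\<lambda>y. G y v w) x = - G x u v * h x w - G x u w * h x v + (C x u v w + C x u w v) / 2"
    unfolding dg G_sym[of x v] christoffel_spec K_eq by (simp add: add_divide_distrib diff_divide_distrib)
  have 3: "D u (\<lambda>y. h y z) x = (G x u z - P x u z) / q x - h x u * h x z"
    unfolding D_h G_h using q_pos[of x] by (simp add: field_simps)
  have 4: "G x v w * (G x u z / q x) = \<kappa> * (G x v w * G x u z) - \<kappa>\<^sup>2 * G x x x * (G x v w * G x u z)"
  proof -
    have "1 / q x = \<kappa> - \<kappa>\<^sup>2 * G x x x"
      using \<epsilon> q_pos[of x] by (simp add: \<kappa>_def G_x h_x power2_eq_square field_simps)
    then have "(G x v w * G x u z) * (1 / q x) = (G x v w * G x u z) * (\<kappa> - \<kappa>\<^sup>2 * G x x x)" by simp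
    then show ?thesis by (simp add: algebra_simps)
  qed
  have 5: "G x v w * (P x u z / q x) = \<kappa> / 2 * G x v w * S x u z - \<kappa> / 2 * G x v w * Q x u z"
    using \<epsilon> by (simp add: S_def \<kappa>_def field_simps)
  have "D u (\<lambda>y. K y v w z) x / 2 = - (G x v w * (G x u z / q x)) + G x v w * (P x u z / q x) + G x v w * h x u * h x z
     - D u (\<lambda>y. G y v w) x * h x z + D u (\<lambda>y. C y v w z) x / 2"
    unfolding 1 3 by (simp add: algebra_simps diff_divide_distrib add_divide_distrib)
  then show ?thesis unfolding 2 4 5 G_\<Gamma>\<Gamma> by (simp add: algebra_simps add_divide_distrib diff_divide_distrib)
qed

text \<open>The deviation from the curvature of hyperbolic space.\<close>

definition E where "E x u v z w = Rm G x u v z w + \<kappa> * (G x u z * G x v w - G x u w * G x v z)"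

lemma E_formula:
  "E x u v z w = (D u (\<lambda>y. C y v w z) x - D v (\<lambda>y. C y u w z) x) / 2
    - (C x u w v - C x v w u) * h x z / 2
    - \<kappa> / 2 * (G x v w * Q x u z - G x u w * Q x v z)
    - \<kappa> / 2 * (G x u z * S x v w - G x v z * S x u w)
    - G x (A x v w) (A x u z) + G x (A x u w) (A x v z)"
  using half_DK_minus_\<Gamma>\<Gamma>[of u v w z x] half_DK_minus_\<Gamma>\<Gamma>[of v u w z x] C_sym[of x u v w] G_sym[of x u v]
  unfolding E_def Rm_formula by (simp add: algebra_simps diff_divide_distrib add_divide_distrib)

end

section \<open>Curvature estimate\<close>

text \<open>Uniform bounds for families of multilinear forms, with a weight \<open>N i\<close> on the index. A further argument
  is treated by moving the previous one into the index and its norm into the weight.\<close>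

lemma linear_family_bound:
  fixes F :: "'i \<Rightarrow> real^'m \<Rightarrow> real"
  assumes lin: "\<And>i. linear (F i)" and b: "\<And>j. \<exists>B. \<forall>i. \<bar>F i (axis j 1)\<bar> \<le> B * N i" and N: "\<And>i. 0 \<le> N i"
  shows "\<exists>B. \<forall>i u. \<bar>F i u\<bar> \<le> B * N i * norm u"
proof -
  from b obtain B where B: "\<And>j i. \<bar>F i (axis j 1)\<bar> \<le> B j * N i" by metis
  have "\<bar>F i u\<bar> \<le> (\<Sum>j\<in>UNIV. B j) * N i * norm u" for i u
  proof -
    have "\<bar>F i u\<bar> \<le> (\<Sum>j\<in>UNIV. \<bar>u $ j * F i (axis j 1)\<bar>)"
      unfolding linear_of_axes[OF lin, of i u] by (rule sum_abs)
    also have "\<dots> \<le> (\<Sum>j\<in>UNIV. norm u * (B j * N i))"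
    proof (intro sum_mono)
      fix j
      have "0 \<le> B j * N i" using B[of i j] abs_ge_zero order_trans by blast
      then show "\<bar>u $ j * F i (axis j 1)\<bar> \<le> norm u * (B j * N i)"
        unfolding abs_mult using component_le_norm_cart[of u j] B[of i j] by (intro mult_mono) auto
    qed
    finally show ?thesis by (simp add: sum_distrib_right sum_distrib_left mult_ac)
  qed
  then show ?thesis by blast
qed

lemma bilinear_family_bound:
  fixes T :: "'i \<Rightarrow> real^'m \<Rightarrow> real^'m \<Rightarrow> real"
  assumes lin: "\<And>i v. linear (\<lambda>u. T i u v)" "\<And>i u. linear (T i u)"
    and b: "\<And>j k. \<exists>B. \<forall>i. \<bar>T i (axis j 1) (axis k 1)\<bar> \<le> B * N i" and N: "\<And>i. 0 \<le> N i"
  shows "\<exists>B. \<forall>i u v. \<bar>T i u v\<bar> \<le> B * N i * norm u * norm v"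
proof -
  have "\<exists>B. \<forall>i u. \<bar>T i u (axis k 1)\<bar> \<le> B * N i * norm u" for k
    by (rule linear_family_bound[where F = "\<lambda>i u. T i u (axis k 1)", OF lin(1) b N])
  then have "\<exists>B. \<forall>p v. \<bar>T (fst p) (snd p) v\<bar> \<le> B * (N (fst p) * norm (snd p)) * norm v"
    using N by (intro linear_family_bound[where F = "\<lambda>p v. T (fst p) (snd p) v"] lin) (auto simp: mult.assoc)
  then show ?thesis by (auto simp: mult.assoc)
qed

lemma trilinear_family_bound:
  fixes T :: "'i \<Rightarrow> real^'m \<Rightarrow> real^'m \<Rightarrow> real^'m \<Rightarrow> real"
  assumes lin: "\<And>i u v. linear (\<lambda>a. T i a u v)" "\<And>i a v. linear (\<lambda>u. T i a u v)" "\<And>i a u. linear (T i a u)"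
    and b: "\<And>j k l. \<exists>B. \<forall>i. \<bar>T i (axis j 1) (axis k 1) (axis l 1)\<bar> \<le> B * N i" and N: "\<And>i. 0 \<le> N i"
  shows "\<exists>B. \<forall>i a u v. \<bar>T i a u v\<bar> \<le> B * N i * norm a * norm u * norm v"
proof -
  have "\<exists>B. \<forall>i a. \<bar>T i a (axis k 1) (axis l 1)\<bar> \<le> B * N i * norm a" for k l
    by (rule linear_family_bound[where F = "\<lambda>i a. T i a (axis k 1) (axis l 1)", OF lin(1) b N])
  then have "\<exists>B. \<forall>p u v. \<bar>T (fst p) (snd p) u v\<bar> \<le> B * (N (fst p) * norm (snd p)) * norm u * norm v"
    using N by (intro bilinear_family_bound[where T = "\<lambda>p u v. T (fst p) (snd p) u v"] lin) (auto simp: mult.assoc)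
  then show ?thesis by (auto simp: mult.assoc)
qed

lemma compact_support_bound:
  fixes f :: "'a::euclidean_space \<Rightarrow> real"
  assumes "continuous_on UNIV f" "\<And>x. r < norm x \<Longrightarrow> f x = 0"
  shows "\<exists>B. \<forall>x. \<bar>f x\<bar> \<le> B"
proof -
  have "compact (f ` cball 0 r)"
    using assms(1) by (intro compact_continuous_image continuous_on_subset[OF assms(1)]) auto
  then obtain B where B: "\<And>x. x \<in> cball 0 r \<Longrightarrow> norm (f x) \<le> B"
    using compact_imp_bounded bounded_iff by (metis image_eqI)
  have "\<bar>f x\<bar> \<le> max B 0" for x
    using B[of x] assms(2)[of x] by (cases "norm x \<le> r") auto
  then show ?thesis by blast
qed

context radial_perturbation
begin

definition ddP where "ddP x b a u v = D b (\<lambda>y. dP y a u v) x"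

lemma supp_open: "open {x :: real^'m. norm x < r0 \<or> r1 < norm x}"
  by (intro open_Collect_disj open_Collect_less continuous_intros)

lemma dP_supp: assumes "norm x < r0 \<or> r1 < norm x" shows "dP x a u v = 0"
  using D_cong[OF supp_open, of x "\<lambda>y. P y u v" "\<lambda>y. 0" a] P_supp assms by (simp add: dP_def D_const)

lemma ddP_supp: assumes "norm x < r0 \<or> r1 < norm x" shows "ddP x b a u v = 0"
  using D_cong[OF supp_open, of x "\<lambda>y. dP y a u v" "\<lambda>y. 0" b] dP_supp assms by (simp add: ddP_def D_const)

lemma ddP_lin: "linear (\<lambda>b. ddP x b a u v)" "linear (\<lambda>a. ddP x b a u v)" "linear (\<lambda>u. ddP x b a u v)" "linear (\<lambda>v. ddP x b a u v)"
  unfolding ddP_def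
  by (rule D_linear_dir[OF dP_smooth] D_param_linear[OF dP_lin(1) dP_smooth] D_param_linear[OF dP_lin(2) dP_smooth]
      D_param_linear[OF dP_lin(3) dP_smooth])+

lemma dP_bound_ex: "\<exists>B. \<forall>x a u v. \<bar>dP x a u v\<bar> \<le> B * norm a * norm u * norm v"
proof -
  have "\<exists>B. \<forall>x. \<bar>dP x (axis i 1) (axis j 1) (axis k 1)\<bar> \<le> B * 1" for i j k
    using compact_support_bound[OF C_inf_on_continuous[OF dP_smooth], of r1] dP_supp by simp
  from trilinear_family_bound[where N = "\<lambda>_. 1", OF dP_lin this] show ?thesis by simp
qed

lemma ddP_bound_ex: "\<exists>B. \<forall>x b a u v. \<bar>ddP x b a u v\<bar> \<le> B * norm b * norm a * norm u * norm v"
proof -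
  have b: "\<exists>B. \<forall>x. \<bar>ddP x (axis l 1) (axis i 1) (axis j 1) (axis k 1)\<bar> \<le> B * 1" for i j k l
    using compact_support_bound[OF C_inf_on_continuous[OF C_inf_on_D[OF dP_smooth]], of r1] ddP_supp
    unfolding ddP_def by simp
  have "\<exists>B. \<forall>x a. \<bar>ddP x a (axis i 1) (axis j 1) (axis k 1)\<bar> \<le> B * 1 * norm a" for i j k
    by (rule linear_family_bound[where F = "\<lambda>x a. ddP x a (axis i 1) (axis j 1) (axis k 1)", OF ddP_lin(1) b]) simp
  then have "\<exists>B. \<forall>p a u v. \<bar>ddP (fst p) (snd p) a u v\<bar> \<le> B * norm (snd p) * norm a * norm u * norm v"
    by (intro trilinear_family_bound[where T = "\<lambda>p. ddP (fst p) (snd p)"] ddP_lin) auto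
  then show ?thesis by auto
qed

lemma M0_nonneg: "0 \<le> M0"
proof -
  have "0 \<le> M0 * norm (axis undefined 1 :: real^'m) * norm (axis undefined 1 :: real^'m)"
    using P_bound abs_ge_zero order_trans by blast
  then show ?thesis by simp
qed

lemma \<delta>_nonneg: "0 \<le> \<delta>"
proof -
  have "0 \<le> \<delta> * norm (axis undefined 1 :: real^'m) * norm (axis undefined 1 :: real^'m)"
    using Q_bound abs_ge_zero order_trans by blast
  then show ?thesis by simp
qed

lemma Q_bound': "\<bar>Q x u v\<bar> \<le> \<delta> * norm u * norm v"
  unfolding Q_def dP_def by (rule Q_bound)

lemma DQ_bound': "\<bar>D x (\<lambda>y. Q y u v) x\<bar> \<le> \<delta> * norm u * norm v"
  unfolding Q_def dP_def by (rule DQ_bound)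

end

text \<open>All estimates at one point of the annulus. \<open>M1\<close> and \<open>M2\<close> bound the derivatives of \<open>P\<close> in arbitrary
  directions; they may be large compared with \<open>\<delta>\<close>, but they do not depend on \<open>\<epsilon>\<close>. The condition \<open>\<epsilon> \<le> r0\<close> makes
  \<open>q x\<close> comparable to \<open>x \<bullet> x\<close>.\<close>

locale perturbed_at = perturbed P r0 r1 c M0 \<delta> \<epsilon>
  for P :: "real^'m \<Rightarrow> real^'m \<Rightarrow> real^'m \<Rightarrow> real" and r0 r1 c M0 \<delta> \<epsilon> +
  fixes M1 M2 :: real and x :: "real^'m"
  assumes dP_bound: "\<bar>dP y a u v\<bar> \<le> M1 * norm a * norm u * norm v"
    and ddP_bound: "\<bar>ddP y b a u v\<bar> \<le> M2 * norm b * norm a * norm u * norm v"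
    and x: "r0 \<le> norm x" "norm x \<le> r1"
    and \<epsilon>_r0: "\<epsilon> \<le> r0"
begin

text \<open>\<open>M3\<close>, \<open>M4\<close> and \<open>\<delta>1\<close> bound \<open>C\<close>, its derivative and \<open>S\<close>. The \<open>G\<close>-norm of \<open>A\<close> is at most \<open>t1 / \<epsilon>\<close>, and at
  most \<open>t2\<close> if one argument is the position vector. As \<open>\<epsilon>\<close> tends to 0, \<open>\<delta>1\<close> and \<open>t1\<close> tend to multiples of \<open>\<delta>\<close>.\<close>

definition M3 where "M3 = 3 * M1 + 2 * M0 / r0"
definition M4 where "M4 = 3 * M2 + 2 * M1 / r0 + 6 * M0 / r0\<^sup>2"
definition \<delta>1 where "\<delta>1 = 2 * \<epsilon>\<^sup>2 * M0 / r0\<^sup>2 + \<delta>"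
definition t1 where "t1 = (\<epsilon> * M3 / sqrt c + sqrt 2 * \<delta>1) / 2"
definition t2 where "t2 = \<delta> / (2 * sqrt c)"
definition N where "N u = sqrt (G x u u)"

lemma M1_nonneg: "0 \<le> M1"
proof -
  have "0 \<le> M1 * norm (axis undefined 1 :: real^'m) * norm (axis undefined 1 :: real^'m) * norm (axis undefined 1 :: real^'m)"
    using dP_bound abs_ge_zero order_trans by blast
  then show ?thesis by simp
qed

lemma M2_nonneg: "0 \<le> M2"
proof -
  have "0 \<le> M2 * norm (axis undefined 1 :: real^'m) * norm (axis undefined 1 :: real^'m) * norm (axis undefined 1 :: real^'m) * norm (axis undefined 1 :: real^'m)"
    using ddP_bound abs_ge_zero order_trans by blast
  then show ?thesis by simp
qed

lemma M_nonneg: "0 \<le> M3" "0 \<le> M4" "0 \<le> \<delta>1" "0 \<le> t1" "0 \<le> t2"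
proof -
  show "0 \<le> M3" "0 \<le> M4" "0 \<le> t2" using M0_nonneg M1_nonneg M2_nonneg r0 \<delta>_nonneg c by (auto simp: M3_def M4_def t2_def)
  show *: "0 \<le> \<delta>1" using M0_nonneg \<delta>_nonneg by (simp add: \<delta>1_def)
  show "0 \<le> t1" using * \<open>0 \<le> M3\<close> \<epsilon> c by (simp add: t1_def)
qed

lemma x0: "x \<noteq> 0" "0 < norm x" using x r0 by auto

lemma xx: "x \<bullet> x = (norm x)\<^sup>2" by (simp add: power2_norm_eq_inner)

lemma q_ge: "r0\<^sup>2 \<le> q x" "(norm x)\<^sup>2 \<le> q x" "q x \<le> 2 * (norm x)\<^sup>2"
proof -
  have "r0\<^sup>2 \<le> (norm x)\<^sup>2" using x r0 by (intro power_mono) auto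
  moreover have "\<epsilon>\<^sup>2 \<le> r0\<^sup>2" using \<epsilon> \<epsilon>_r0 by (intro power_mono) auto
  ultimately show "r0\<^sup>2 \<le> q x" "(norm x)\<^sup>2 \<le> q x" "q x \<le> 2 * (norm x)\<^sup>2"
    using zero_le_power2[of \<epsilon>] unfolding q_def xx by linarith+
qed

lemma h_bound: "\<bar>h x z\<bar> \<le> norm z / r0"
proof -
  have "\<bar>h x z\<bar> = \<bar>x \<bullet> z\<bar> / q x" using q_pos[of x] by (simp add: h_def)
  also have "\<dots> \<le> (norm x * norm z) / (norm x)\<^sup>2"
    using Cauchy_Schwarz_ineq2 q_ge x0 by (intro frac_le) auto
  also have "\<dots> = norm z / norm x" using x0 by (simp add: power2_eq_square)
  also have "\<dots> \<le> norm z / r0" using x r0 x0 by (intro divide_left_mono mult_pos_pos) auto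
  finally show ?thesis .
qed

lemma hx_bound: "\<bar>h x x\<bar> \<le> 1"
  using q_pos[of x] \<epsilon> unfolding h_x by (simp add: q_def field_simps)

lemma C_bound: "\<bar>C x u v w\<bar> \<le> M3 * (norm u * norm v * norm w)"
proof -
  have 1: "\<bar>dP x u v w\<bar> \<le> M1 * (norm u * norm v * norm w)" "\<bar>dP x v u w\<bar> \<le> M1 * (norm u * norm v * norm w)"
    "\<bar>dP x w u v\<bar> \<le> M1 * (norm u * norm v * norm w)"
    using dP_bound[of x u v w] dP_bound[of x v u w] dP_bound[of x w u v] by (simp_all add: mult_ac)
  have "\<bar>P x u v\<bar> * \<bar>h x w\<bar> \<le> (M0 * norm u * norm v) * (norm w / r0)"
    using P_bound h_bound M0_nonneg by (intro mult_mono) auto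
  moreover have "\<bar>2 * P x u v * h x w\<bar> = 2 * (\<bar>P x u v\<bar> * \<bar>h x w\<bar>)" by (simp add: abs_mult)
  moreover have "2 * ((M0 * norm u * norm v) * (norm w / r0)) = 2 * M0 / r0 * (norm u * norm v * norm w)" by simp
  ultimately have 2: "\<bar>2 * P x u v * h x w\<bar> \<le> 2 * M0 / r0 * (norm u * norm v * norm w)" by linarith
  show ?thesis using 1 2 unfolding C_def M3_def distrib_right by linarith
qed

lemma DC: "D u (\<lambda>y. C y v w z) x = ddP x u v w z + ddP x u w v z - ddP x u z v w
    + 2 * (P x v w * D u (\<lambda>y. h y z) x + dP x u v w * h x z)"
proof -
  have s: "C_inf_on (\<lambda>y. P y v w * h y z) UNIV" by (rule C_inf_on_mult[OF open_UNIV P_smooth h_smooth])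
  have s2: "C_inf_on (\<lambda>y. 2 * (P y v w * h y z)) UNIV" by (rule C_inf_on_mult[OF open_UNIV C_inf_on_const s])
  have s3: "C_inf_on (\<lambda>y. dP y v w z + dP y w v z) UNIV" by (rule C_inf_on_add[OF open_UNIV dP_smooth dP_smooth])
  have s4: "C_inf_on (\<lambda>y. dP y v w z + dP y w v z - dP y z v w) UNIV" by (rule C_inf_on_diff[OF open_UNIV s3 dP_smooth])
  have "(\<lambda>y. C y v w z) = (\<lambda>y. dP y v w z + dP y w v z - dP y z v w + 2 * (P y v w * h y z))"
    by (intro ext) (simp add: C_def)
  then show ?thesis
    by (simp only: D_add[OF s4 s2] D_diff[OF s3 dP_smooth] D_add[OF dP_smooth dP_smooth] D_cmult[OF s]
        D_mult[OF P_smooth h_smooth] ddP_def dP_def[of x u v w])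
qed

lemma DC_bound: "\<bar>D u (\<lambda>y. C y v w z) x\<bar> \<le> M4 * (norm u * norm v * norm w * norm z)"
proof -
  define p where "p = norm u * norm v * norm w * norm z"
  have 1: "\<bar>ddP x u v w z\<bar> \<le> M2 * p" "\<bar>ddP x u w v z\<bar> \<le> M2 * p" "\<bar>ddP x u z v w\<bar> \<le> M2 * p"
    using ddP_bound[of x u v w z] ddP_bound[of x u w v z] ddP_bound[of x u z v w] by (simp_all add: p_def mult_ac)
  have "\<bar>D u (\<lambda>y. h y z) x\<bar> \<le> 3 * (norm u * norm z / r0\<^sup>2)"
  proof -
    have "\<bar>(u \<bullet> z) / q x\<bar> \<le> (norm u * norm z) / r0\<^sup>2"
      unfolding abs_divide using q_pos[of x] q_ge r0 Cauchy_Schwarz_ineq2 by (intro frac_le) auto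
    moreover have "\<bar>h x z\<bar> * \<bar>h x u\<bar> \<le> (norm z / r0) * (norm u / r0)"
      using h_bound r0 by (intro mult_mono) auto
    moreover have "\<bar>2 * h x z * h x u\<bar> = 2 * (\<bar>h x z\<bar> * \<bar>h x u\<bar>)" by (simp add: abs_mult)
    moreover have "(norm z / r0) * (norm u / r0) = norm u * norm z / r0\<^sup>2" by (simp add: power2_eq_square)
    ultimately show ?thesis unfolding D_h by linarith
  qed
  then have "\<bar>P x v w\<bar> * \<bar>D u (\<lambda>y. h y z) x\<bar> \<le> (M0 * norm v * norm w) * (3 * (norm u * norm z / r0\<^sup>2))"
    using P_bound M0_nonneg by (intro mult_mono) auto
  moreover have "\<bar>2 * (P x v w * D u (\<lambda>y. h y z) x)\<bar> = 2 * (\<bar>P x v w\<bar> * \<bar>D u (\<lambda>y. h y z) x\<bar>)" by (simp add: abs_mult)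
  moreover have "2 * ((M0 * norm v * norm w) * (3 * (norm u * norm z / r0\<^sup>2))) = 6 * M0 / r0\<^sup>2 * p" by (simp add: p_def)
  ultimately have 2: "\<bar>2 * (P x v w * D u (\<lambda>y. h y z) x)\<bar> \<le> 6 * M0 / r0\<^sup>2 * p" by linarith
  have "\<bar>dP x u v w\<bar> * \<bar>h x z\<bar> \<le> (M1 * norm u * norm v * norm w) * (norm z / r0)"
    using dP_bound h_bound M1_nonneg by (intro mult_mono) auto
  moreover have "\<bar>2 * (dP x u v w * h x z)\<bar> = 2 * (\<bar>dP x u v w\<bar> * \<bar>h x z\<bar>)" by (simp add: abs_mult)
  moreover have "2 * ((M1 * norm u * norm v * norm w) * (norm z / r0)) = 2 * M1 / r0 * p" by (simp add: p_def)
  ultimately have 3: "\<bar>2 * (dP x u v w * h x z)\<bar> \<le> 2 * M1 / r0 * p" by linarith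
  show ?thesis using 1 2 3 unfolding DC M4_def p_def[symmetric] distrib_right distrib_left by linarith
qed

lemma S_bound: "\<bar>S x u v\<bar> \<le> \<delta>1 * (norm u * norm v)"
proof -
  have "\<bar>2 * \<epsilon>\<^sup>2 * P x u v\<bar> / q x \<le> (2 * \<epsilon>\<^sup>2 * (M0 * norm u * norm v)) / r0\<^sup>2"
    using q_ge r0 P_bound[of x u v] M0_nonneg by (intro frac_le) (auto simp: abs_mult intro!: mult_left_mono)
  then have "\<bar>2 * \<epsilon>\<^sup>2 * P x u v / q x\<bar> \<le> 2 * \<epsilon>\<^sup>2 * M0 / r0\<^sup>2 * (norm u * norm v)"
    using q_pos[of x] by (simp add: abs_mult mult_ac)
  moreover have "\<bar>Q x u v\<bar> \<le> \<delta> * (norm u * norm v)" using Q_bound'[of x u v] by (simp add: mult.assoc)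
  ultimately show ?thesis unfolding S_def \<delta>1_def distrib_right by linarith
qed

lemma N_nonneg: "0 \<le> N u" unfolding N_def using pos_form.nonneg[OF G_pos_form] by simp

lemma N_sq: "N u * N u = G x u u" unfolding N_def using pos_form.nonneg[OF G_pos_form] by simp

lemma G_le_N: "\<bar>G x u v\<bar> \<le> N u * N v" unfolding N_def by (rule pos_form.cauchy_schwarz[OF G_pos_form])

lemma tang_le_N: "sqrt c * norm (tang x u) \<le> N u"
proof -
  have "c * (tang x u \<bullet> tang x u) \<le> G x u u"
  proof -
    have "0 \<le> ((x \<bullet> u) / (x \<bullet> x))\<^sup>2 * (\<epsilon>\<^sup>2 * (x \<bullet> x) / q x)" using q_pos[of x] by simp
    then show ?thesis using G_ge[OF x0(1), of u] by linarith
  qed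
  then have "sqrt (c * (tang x u \<bullet> tang x u)) \<le> N u" unfolding N_def by (rule real_sqrt_le_mono)
  then show ?thesis by (simp add: real_sqrt_mult norm_eq_sqrt_inner)
qed

lemma radial_le_N: "\<epsilon> * \<bar>(x \<bullet> u) / (x \<bullet> x)\<bar> \<le> sqrt 2 * N u"
proof -
  define l where "l = (x \<bullet> u) / (x \<bullet> x)"
  have "l\<^sup>2 * (\<epsilon>\<^sup>2 / 2) \<le> l\<^sup>2 * (\<epsilon>\<^sup>2 * (x \<bullet> x) / q x)"
  proof (rule mult_left_mono)
    have "\<epsilon>\<^sup>2 * q x \<le> \<epsilon>\<^sup>2 * (2 * (x \<bullet> x))" using q_ge(3) unfolding xx by (intro mult_left_mono) auto
    then show "\<epsilon>\<^sup>2 / 2 \<le> \<epsilon>\<^sup>2 * (x \<bullet> x) / q x" using q_pos[of x] by (simp add: field_simps)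
  qed simp
  also have "\<dots> \<le> G x u u"
  proof -
    have "0 \<le> c * (tang x u \<bullet> tang x u)" using c by simp
    then show ?thesis using G_ge[OF x0(1), of u] unfolding l_def by linarith
  qed
  finally have "(\<epsilon> * \<bar>l\<bar>)\<^sup>2 \<le> 2 * G x u u" by (simp add: power_mult_distrib mult.commute)
  then have "sqrt ((\<epsilon> * \<bar>l\<bar>)\<^sup>2) \<le> sqrt (2 * G x u u)" by (rule real_sqrt_le_mono)
  then show ?thesis using \<epsilon> by (simp add: N_def real_sqrt_mult l_def abs_mult)
qed

text \<open>A vector is estimated by its pairing with itself, since only the pairings of \<open>A\<close> are known explicitly.\<close>

lemma N_le_of_dual:
  assumes "G x v v \<le> B * N v" "0 \<le> B" shows "N v \<le> B"
proof (cases "N v = 0")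
  case False
  then have "N v > 0" using N_nonneg[of v] by linarith
  then show ?thesis using assms unfolding N_sq[symmetric] by simp
qed (simp add: assms)

text \<open>\<open>e1\<close> to \<open>e4\<close> bound \<open>E\<close> with no, one (in the first or in the second pair) and two radial arguments, relative to
  the size \<open>1 / \<epsilon>\<^sup>2\<close> of the hyperbolic curvature: a radial vector of unit length is \<open>x / \<epsilon>\<close> up to bounded factors,
  so each radial argument accounts for a factor \<open>1 / \<epsilon>\<close>.\<close>

definition \<delta>2 where "\<delta>2 = 2 * \<epsilon>\<^sup>2 * \<delta> / r0\<^sup>2 + 4 * \<epsilon>\<^sup>2 * M0 / r0\<^sup>2 + \<delta>"
definition e1 where "e1 = \<epsilon>\<^sup>2 * M4 + (1 + M0) * (\<delta> + \<delta>1) + 2 * t1\<^sup>2"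
definition e2 where "e2 = \<epsilon> * (M4 * r1) + 2 * t1 * t2"
definition e3 where "e3 = \<epsilon> * (M4 * r1 + M3) + 2 * t1 * t2"
definition e4 where "e4 = (\<delta>2 + 2 * \<delta> + 2 * \<delta>1) / 2 + t2\<^sup>2"

lemma tang_le: "norm (tang x u) \<le> N u / sqrt c"
  using tang_le_N[of u] c by (simp add: field_simps)

text \<open>The radial component of a \<open>G\<close>-unit vector can be as long as \<open>1 / \<epsilon>\<close>, but it is paired with \<open>S\<close>, which
  is small.\<close>

lemma N_A: "N (A x u v) \<le> t1 / \<epsilon> * (norm u * norm v)"
proof (rule N_le_of_dual)
  define W where "W = A x u v"
  define l where "l = (x \<bullet> W) / (x \<bullet> x)"
  have "C x u v W = C x u v (tang x W + l *\<^sub>R x)" unfolding l_def using tang_decomp[of W x] by simp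
  also have "\<dots> = C x u v (tang x W) - l * S x u v"
    by (simp add: linear_add[OF C_lin(3)] linear_cmul[OF C_lin(3)] C_rad3)
  finally have CW: "C x u v W = C x u v (tang x W) - l * S x u v" .
  have 1: "\<bar>C x u v (tang x W)\<bar> \<le> M3 * (norm u * norm v * (N W / sqrt c))"
    using C_bound[of u v "tang x W"] tang_le[of W] M_nonneg
    by (meson mult_left_mono mult_nonneg_nonneg norm_ge_zero order_trans)
  have "\<bar>l\<bar> \<le> sqrt 2 * N W / \<epsilon>" using radial_le_N[of W] \<epsilon> by (simp add: l_def field_simps)
  then have "\<bar>l\<bar> * \<bar>S x u v\<bar> \<le> (sqrt 2 * N W / \<epsilon>) * (\<delta>1 * (norm u * norm v))"
    using S_bound N_nonneg \<epsilon> by (intro mult_mono) auto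
  with 1 have "\<bar>C x u v W\<bar> \<le> M3 * (norm u * norm v * (N W / sqrt c)) + (sqrt 2 * N W / \<epsilon>) * (\<delta>1 * (norm u * norm v))"
    unfolding CW abs_mult[symmetric] by linarith
  also have "\<dots> = 2 * (t1 / \<epsilon> * (norm u * norm v) * N W)"
    using \<epsilon> c by (simp add: t1_def field_simps)
  finally show "G x (A x u v) (A x u v) \<le> t1 / \<epsilon> * (norm u * norm v) * N (A x u v)"
    using G_A[of x u v W] unfolding W_def by linarith
qed (use M_nonneg \<epsilon> in simp)

lemma A_sym: "A x u v = A x v u"
  by (rule g_eqI[of x]) (simp add: G_A C_sym[of x u v])

lemma N_A_rad: "N (A x x v) \<le> t2 * norm v"
proof (rule N_le_of_dual)
  define W where "W = A x x v"
  define l where "l = (x \<bullet> W) / (x \<bullet> x)"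
  have "C x x v W = Q x v (tang x W + l *\<^sub>R x)" unfolding l_def C_rad1 using tang_decomp[of W x] by simp
  also have "\<dots> = Q x v (tang x W)"
    by (simp add: linear_add[OF Q_lin(2)] linear_cmul[OF Q_lin(2)] Q_rad)
  finally have "\<bar>C x x v W\<bar> \<le> \<delta> * norm v * norm (tang x W)" using Q_bound'[of x v "tang x W"] by simp
  also have "\<dots> \<le> \<delta> * norm v * (N W / sqrt c)"
    using tang_le[of W] \<delta>_nonneg by (intro mult_left_mono) auto
  also have "\<dots> = 2 * (t2 * norm v * N W)" by (simp add: t2_def)
  finally show "G x (A x x v) (A x x v) \<le> t2 * norm v * N (A x x v)"
    using G_A[of x x v W] unfolding W_def by linarith
qed (use M_nonneg in simp)

lemma A_xx: "A x x x = 0"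
  by (rule g_eqI[of x]) (simp add: G_A C_rad1 Q_rad g_simps)

lemma G_AA: "\<bar>G x (A x u v) (A x z w)\<bar> \<le> (t1 / \<epsilon> * (norm u * norm v)) * (t1 / \<epsilon> * (norm z * norm w))"
  using M_nonneg \<epsilon> by (intro order_trans[OF G_le_N] mult_mono N_A N_nonneg) auto

lemma G_AA_rad1: "\<bar>G x (A x x v) (A x z w)\<bar> \<le> (t2 * norm v) * (t1 / \<epsilon> * (norm z * norm w))"
  using M_nonneg \<epsilon> by (intro order_trans[OF G_le_N] mult_mono N_A N_A_rad N_nonneg) auto

lemma G_AA_rad2: "\<bar>G x (A x z w) (A x x v)\<bar> \<le> (t2 * norm v) * (t1 / \<epsilon> * (norm z * norm w))"
  using G_AA_rad1[of v z w] by (simp add: gsym)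

lemma G_AA_rad12: "\<bar>G x (A x x v) (A x x w)\<bar> \<le> (t2 * norm v) * (t2 * norm w)"
  using M_nonneg by (intro order_trans[OF G_le_N] mult_mono N_A_rad N_nonneg) auto

lemma G_tang_bound:
  assumes "x \<bullet> u = 0" shows "\<bar>G x u v\<bar> \<le> (1 + M0) * (norm u * norm v)"
proof -
  have "G x u v = u \<bullet> v + P x u v" using assms by (simp add: G_def)
  moreover have "\<bar>u \<bullet> v\<bar> \<le> norm u * norm v" by (rule Cauchy_Schwarz_ineq2)
  moreover have "\<bar>P x u v\<bar> \<le> M0 * (norm u * norm v)" using P_bound[of x u v] by (simp add: mult.assoc)
  ultimately show ?thesis unfolding distrib_right by linarith
qed

lemma G_x_tang: "x \<bullet> u = 0 \<Longrightarrow> G x x u = 0" "x \<bullet> u = 0 \<Longrightarrow> G x u x = 0"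
  using gsym[of x u x] by (simp_all add: G_x h_def)

lemma h_tang: "x \<bullet> u = 0 \<Longrightarrow> h x u = 0" by (simp add: h_def)

lemma S_x: "S x x v = 0" "S x v x = 0" by (simp_all add: S_def P_rad P_rad2 Q_rad)

text \<open>The shape of the right-hand side of \<open>E_formula\<close>.\<close>

lemma abs_sum7_le:
  fixes d1 d2 y x3 x4 g1 g2 :: real
  assumes "\<bar>d1\<bar> \<le> B1" "\<bar>d2\<bar> \<le> B1" "\<bar>y\<bar> \<le> B2" "\<bar>x3\<bar> \<le> B3" "\<bar>x4\<bar> \<le> B4" "\<bar>g1\<bar> \<le> B5" "\<bar>g2\<bar> \<le> B5"
  shows "\<bar>(d1 - d2) / 2 - y - x3 - x4 - g1 + g2\<bar> \<le> B1 + B2 + B3 + B4 + 2 * B5"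
  using assms[THEN abs_le_D1] assms[THEN abs_le_D2] by (intro abs_leI) argo+

lemma E_tang:
  assumes "x \<bullet> a = 0" "x \<bullet> b = 0" "x \<bullet> z = 0" "x \<bullet> w = 0"
  shows "\<bar>E x a b z w\<bar> \<le> \<kappa> * e1 * (norm a * norm b * norm z * norm w)"
proof -
  define p where "p = norm a * norm b * norm z * norm w"
  have 1: "\<bar>D a (\<lambda>y. C y b w z) x\<bar> \<le> M4 * p" "\<bar>D b (\<lambda>y. C y a w z) x\<bar> \<le> M4 * p"
    using DC_bound[of a b w z] DC_bound[of b a w z] by (simp_all add: p_def mult_ac)
  have "\<bar>G x b w * Q x a z\<bar> \<le> ((1 + M0) * (norm b * norm w)) * (\<delta> * norm a * norm z)"
    "\<bar>G x a w * Q x b z\<bar> \<le> ((1 + M0) * (norm a * norm w)) * (\<delta> * norm b * norm z)"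
    "\<bar>G x a z * S x b w\<bar> \<le> ((1 + M0) * (norm a * norm z)) * (\<delta>1 * (norm b * norm w))"
    "\<bar>G x b z * S x a w\<bar> \<le> ((1 + M0) * (norm b * norm z)) * (\<delta>1 * (norm a * norm w))"
    unfolding abs_mult using assms M0_nonneg
    by (intro mult_mono G_tang_bound Q_bound' S_bound; simp)+
  then have 2: "\<bar>G x b w * Q x a z\<bar> \<le> (1 + M0) * \<delta> * p" "\<bar>G x a w * Q x b z\<bar> \<le> (1 + M0) * \<delta> * p"
    "\<bar>G x a z * S x b w\<bar> \<le> (1 + M0) * \<delta>1 * p" "\<bar>G x b z * S x a w\<bar> \<le> (1 + M0) * \<delta>1 * p"
    by (simp_all add: p_def mult_ac)
  have *: "\<bar>\<kappa> / 2 * (r - s)\<bar> \<le> \<kappa> * B" if "\<bar>r\<bar> \<le> B" "\<bar>s\<bar> \<le> B" for r s B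
  proof -
    have "\<bar>\<kappa> / 2 * (r - s)\<bar> = \<kappa> * (\<bar>r - s\<bar> / 2)" using \<kappa>_pos by (simp add: abs_mult)
    also have "\<dots> \<le> \<kappa> * B" using that \<kappa>_pos by (intro mult_left_mono) auto
    finally show ?thesis .
  qed
  have 3: "\<bar>G x (A x b w) (A x a z)\<bar> \<le> \<kappa> * t1\<^sup>2 * p" "\<bar>G x (A x a w) (A x b z)\<bar> \<le> \<kappa> * t1\<^sup>2 * p"
    using G_AA[of b w a z] G_AA[of a w b z] by (simp_all add: p_def \<kappa>_def power2_eq_square mult_ac)
  have "\<bar>E x a b z w\<bar> \<le> M4 * p + 0 + \<kappa> * ((1 + M0) * \<delta> * p) + \<kappa> * ((1 + M0) * \<delta>1 * p) + 2 * (\<kappa> * t1\<^sup>2 * p)"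
    unfolding E_formula
    by (intro abs_sum7_le 1 *[OF 2(1,2)] *[OF 2(3,4)] 3) (simp add: h_tang[OF assms(3)])
  also have "M4 * p = \<kappa> * (\<epsilon>\<^sup>2 * M4 * p)" using \<epsilon> by (simp add: \<kappa>_def)
  finally show ?thesis unfolding e1_def p_def[symmetric] by (simp add: algebra_simps)
qed

lemma E_mixed1:
  assumes "x \<bullet> b = 0" "x \<bullet> z = 0" "x \<bullet> w = 0"
  shows "\<bar>E x x b z w\<bar> \<le> e2 / \<epsilon> * (norm b * norm z * norm w)"
proof -
  define p where "p = norm b * norm z * norm w"
  have "0 \<le> p" by (simp add: p_def)
  then have "M4 * (norm x * p) \<le> M4 * (r1 * p)"
    using x M_nonneg by (intro mult_left_mono mult_right_mono) auto
  then have 1: "\<bar>D x (\<lambda>y. C y b w z) x\<bar> \<le> M4 * r1 * p" "\<bar>D b (\<lambda>y. C y x w z) x\<bar> \<le> M4 * r1 * p"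
    using DC_bound[of x b w z] DC_bound[of b x w z] by (simp_all add: p_def mult_ac)
  have 2: "\<bar>G x (A x b w) (A x x z)\<bar> \<le> t1 * t2 / \<epsilon> * p" "\<bar>G x (A x x w) (A x b z)\<bar> \<le> t1 * t2 / \<epsilon> * p"
    using G_AA_rad2[of b w z] G_AA_rad1[of w b z] by (simp_all add: p_def mult_ac)
  have "\<bar>E x x b z w\<bar> \<le> M4 * r1 * p + 0 + 0 + 0 + 2 * (t1 * t2 / \<epsilon> * p)"
    unfolding E_formula
    by (intro abs_sum7_le 1 2) (simp_all add: h_tang assms Q_rad S_x G_x_tang)
  also have "\<dots> = e2 / \<epsilon> * p" using \<epsilon> by (simp add: e2_def field_simps)
  finally show ?thesis unfolding p_def .
qed

lemma E_mixed2:
  assumes "x \<bullet> a = 0" "x \<bullet> b = 0" "x \<bullet> w = 0"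
  shows "\<bar>E x a b x w\<bar> \<le> e3 / \<epsilon> * (norm a * norm b * norm w)"
proof -
  define p where "p = norm a * norm b * norm w"
  have "0 \<le> p" by (simp add: p_def)
  then have "M4 * (norm x * p) \<le> M4 * (r1 * p)"
    using x M_nonneg by (intro mult_left_mono mult_right_mono) auto
  then have 1: "\<bar>D a (\<lambda>y. C y b w x) x\<bar> \<le> M4 * r1 * p" "\<bar>D b (\<lambda>y. C y a w x) x\<bar> \<le> M4 * r1 * p"
    using DC_bound[of a b w x] DC_bound[of b a w x] by (simp_all add: p_def mult_ac)
  have "\<bar>C x a w b - C x b w a\<bar> \<le> 2 * (M3 * p)"
    using C_bound[of a w b] C_bound[of b w a] by (simp add: p_def mult_ac)
  then have "\<bar>C x a w b - C x b w a\<bar> * \<bar>h x x\<bar> \<le> 2 * (M3 * p) * 1"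
    using hx_bound by (intro mult_mono) auto
  then have 2: "\<bar>(C x a w b - C x b w a) * h x x / 2\<bar> \<le> M3 * p" by (simp add: abs_mult)
  have 3: "\<bar>G x (A x b w) (A x a x)\<bar> \<le> t1 * t2 / \<epsilon> * p" "\<bar>G x (A x a w) (A x b x)\<bar> \<le> t1 * t2 / \<epsilon> * p"
    using G_AA_rad2[of b w a] G_AA_rad2[of a w b] unfolding A_sym[of a x] A_sym[of b x] by (simp_all add: p_def mult_ac)
  have "\<bar>E x a b x w\<bar> \<le> M4 * r1 * p + M3 * p + 0 + 0 + 2 * (t1 * t2 / \<epsilon> * p)"
    unfolding E_formula
    by (intro abs_sum7_le 1 2 3) (simp_all add: assms Q_rad S_x G_x_tang)
  also have "\<dots> = e3 / \<epsilon> * p" using \<epsilon> by (simp add: e3_def field_simps)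
  finally show ?thesis unfolding p_def .
qed

lemma S_smooth: "C_inf_on (\<lambda>y. S y u v) UNIV"
  unfolding S_def using q_pos
  by (intro C_inf_on_add C_inf_on_divide C_inf_on_mult C_inf_on_const P_smooth q_smooth Q_smooth open_UNIV)
    (simp add: less_imp_neq[symmetric])

lemma D_S: "D x (\<lambda>y. S y u v) x = 2 * \<epsilon>\<^sup>2 * Q x u v / q x - 4 * \<epsilon>\<^sup>2 * P x u v * h x x / q x + D x (\<lambda>y. Q y u v) x"
proof -
  have "((\<lambda>y. 2 * \<epsilon>\<^sup>2 * P y u v) has_derivative (\<lambda>a. 2 * \<epsilon>\<^sup>2 * dP x a u v)) (at x)"
    unfolding dP_def by (intro has_derivative_mult_right C_inf_on_has_derivative[OF P_smooth UNIV_I])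
  with q_has_derivative have "((\<lambda>y. 2 * \<epsilon>\<^sup>2 * P y u v / q y) has_derivative
      (\<lambda>a. (2 * \<epsilon>\<^sup>2 * dP x a u v * q x - 2 * \<epsilon>\<^sup>2 * P x u v * (2 * (x \<bullet> a))) / (q x * q x))) (at x)"
    using q_pos[of x] by (intro has_derivative_divide') auto
  from D_eqI[OF has_derivative_add[OF this C_inf_on_has_derivative[OF Q_smooth UNIV_I]], of x]
  have "D x (\<lambda>y. S y u v) x = (2 * \<epsilon>\<^sup>2 * dP x x u v * q x - 2 * \<epsilon>\<^sup>2 * P x u v * (2 * (x \<bullet> x))) / (q x * q x)
     + D x (\<lambda>y. Q y u v) x"
    unfolding S_def .
  then show ?thesis using q_pos[of x] by (simp add: Q_def h_def field_simps)
qed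

lemma D_S_bound: "\<bar>D x (\<lambda>y. S y u v) x\<bar> \<le> \<delta>2 * (norm u * norm v)"
proof -
  have "\<bar>2 * \<epsilon>\<^sup>2 * Q x u v\<bar> / q x \<le> (2 * \<epsilon>\<^sup>2 * (\<delta> * norm u * norm v)) / r0\<^sup>2"
    using q_ge r0 Q_bound'[of x u v] \<delta>_nonneg by (intro frac_le) (auto simp: abs_mult intro!: mult_left_mono)
  then have 1: "\<bar>2 * \<epsilon>\<^sup>2 * Q x u v / q x\<bar> \<le> 2 * \<epsilon>\<^sup>2 * \<delta> / r0\<^sup>2 * (norm u * norm v)"
    using q_pos[of x] by (simp add: abs_mult mult_ac)
  have "\<bar>P x u v\<bar> * \<bar>h x x\<bar> \<le> (M0 * norm u * norm v) * 1"
    using P_bound hx_bound M0_nonneg by (intro mult_mono) auto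
  then have "4 * \<epsilon>\<^sup>2 * (\<bar>P x u v\<bar> * \<bar>h x x\<bar>) / q x \<le> (4 * \<epsilon>\<^sup>2 * (M0 * norm u * norm v * 1)) / r0\<^sup>2"
    using q_ge r0 M0_nonneg by (intro frac_le mult_left_mono) auto
  then have 2: "\<bar>4 * \<epsilon>\<^sup>2 * P x u v * h x x / q x\<bar> \<le> 4 * \<epsilon>\<^sup>2 * M0 / r0\<^sup>2 * (norm u * norm v)"
    using q_pos[of x] by (simp add: abs_mult mult_ac)
  have 3: "\<bar>D x (\<lambda>y. Q y u v) x\<bar> \<le> \<delta> * (norm u * norm v)"
    using DQ_bound'[of x u v] by (simp add: mult.assoc)
  show ?thesis unfolding D_S \<delta>2_def distrib_right using 1 2 3 by linarith
qed

text \<open>Radial arguments of a derivative are handled by differentiating \<open>C y u v y = - S y u v\<close> and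
  \<open>C y y w y = 0\<close>; no second derivative of \<open>P\<close> in a tangential direction survives.\<close>

lemma D_C_last: "D a (\<lambda>y. C y u v x) x = - D a (\<lambda>y. S y u v) x - C x u v a"
proof -
  have "D a (\<lambda>y. C y u v y) x = D a (\<lambda>y. C y u v x) x + C x u v a"
    using D_param_linear_apply[OF C_lin(3) C_smooth C_inf_on_id, of a u v x] by (simp add: D_ident)
  moreover have "D a (\<lambda>y. C y u v y) x = - D a (\<lambda>y. S y u v) x"
    using D_cmult[OF S_smooth, of a "-1" u v x] by (simp add: C_rad3)
  ultimately show ?thesis by linarith
qed

lemma D_C_first_last: "D b (\<lambda>y. C y x w x) x = S x b w - Q x w b"
proof -
  have s: "C_inf_on (\<lambda>y. C y u w y) UNIV" for u
    by (rule C_inf_on_param_linear_apply[OF C_lin(3) C_smooth C_inf_on_id])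
  have "D b (\<lambda>y. C y y w y) x = D b (\<lambda>y. C y x w y) x + C x b w x"
    using D_param_linear_apply[OF C_lin(1) s C_inf_on_id, of b x] by (simp add: D_ident)
  moreover have "D b (\<lambda>y. C y x w y) x = D b (\<lambda>y. C y x w x) x + C x x w b"
    using D_param_linear_apply[OF C_lin(3) C_smooth C_inf_on_id, of b x w x] by (simp add: D_ident)
  moreover have "D b (\<lambda>y. C y y w y) x = 0" by (simp add: C_rad1 Q_rad D_const)
  ultimately show ?thesis by (simp add: C_rad1 C_rad3)
qed

lemma abs_sum5_le:
  fixes d1 d2 y1 y2 g :: real
  assumes "\<bar>d1\<bar> \<le> B1" "\<bar>d2\<bar> \<le> B2" "\<bar>y1\<bar> \<le> B3" "\<bar>y2\<bar> \<le> B4" "\<bar>g\<bar> \<le> B5"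
  shows "\<bar>(- d1 + d2) / 2 - y1 / 2 - y2 / 2 + g\<bar> \<le> (B1 + B2 + B3 + B4) / 2 + B5"
  using assms[THEN abs_le_D1] assms[THEN abs_le_D2] by (intro abs_leI) argo+

lemma E_rad:
  assumes "x \<bullet> b = 0" "x \<bullet> w = 0"
  shows "\<bar>E x x b x w\<bar> \<le> e4 * (norm b * norm w)"
proof -
  define p where "p = norm b * norm w"
  have E: "E x x b x w = (- D x (\<lambda>y. S y b w) x + Q x w b) / 2 - (Q x w b + S x b w) * h x x / 2
      - S x b w * h x x / 2 + G x (A x x w) (A x x b)"
  proof -
    have k: "\<kappa> / 2 * (G x x x * S x b w) = S x b w * h x x / 2" using \<kappa>G_x[of x x] by (simp add: mult_ac)
    show ?thesis
      unfolding E_formula D_C_first_last unfolding D_C_last A_xx A_sym[of b x]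
      by (simp only: k Q_rad S_x mult_zero_right mult_zero_left diff_zero) (simp add: C_rad1 C_rad3 g_simps)
  qed
  have 1: "\<bar>D x (\<lambda>y. S y b w) x\<bar> \<le> \<delta>2 * p" using D_S_bound by (simp add: p_def)
  have 2: "\<bar>Q x w b\<bar> \<le> \<delta> * p" using Q_bound'[of x w b] by (simp add: p_def mult_ac)
  have 3: "\<bar>S x b w\<bar> \<le> \<delta>1 * p" using S_bound by (simp add: p_def)
  have "\<bar>Q x w b + S x b w\<bar> * \<bar>h x x\<bar> \<le> (\<delta> * p + \<delta>1 * p) * 1" "\<bar>S x b w\<bar> * \<bar>h x x\<bar> \<le> (\<delta>1 * p) * 1"
    using 2 3 hx_bound by (intro mult_mono; linarith)+
  then have 4: "\<bar>(Q x w b + S x b w) * h x x\<bar> \<le> \<delta> * p + \<delta>1 * p" "\<bar>S x b w * h x x\<bar> \<le> \<delta>1 * p"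
    by (simp_all add: abs_mult)
  have 5: "\<bar>G x (A x x w) (A x x b)\<bar> \<le> t2\<^sup>2 * p"
    using G_AA_rad12[of w b] by (simp add: p_def power2_eq_square mult_ac)
  have "\<bar>E x x b x w\<bar> \<le> (\<delta>2 * p + \<delta> * p + (\<delta> * p + \<delta>1 * p) + \<delta>1 * p) / 2 + t2\<^sup>2 * p"
    unfolding E by (intro abs_sum5_le 1 2 4 5)
  also have "\<dots> = e4 * p" by (simp add: e4_def algebra_simps)
  finally show ?thesis unfolding p_def .
qed

lemma E_multilinear: "multilinear4 (E x)"
proof -
  have h: "linear (\<lambda>u. \<kappa> * f u)" if "linear f" for f :: "real^'m \<Rightarrow> real"
    using linear_compose_scale_right[OF that, of \<kappa>] by simp
  have r: "linear (\<lambda>u. Rm G x u v z w)" "linear (\<lambda>v. Rm G x u v z w)" "linear (\<lambda>z. Rm G x u v z w)" "linear (\<lambda>w. Rm G x u v z w)"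
    "linear (\<lambda>u. G x u z * G x v w - G x u w * G x v z)" "linear (\<lambda>v. G x u z * G x v w - G x u w * G x v z)"
    "linear (\<lambda>z. G x u z * G x v w - G x u w * G x v z)" "linear (\<lambda>w. G x u z * G x v w - G x u w * G x v z)" for u v z w
    using Rm_multilinear[of x] multilinear4_gram[OF G_pos_form, of x] unfolding multilinear4_def by simp_all
  show ?thesis unfolding multilinear4_def E_def by (intro conjI allI linear_compose_add h r)
qed

lemma E_antisym1: "E x v u z w = - E x u v z w"
  unfolding E_def using Rm_antisym1[of x v u z w] by (simp add: algebra_simps)

lemma E_antisym2: "E x u v w z = - E x u v z w"
  unfolding E_def using Rm_antisym2[of x u v w z] by (simp add: algebra_simps)

text \<open>\<open>E\<close> depends on \<open>u \<and> v\<close> and \<open>z \<and> w\<close> only, and in \<open>(a + l x) \<and> (b + m x)\<close> the position vector can be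
  collected into one factor.\<close>

lemma E_split:
  "E x (a + l *\<^sub>R x) (b + m *\<^sub>R x) z w = E x a b z w + E x x (l *\<^sub>R b - m *\<^sub>R a) z w"
  "E x u v (a + l *\<^sub>R x) (b + m *\<^sub>R x) = E x u v a b + E x u v x (l *\<^sub>R b - m *\<^sub>R a)"
proof -
  have l: "linear (\<lambda>u. E x u v z w)" "linear (\<lambda>v. E x u v z w)" "linear (\<lambda>z. E x u v z w)" "linear (\<lambda>w. E x u v z w)" for u v z w
    using E_multilinear unfolding multilinear4_def by simp_all
  have "E x x x z w = 0" "E x u v x x = 0" using E_antisym1[of x x z w] E_antisym2[of u v x x] by simp_all
  then show "E x (a + l *\<^sub>R x) (b + m *\<^sub>R x) z w = E x a b z w + E x x (l *\<^sub>R b - m *\<^sub>R a) z w"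
    "E x u v (a + l *\<^sub>R x) (b + m *\<^sub>R x) = E x u v a b + E x u v x (l *\<^sub>R b - m *\<^sub>R a)"
    using E_antisym1[of x a z w] E_antisym2[of u v x a]
    by (simp_all add: linear_add[OF l(1)] linear_add[OF l(2)] linear_add[OF l(3)] linear_add[OF l(4)]
        linear_diff[OF l(2)] linear_diff[OF l(4)]
        linear_cmul[OF l(1)] linear_cmul[OF l(2)] linear_cmul[OF l(3)] linear_cmul[OF l(4)] algebra_simps)
qed

text \<open>The tangential vector which \<open>E_split\<close> produces next to \<open>x\<close>.\<close>

lemma mixed_norm:
  "norm (((x \<bullet> u) / (x \<bullet> x)) *\<^sub>R tang x v - ((x \<bullet> v) / (x \<bullet> x)) *\<^sub>R tang x u) \<le> 2 * sqrt 2 / (sqrt c * \<epsilon>) * (N u * N v)"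
proof -
  have l: "\<bar>(x \<bullet> u) / (x \<bullet> x)\<bar> \<le> sqrt 2 * N u / \<epsilon>" for u
    using radial_le_N[of u] \<epsilon> by (simp add: field_simps)
  have *: "norm (((x \<bullet> u) / (x \<bullet> x)) *\<^sub>R tang x v) \<le> (sqrt 2 * N u / \<epsilon>) * (N v / sqrt c)" for u v
    unfolding norm_scaleR using l N_nonneg \<epsilon> by (intro mult_mono tang_le) auto
  have "norm (((x \<bullet> u) / (x \<bullet> x)) *\<^sub>R tang x v - ((x \<bullet> v) / (x \<bullet> x)) *\<^sub>R tang x u)
      \<le> (sqrt 2 * N u / \<epsilon>) * (N v / sqrt c) + (sqrt 2 * N v / \<epsilon>) * (N u / sqrt c)"
    by (rule order_trans[OF norm_triangle_ineq4 add_mono[OF * *]])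
  also have "\<dots> = 2 * sqrt 2 / (sqrt c * \<epsilon>) * (N u * N v)" using \<epsilon> c by (simp add: field_simps)
  finally show ?thesis .
qed

lemma e_nonneg: "0 \<le> e1" "0 \<le> e2" "0 \<le> e3" "0 \<le> e4"
  using M_nonneg M0_nonneg \<delta>_nonneg \<epsilon> r0 by (simp_all add: e1_def e2_def e3_def e4_def \<delta>2_def)

definition \<eta> where "\<eta> = e1 / c\<^sup>2 + 2 * sqrt 2 / (c * sqrt c) * (e2 + e3) + 8 / c * e4"

lemma E_bound: "\<bar>E x u v z w\<bar> \<le> \<eta> * \<kappa> * (N u * N v * N z * N w)"
proof -
  define F where "F = 2 * sqrt 2 / (sqrt c * \<epsilon>)"
  define R where "R = 1 / sqrt c"
  define p where "p = N u * N v * N z * N w"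
  define l where "l u = (x \<bullet> u) / (x \<bullet> x)" for u
  define t where "t u = tang x u" for u
  define f where "f u v = l u *\<^sub>R t v - l v *\<^sub>R t u" for u v
  have dec: "y = t y + l y *\<^sub>R x" for y unfolding t_def l_def by (rule tang_decomp)
  have tx: "x \<bullet> t y = 0" for y unfolding t_def using tang_orth[OF x0(1), of y] by (simp add: inner_commute)
  have fx: "x \<bullet> f y y' = 0" for y y' by (simp add: f_def inner_diff_right tx)
  have R: "R * R = 1 / c" "0 \<le> R" using c by (simp_all add: R_def)
  have nt: "norm (t y) \<le> R * N y" for y using tang_le[of y] by (simp add: t_def R_def)
  have nf: "norm (f y y') \<le> F * (N y * N y')" for y y' using mixed_norm[of y y'] by (simp add: f_def t_def l_def F_def)
  have pos: "0 \<le> F" "0 \<le> \<kappa>" "0 \<le> 1 / \<epsilon>" using \<epsilon> c \<kappa>_pos by (simp_all add: F_def)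
  have "E x u v z w = E x (t u + l u *\<^sub>R x) (t v + l v *\<^sub>R x) (t z + l z *\<^sub>R x) (t w + l w *\<^sub>R x)"
    by (simp only: dec[symmetric])
  also have "\<dots> = E x (t u) (t v) (t z) (t w) + E x (t u) (t v) x (f z w) + E x x (f u v) (t z) (t w) + E x x (f u v) x (f z w)"
    unfolding E_split f_def by (simp only: add.assoc)
  finally have eq: "E x u v z w = E x (t u) (t v) (t z) (t w) + E x (t u) (t v) x (f z w) + E x x (f u v) (t z) (t w) + E x x (f u v) x (f z w)" .
  have "\<bar>E x (t u) (t v) (t z) (t w)\<bar> \<le> \<kappa> * e1 * (norm (t u) * norm (t v) * norm (t z) * norm (t w))"
    by (intro E_tang tx)
  also have "\<dots> \<le> \<kappa> * e1 * ((R * N u) * (R * N v) * (R * N z) * (R * N w))"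
    using e_nonneg pos R N_nonneg by (intro mult_left_mono mult_mono nt) auto
  also have "\<dots> = \<kappa> * (e1 * ((R * R) * (R * R))) * p" by (simp add: p_def)
  also have "\<dots> = e1 / c\<^sup>2 * \<kappa> * p" unfolding R by (simp add: power2_eq_square)
  finally have 1: "\<bar>E x (t u) (t v) (t z) (t w)\<bar> \<le> e1 / c\<^sup>2 * \<kappa> * p" .
  have RF: "1 / \<epsilon> * F * (R * R) = 2 * sqrt 2 / (c * sqrt c) * \<kappa>"
    unfolding R F_def \<kappa>_def by (simp add: power2_eq_square)
  have "\<bar>E x (t u) (t v) x (f z w)\<bar> \<le> e3 / \<epsilon> * (norm (t u) * norm (t v) * norm (f z w))"
    by (intro E_mixed2 tx fx)
  also have "\<dots> \<le> e3 / \<epsilon> * ((R * N u) * (R * N v) * (F * (N z * N w)))"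
    using e_nonneg pos R N_nonneg \<epsilon> by (intro mult_left_mono mult_mono nt nf) auto
  also have "\<dots> = e3 * (1 / \<epsilon> * F * (R * R)) * p" by (simp add: p_def)
  finally have 2: "\<bar>E x (t u) (t v) x (f z w)\<bar> \<le> e3 * (2 * sqrt 2 / (c * sqrt c) * \<kappa>) * p" unfolding RF .
  have "\<bar>E x x (f u v) (t z) (t w)\<bar> \<le> e2 / \<epsilon> * (norm (f u v) * norm (t z) * norm (t w))"
    by (intro E_mixed1 tx fx)
  also have "\<dots> \<le> e2 / \<epsilon> * ((F * (N u * N v)) * (R * N z) * (R * N w))"
    using e_nonneg pos R N_nonneg \<epsilon> by (intro mult_left_mono mult_mono nt nf) auto
  also have "\<dots> = e2 * (1 / \<epsilon> * F * (R * R)) * p" by (simp add: p_def)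
  finally have 3: "\<bar>E x x (f u v) (t z) (t w)\<bar> \<le> e2 * (2 * sqrt 2 / (c * sqrt c) * \<kappa>) * p" unfolding RF .
  have FF: "F * F = 8 / c * \<kappa>" using c by (simp add: F_def \<kappa>_def power2_eq_square)
  have "\<bar>E x x (f u v) x (f z w)\<bar> \<le> e4 * (norm (f u v) * norm (f z w))"
    by (intro E_rad fx)
  also have "\<dots> \<le> e4 * ((F * (N u * N v)) * (F * (N z * N w)))"
    using e_nonneg pos N_nonneg by (intro mult_left_mono mult_mono nf) auto
  also have "\<dots> = e4 * (F * F) * p" by (simp add: p_def)
  finally have 4: "\<bar>E x x (f u v) x (f z w)\<bar> \<le> e4 * (8 / c * \<kappa>) * p" unfolding FF .
  have "\<bar>E x u v z w\<bar> \<le> e1 / c\<^sup>2 * \<kappa> * p + e3 * (2 * sqrt 2 / (c * sqrt c) * \<kappa>) * p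
      + e2 * (2 * sqrt 2 / (c * sqrt c) * \<kappa>) * p + e4 * (8 / c * \<kappa>) * p"
    unfolding eq by (intro order_trans[OF abs_triangle_ineq] add_mono 1 2 3 4)
  also have "\<dots> = \<eta> * \<kappa> * p" by (simp add: \<eta>_def distrib_left distrib_right mult_ac)
  finally show ?thesis unfolding p_def .
qed

end

section \<open>Negative curvature operator and the unit sphere\<close>

text \<open>The constant \<open>\<eta>\<close> of \<open>E_bound\<close> as a function of the parameters, and its limit for \<open>\<epsilon> \<rightarrow> 0\<close>. The limit
  depends only on the ellipticity constant, the size of \<open>P\<close> and \<open>\<delta>\<close>, and it vanishes with \<open>\<delta>\<close>. Hence
  \<open>\<delta>\<close> can be fixed before the bounds \<open>M1\<close> and \<open>M2\<close> are known, and \<open>\<epsilon>\<close> after that.\<close>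

definition eta_fun :: "real \<Rightarrow> real \<Rightarrow> real \<Rightarrow> real \<Rightarrow> real \<Rightarrow> real \<Rightarrow> real \<Rightarrow> real \<Rightarrow> real" where
  "eta_fun c M0 \<delta> r0 r1 M1 M2 \<epsilon> =
    (let M3 = 3 * M1 + 2 * M0 / r0; M4 = 3 * M2 + 2 * M1 / r0 + 6 * M0 / r0\<^sup>2;
       \<delta>1 = 2 * \<epsilon>\<^sup>2 * M0 / r0\<^sup>2 + \<delta>; \<delta>2 = 2 * \<epsilon>\<^sup>2 * \<delta> / r0\<^sup>2 + 4 * \<epsilon>\<^sup>2 * M0 / r0\<^sup>2 + \<delta>;
       t1 = (\<epsilon> * M3 / sqrt c + sqrt 2 * \<delta>1) / 2; t2 = \<delta> / (2 * sqrt c)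
     in (\<epsilon>\<^sup>2 * M4 + (1 + M0) * (\<delta> + \<delta>1) + 2 * t1\<^sup>2) / c\<^sup>2
       + 2 * sqrt 2 / (c * sqrt c) * ((\<epsilon> * (M4 * r1) + 2 * t1 * t2) + (\<epsilon> * (M4 * r1 + M3) + 2 * t1 * t2))
       + 8 / c * ((\<delta>2 + 2 * \<delta> + 2 * \<delta>1) / 2 + t2\<^sup>2))"

definition eta0 :: "real \<Rightarrow> real \<Rightarrow> real \<Rightarrow> real" where
  "eta0 c M0 \<delta> =
    (let t1 = sqrt 2 * \<delta> / 2; t2 = \<delta> / (2 * sqrt c)
     in ((1 + M0) * (\<delta> + \<delta>) + 2 * t1\<^sup>2) / c\<^sup>2
       + 2 * sqrt 2 / (c * sqrt c) * (2 * t1 * t2 + 2 * t1 * t2)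
       + 8 / c * ((\<delta> + 2 * \<delta> + 2 * \<delta>) / 2 + t2\<^sup>2))"

lemma eta_fun_tendsto: "((\<lambda>\<epsilon>. eta_fun c M0 \<delta> r0 r1 M1 M2 \<epsilon>) \<longlongrightarrow> eta0 c M0 \<delta>) (at_right 0)"
proof -
  have "isCont (\<lambda>\<epsilon>. eta_fun c M0 \<delta> r0 r1 M1 M2 \<epsilon>) 0"
    unfolding eta_fun_def Let_def divide_inverse by (intro continuous_intros)
  then have "((\<lambda>\<epsilon>. eta_fun c M0 \<delta> r0 r1 M1 M2 \<epsilon>) \<longlongrightarrow> eta_fun c M0 \<delta> r0 r1 M1 M2 0) (at_right 0)"
    by (meson continuous_within filterlim_at_split isCont_def)
  moreover have "eta_fun c M0 \<delta> r0 r1 M1 M2 0 = eta0 c M0 \<delta>"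
    by (simp add: eta_fun_def eta0_def Let_def)
  ultimately show ?thesis by simp
qed

lemma eta0_tendsto: "((\<lambda>\<delta>. eta0 c M0 \<delta>) \<longlongrightarrow> 0) (at 0)"
proof -
  have "isCont (eta0 c M0) 0"
    unfolding eta0_def[abs_def] Let_def divide_inverse by (intro continuous_intros)
  moreover have "eta0 c M0 0 = 0" by (simp add: eta0_def)
  ultimately show ?thesis by (simp add: isCont_def)
qed

lemma (in perturbed_at) \<eta>_eq: "\<eta> = eta_fun c M0 \<delta> r0 r1 M1 M2 \<epsilon>"
  unfolding \<eta>_def eta_fun_def e1_def e2_def e3_def e4_def t1_def t2_def \<delta>1_def \<delta>2_def M3_def M4_def Let_def ..

text \<open>The strict Cauchy-Schwarz inequality, read off from the vector \<open>b(v, v) u - b(u, v) v\<close>.\<close>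

lemma (in pos_form) gram_pos:
  assumes "u \<noteq> v" "independent {u, v}"
  shows "0 < b u u * b v v - b u v * b v u"
proof -
  have v: "v \<noteq> 0" using assms(2) dependent_zero[of "{u, v}"] by auto
  define w where "w = b v v *\<^sub>R u - b u v *\<^sub>R v"
  have "w \<noteq> 0"
  proof
    assume "w = 0"
    then have "b v v *\<^sub>R u = b u v *\<^sub>R v" by (simp add: w_def)
    then have "(1 / b v v) *\<^sub>R (b v v *\<^sub>R u) = (1 / b v v) *\<^sub>R (b u v *\<^sub>R v)" by (rule arg_cong)
    then have "u = (b u v / b v v) *\<^sub>R v" using pos[OF v] by simp
    then have "u \<in> span {v}" by (metis span_base span_scale insertI1)
    then show False using assms by (metis Diff_insert_absorb dependent_def insertI1 singletonD)
  qed
  then have "0 < b w w" by (rule pos)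
  also have "b w w = b v v * (b u u * b v v - b u v * b v u)"
    by (simp add: w_def bilinear_simps sym[of v u] algebra_simps)
  finally show ?thesis using pos[OF v] by (simp add: zero_less_mult_iff)
qed

context perturbed
begin

text \<open>Off the annulus \<open>P\<close> vanishes on an open set, so that the metric is hyperbolic there.\<close>

lemma E_eq_0:
  assumes "norm x < r0 \<or> r1 < norm x"
  shows "E x u v z w = 0"
proof -
  have C0: "C y u v w = 0" if "norm y < r0 \<or> r1 < norm y" for y u v w
    using that by (simp add: C_def dP_supp P_supp)
  have DC0: "D u (\<lambda>y. C y v w z) x = 0" for u v w z
    using D_cong[OF supp_open, of x "\<lambda>y. C y v w z" "\<lambda>y. 0" u] C0 assms by (simp add: D_const)
  have Q0: "Q x u v = 0" and S0: "S x u v = 0" for u v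
    using assms by (simp_all add: Q_def S_def dP_supp P_supp)
  have A0: "A x u v = 0" for u v
    by (rule g_eqI[of x]) (simp add: G_A C0[OF assms] g_simps)
  show ?thesis unfolding E_formula by (simp add: DC0 C0[OF assms] Q0 S0 A0 g_simps)
qed

lemma negative_curvature:
  assumes dP_bound: "\<And>y a u v. \<bar>dP y a u v\<bar> \<le> M1 * norm a * norm u * norm v"
    and ddP_bound: "\<And>y b a u v. \<bar>ddP y b a u v\<bar> \<le> M2 * norm b * norm a * norm u * norm v"
    and \<epsilon>_r0: "\<epsilon> \<le> r0"
    and \<eta>: "eta_fun c M0 \<delta> r0 r1 M1 M2 \<epsilon> * (real CARD('m))\<^sup>2 < 2"
  shows "negative_curvature_operator G"
proof (rule negative_curvature_operatorI[OF G_pos_form Rm_multilinear])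
  define \<eta>' where "\<eta>' = max (eta_fun c M0 \<delta> r0 r1 M1 M2 \<epsilon>) 0"
  have \<eta>': "\<eta>' * (real CARD('m))\<^sup>2 < 2" using \<eta> by (auto simp: \<eta>'_def max_def)
  fix x and \<alpha> :: "real^'m^'m" assume \<alpha>: "\<alpha> \<in> bivectors" "\<alpha> \<noteq> 0"
  show "bivector_form (Rm G x) \<alpha> \<alpha> < 0"
  proof (rule bivector_form_negative[OF G_pos_form Rm_multilinear \<kappa>_pos \<eta>' _ \<alpha>])
    fix u v z w
    define p where "p = sqrt (G x u u) * sqrt (G x v v) * sqrt (G x z z) * sqrt (G x w w)"
    have p: "0 \<le> p" unfolding p_def using pos_form.nonneg[OF G_pos_form] by (intro mult_nonneg_nonneg) auto
    have "\<bar>E x u v z w\<bar> \<le> \<eta>' * \<kappa> * p"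
    proof (cases "norm x < r0 \<or> r1 < norm x")
      case True
      have "0 \<le> \<eta>' * \<kappa> * p" using p \<kappa>_pos by (simp add: \<eta>'_def)
      then show ?thesis by (simp add: E_eq_0[OF True])
    next
      case False
      interpret perturbed_at P r0 r1 c M0 \<delta> \<epsilon> M1 M2 x
        by unfold_locales (use dP_bound ddP_bound \<epsilon>_r0 False in auto)
      have "\<bar>E x u v z w\<bar> \<le> eta_fun c M0 \<delta> r0 r1 M1 M2 \<epsilon> * \<kappa> * p"
        using E_bound[of u v z w] unfolding \<eta>_eq N_def p_def .
      also have "\<dots> \<le> \<eta>' * \<kappa> * p"
        using p \<kappa>_pos by (intro mult_right_mono) (auto simp: \<eta>'_def)
      finally show ?thesis .
    qed
    then show "\<bar>Rm G x u v z w + \<kappa> * (G x u z * G x v w - G x u w * G x v z)\<bar>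
        \<le> \<eta>' * \<kappa> * sqrt (G x u u) * sqrt (G x v v) * sqrt (G x z z) * sqrt (G x w w)"
      unfolding E_def p_def by (simp add: mult.assoc)
  qed
qed

lemma constant_curvature_outside: "constant_sectional_curvature_on (- cball 0 r1) G (- \<kappa>)"
  unfolding constant_sectional_curvature_on_def
proof (intro ballI allI impI)
  fix x u v :: "real^'m" assume x: "x \<in> - cball 0 r1" and uv: "u \<noteq> v \<and> independent {u, v}"
  have g: "0 < G x u u * G x v v - G x u v * G x v u"
    using pos_form.gram_pos[OF G_pos_form] uv by blast
  have "Rm G x u v u v = - \<kappa> * (G x u u * G x v v - G x u v * G x v u)"
    using E_eq_0[of x u v u v] x unfolding E_def by simp
  then show "sectional_curvature G x u v = - \<kappa>"
    using g by (simp add: sectional_curvature_def gram2_def)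
qed

end

text \<open>The derivative within the sphere is an arbitrary choice, but any two choices agree on a tangent vector:
  compose with the great circle in its direction.\<close>

lemma sphere_diff_eq:
  fixes F :: "'a::euclidean_space \<Rightarrow> 'b::euclidean_space"
  assumes F: "(F has_derivative F') (at x)" and x: "x \<in> unit_sphere" and U: "open U" "x \<in> U"
    and eq: "\<And>y. y \<in> unit_sphere \<Longrightarrow> y \<in> U \<Longrightarrow> f y = F y" and v: "v \<bullet> x = 0"
  shows "sphere_diff f x v = F' v"
proof -
  let ?S = "sphere 0 1 :: 'a set"
  from U obtain d where d: "0 < d" "ball x d \<subseteq> U" using open_contains_ball by blast
  have fF: "(f has_derivative F') (at x within ?S)"
  proof (rule has_derivative_transform_within[OF has_derivative_at_withinI[OF F] d(1) x])
    fix y assume "y \<in> ?S" "dist y x < d"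
    then show "F y = f y" using eq d(2) by (auto simp: dist_commute subset_eq)
  qed
  define D where "D = frechet_derivative f (at x within ?S)"
  have fD: "(f has_derivative D) (at x within ?S)"
    unfolding D_def using fF frechet_derivative_works differentiable_def by blast
  have lin: "linear D" "linear F'" using fD F has_derivative_linear by auto
  have "D v = F' v"
  proof (cases "v = 0")
    case True
    then show ?thesis using lin by (simp add: linear_0)
  next
    case False
    define w where "w = v /\<^sub>R norm v"
    define p where "p t = cos t *\<^sub>R x + sin t *\<^sub>R w" for t
    have w: "w \<bullet> x = 0" "x \<bullet> w = 0" "w \<bullet> w = 1" "x \<bullet> x = 1"
      using False v x by (auto simp: w_def inner_commute dot_square_norm power2_eq_square)
    have "p t \<bullet> p t = 1" for t
      using w by (simp add: p_def inner_add_left inner_add_right flip: power2_eq_square)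
    then have pS: "range p \<subseteq> ?S" by (auto simp: norm_eq_1)
    have p: "(p has_derivative (\<lambda>t. t *\<^sub>R w)) (at 0)"
      unfolding p_def[abs_def] by (auto intro!: derivative_eq_intros)
    have p0: "p 0 = x" by (simp add: p_def)
    have ch: "((\<lambda>t. f (p t)) has_derivative (\<lambda>t. A (t *\<^sub>R w))) (at 0)" if "(f has_derivative A) (at x within ?S)" for A
      using has_derivative_in_compose[OF p, of f A] has_derivative_subset[OF that pS] p0 by simp
    have "(\<lambda>t. D (t *\<^sub>R w)) = (\<lambda>t. F' (t *\<^sub>R w))"
      using has_derivative_unique[OF ch[OF fD] ch[OF fF]] .
    from fun_cong[OF this, of "norm v"] show ?thesis using False by (simp add: w_def)
  qed
  then show ?thesis by (simp add: sphere_diff_def D_def)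
qed

lemma sphere_diff_id: "x \<in> unit_sphere \<Longrightarrow> v \<bullet> x = 0 \<Longrightarrow> sphere_diff (\<lambda>x. x) x v = v"
  by (rule sphere_diff_eq[where U = UNIV and F = "\<lambda>x. x"]) auto

lemma sphere_embedding_id: "sphere_embedding (\<lambda>x :: 'a::euclidean_space. x)"
  unfolding sphere_embedding_def
proof (intro conjI ballI)
  show "smooth_map unit_sphere (\<lambda>x :: 'a. x)"
    unfolding smooth_map_def by (intro ballI exI[of _ UNIV] exI[of _ "\<lambda>x. x"]) (simp add: C_inf_on_id)
  show "inj_on (sphere_diff (\<lambda>x. x) x) (sphere_tangent x)" if "x \<in> unit_sphere" for x :: 'a
    using that by (auto simp: inj_on_def sphere_tangent_def sphere_diff_id)
  show "\<exists>Y. homeomorphism unit_sphere ((\<lambda>x. x) ` unit_sphere) (\<lambda>x :: 'a. x) Y"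
    by (rule exI[of _ "\<lambda>x. x"]) (auto simp: homeomorphism_def)
qed

lemma inside_unit_sphere: "inside (unit_sphere :: 'a::euclidean_space set) = ball 0 1"
  using inside_frontier_eq_interior[of "cball (0::'a) 1"] by (simp add: frontier_cball)

context perturbed
begin

lemma G_xx_pos: "x \<noteq> 0 \<Longrightarrow> 0 < G x x x"
  by (rule pos_form.pos[OF G_pos_form])

text \<open>The position vector is orthogonal to the spheres around the origin also with respect to \<open>G\<close>.\<close>

definition inward_normal where "inward_normal x = - (1 / sqrt (G x x x)) *\<^sub>R x"

lemma inward_unit_normal:
  assumes x: "x \<in> unit_sphere"
  shows "inward_unit_normal G (\<lambda>x. x) x (inward_normal x)"
  unfolding inward_unit_normal_def
proof (intro conjI ballI)
  have x0: "x \<noteq> 0" using x by auto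
  have s: "0 < sqrt (G x x x)" using G_xx_pos[OF x0] by simp
  show "G x (inward_normal x) (inward_normal x) = 1" using s by (simp add: inward_normal_def g_simps)
  show "G x (sphere_diff (\<lambda>x. x) x v) (inward_normal x) = 0" if "v \<in> sphere_tangent x" for v
  proof -
    have "v \<bullet> x = 0" "x \<bullet> v = 0" using that by (auto simp: sphere_tangent_def inner_commute)
    then show ?thesis using gsym[of x v x] x by (simp add: sphere_diff_id inward_normal_def g_simps G_x h_def)
  qed
  show "\<forall>\<^sub>F t in at_right 0. x + t *\<^sub>R inward_normal x \<in> inside ((\<lambda>x. x) ` unit_sphere)"
    unfolding eventually_at_right_field
  proof (intro exI conjI allI impI)
    show "0 < sqrt (G x x x)" by fact
    fix t assume t: "0 < t" "t < sqrt (G x x x)"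
    have "x + t *\<^sub>R inward_normal x = (1 - t / sqrt (G x x x)) *\<^sub>R x" by (simp add: inward_normal_def algebra_simps)
    moreover have "\<bar>1 - t / sqrt (G x x x)\<bar> < 1" using t s by (simp add: abs_if field_simps)
    ultimately show "x + t *\<^sub>R inward_normal x \<in> inside ((\<lambda>x. x) ` unit_sphere)"
      using x by (simp add: inside_unit_sphere)
  qed
qed

text \<open>Tangency of \<open>V\<close> gives \<open>x \<bullet> D\<^sub>V V = - V \<bullet> V\<close>, and \<open>K_eq\<close> and \<open>C_rad3\<close> give the radial component of the
  Christoffel symbol. If \<open>Q\<close> vanishes on the unit sphere, the two add up to
  \<open>G(\<nabla>\<^sub>V V, x) = - G(V, V)\<close>.\<close>

lemma positive_definite_II:
  assumes Q0: "\<And>x v. norm x = 1 \<Longrightarrow> Q x v v = 0"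
  shows "positive_definite_II G (\<lambda>x. x) inward_normal"
  unfolding positive_definite_II_def
proof (intro allI impI ballI)
  fix V :: "real^'m \<Rightarrow> real^'m" and x :: "real^'m"
  assume V: "tangent_field unit_sphere sphere_tangent V" and x: "x \<in> unit_sphere" and Vx: "V x \<noteq> 0"
  have tan: "V y \<bullet> y = 0" if "y \<in> unit_sphere" for y
    using V that by (auto simp: tangent_field_def sphere_tangent_def)
  have nx: "norm x = 1" "x \<bullet> x = 1" "x \<noteq> 0" using x by (auto simp: norm_eq_1)
  from V x obtain U F where F: "open U" "x \<in> U" "C_inf_on F U" "\<And>y. y \<in> unit_sphere \<Longrightarrow> y \<in> U \<Longrightarrow> F y = V y"
    unfolding tangent_field_def smooth_map_def by (metis IntI)
  have dF: "(F has_derivative (\<lambda>v. D v F x)) (at x)" by (rule C_inf_on_has_derivative[OF F(3,2)])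
  let ?v = "V x"
  have vx: "?v \<bullet> x = 0" "x \<bullet> ?v = 0" using tan[OF x] by (simp_all add: inner_commute)
  have dW: "sphere_diff (\<lambda>y. sphere_diff (\<lambda>x. x) y (V y)) x ?v = D ?v F x"
    by (rule sphere_diff_eq[OF dF x F(1,2) _ vx(1)]) (simp add: sphere_diff_id tan F(4))
  have "D ?v F x \<bullet> x + F x \<bullet> ?v = sphere_diff (\<lambda>y. V y \<bullet> y) x ?v"
    using sphere_diff_eq[OF has_derivative_inner[OF dF has_derivative_ident] x F(1,2) _ vx(1), of "\<lambda>y. V y \<bullet> y"] F(4)
    by (simp add: add.commute)
  also have "\<dots> = 0"
    by (rule sphere_diff_eq[OF has_derivative_const x F(1,2) _ vx(1)]) (rule tan)
  finally have DF: "x \<bullet> D ?v F x = - (?v \<bullet> ?v)" using F(4)[OF x F(2)] by (simp add: inner_commute)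
  have Gx: "G x w x = \<epsilon>\<^sup>2 * (x \<bullet> w) / q x" for w
    using gsym[of x w x] by (simp add: G_x h_def)
  have hx: "h x x = 1 / q x" by (simp add: h_def nx)
  have "G x (D ?v F x + \<Gamma> x ?v ?v) x = \<epsilon>\<^sup>2 * (- (?v \<bullet> ?v)) / q x + (- 2 * G x ?v ?v * (1 / q x) - S x ?v ?v) / 2"
    unfolding pos_form.bilinear_simps(1)[OF G_pos_form] christoffel_spec K_eq Gx DF hx C_rad3 by simp
  also have "S x ?v ?v = 2 * \<epsilon>\<^sup>2 * P x ?v ?v / q x" using Q0[OF nx(1)] by (simp add: S_def)
  also have "\<epsilon>\<^sup>2 * (- (?v \<bullet> ?v)) / q x + (- 2 * G x ?v ?v * (1 / q x) - 2 * \<epsilon>\<^sup>2 * P x ?v ?v / q x) / 2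
      = - ((\<epsilon>\<^sup>2 * (?v \<bullet> ?v + P x ?v ?v) + G x ?v ?v) / q x)"
    using q_pos[of x] by (simp add: field_simps)
  also have "?v \<bullet> ?v + P x ?v ?v = G x ?v ?v" by (simp add: G_def vx)
  also have "\<epsilon>\<^sup>2 * G x ?v ?v + G x ?v ?v = G x ?v ?v * q x" by (simp add: q_def nx algebra_simps)
  finally have key: "G x (D ?v F x + \<Gamma> x ?v ?v) x = - G x ?v ?v" using q_pos[of x] by simp
  have "second_fundamental_form G (\<lambda>x. x) inward_normal V V x = G x ?v ?v / sqrt (G x x x)"
    unfolding second_fundamental_form_def nabla_along_def dW sphere_diff_id[OF x vx(1)] inward_normal_def
      pos_form.bilinear_simps(8)[OF G_pos_form] key by simp
  then show "0 < second_fundamental_form G (\<lambda>x. x) inward_normal V V x"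
    using pos_form.pos[OF G_pos_form Vx, of x] G_xx_pos[OF nx(3)] by simp
qed

end

section \<open>Completeness\<close>

context smooth_metric
begin

definition speed :: "(real \<Rightarrow> real^'m) \<Rightarrow> real \<Rightarrow> real" where
  "speed p t = sqrt (g (p t) (vector_derivative p (at t)) (vector_derivative p (at t)))"

definition has_length :: "(real \<Rightarrow> real^'m) \<Rightarrow> real \<Rightarrow> bool" where
  "has_length p L \<longleftrightarrow> valid_path p \<and> (speed p has_integral L) {0..1}"

definition lengths :: "real^'m \<Rightarrow> real^'m \<Rightarrow> real set" where
  "lengths x y = {L. \<exists>p. pathstart p = x \<and> pathfinish p = y \<and> has_length p L}"

abbreviation d where "d \<equiv> riemannian_dist g"

lemma d_eq: "d x y = Inf (lengths x y)"
  unfolding riemannian_dist_def lengths_def has_length_def speed_def[abs_def] by (rule arg_cong[where f = Inf]) auto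

lemma g_nonneg: "0 \<le> g x u u" by (rule pos_form.nonneg[OF form])

lemma length_nonneg: "has_length p L \<Longrightarrow> 0 \<le> L"
  unfolding has_length_def speed_def[abs_def] by (auto intro: has_integral_nonneg simp: g_nonneg)

lemma valid_path_finite_bad:
  assumes "valid_path p"
  obtains S where "finite S" "\<And>t. t \<in> {0..1} - S \<Longrightarrow> (p has_vector_derivative vector_derivative p (at t)) (at t)"
    "continuous_on {0..1} p"
  using assms unfolding valid_path_def piecewise_C1_differentiable_on_def C1_differentiable_on_eq
  by (metis vector_derivative_works)

lemma length_reverse:
  assumes "has_length p L" shows "has_length (reversepath p) L"
proof -
  from assms have v: "valid_path p" and L: "(speed p has_integral L) {0..1}" by (auto simp: has_length_def)
  from valid_path_finite_bad[OF v] obtain S where S: "finite S"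
    "\<And>t. t \<in> {0..1} - S \<Longrightarrow> (p has_vector_derivative vector_derivative p (at t)) (at t)" by metis
  have I: "((\<lambda>t. speed p (1 - t)) has_integral L) {0..1}"
    using has_integral_affinity01 [where m= "-1" and c=1, OF L] by simp
  have e: "speed (reversepath p) t = speed p (1 - t)" if "t \<in> {0..1} - (\<lambda>t. 1 - t) ` S" for t
  proof -
    have "1 - t \<in> {0..1} - S" using that by force
    from S(2)[OF this] have f': "(p has_vector_derivative vector_derivative p (at (1 - t))) (at (1 - t))" .
    have "(p \<circ> (\<lambda>t. 1 - t) has_vector_derivative -1 *\<^sub>R vector_derivative p (at (1 - t))) (at t)"
      by (intro vector_diff_chain_within has_vector_derivative_at_within [OF f'] derivative_eq_intros | simp)+
    then have "vector_derivative (reversepath p) (at t) = - vector_derivative p (at (1 - t))"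
      by (intro vector_derivative_at) (simp add: o_def reversepath_def)
    then show ?thesis by (simp add: speed_def reversepath_def g_simps)
  qed
  have "(speed (reversepath p) has_integral L) {0..1}"
    by (rule has_integral_spike_finite[OF finite_imageI[OF S(1)] e I])
  then show ?thesis using v by (simp add: has_length_def valid_path_imp_reverse)
qed

lemma length_join:
  assumes 1: "has_length p1 L1" and 2: "has_length p2 L2" and "pathfinish p1 = pathstart p2"
  shows "has_length (p1 +++ p2) (L1 + L2)"
proof -
  from 1 have v1: "valid_path p1" and I1: "(speed p1 has_integral L1) {0..1}" by (auto simp: has_length_def)
  from 2 have v2: "valid_path p2" and I2: "(speed p2 has_integral L2) {0..1}" by (auto simp: has_length_def)
  from valid_path_finite_bad[OF v1] obtain S1 where S1: "finite S1"
    "\<And>t. t \<in> {0..1} - S1 \<Longrightarrow> (p1 has_vector_derivative vector_derivative p1 (at t)) (at t)" by metis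
  from valid_path_finite_bad[OF v2] obtain S2 where S2: "finite S2"
    "\<And>t. t \<in> {0..1} - S2 \<Longrightarrow> (p2 has_vector_derivative vector_derivative p2 (at t)) (at t)" by metis
  have i1: "((\<lambda>t. 2 * speed p1 (2 * t)) has_integral L1) {0..1/2}"
   and i2: "((\<lambda>t. 2 * speed p2 (2 * t - 1)) has_integral L2) {1/2..1}"
    using has_integral_affinity01 [OF I1, where m= 2 and c=0, THEN has_integral_cmul [where c=2]]
          has_integral_affinity01 [OF I2, where m= 2 and c="-1", THEN has_integral_cmul [where c=2]]
    by (simp_all only: image_affinity_atLeastAtMost_div_diff, simp_all)
  have sp: "sqrt (g x (2 *\<^sub>R w) (2 *\<^sub>R w)) = 2 * sqrt (g x w w)" for x w
  proof -
    have "g x (2 *\<^sub>R w) (2 *\<^sub>R w) = 2\<^sup>2 * g x w w" by (simp add: g_simps)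
    then show ?thesis by (simp only: real_sqrt_mult real_sqrt_abs abs_numeral)
  qed
  have e1: "speed (p1 +++ p2) t = 2 * speed p1 (2 * t)" if "t \<in> {0..1/2} - insert (1/2) ((*) 2 -` S1)" for t
  proof -
    have "((\<lambda>x. p1 (2 * x)) has_vector_derivative 2 *\<^sub>R vector_derivative p1 (at (2 * t))) (at t)"
    proof -
      have "((*) 2 has_vector_derivative 2) (at t)"
        by (simp add: has_vector_derivative_def has_derivative_def bounded_linear_mult_left)
      moreover have "(p1 has_vector_derivative vector_derivative p1 (at (2 * t))) (at (2 * t))"
        using S1 that by auto
      ultimately show ?thesis by (intro vector_diff_chain_at [simplified o_def])
    qed
    then have "((p1 +++ p2) has_vector_derivative 2 *\<^sub>R vector_derivative p1 (at (2 * t))) (at t)"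
      by (rule has_vector_derivative_transform_within[where d = "\<bar>t - 1/2\<bar>"])
        (use that in \<open>auto simp: joinpaths_def dist_real_def abs_if split: if_split_asm\<close>)
    then show ?thesis using that by (simp add: speed_def vector_derivative_at sp joinpaths_def)
  qed
  have e2: "speed (p1 +++ p2) t = 2 * speed p2 (2 * t - 1)" if "t \<in> {1/2..1} - insert (1/2) ((\<lambda>t. 2 * t - 1) -` S2)" for t
  proof -
    have "((\<lambda>x. p2 (2 * x - 1)) has_vector_derivative 2 *\<^sub>R vector_derivative p2 (at (2 * t - 1))) (at t)"
    proof -
      have "((\<lambda>x. 2 * x - 1) has_vector_derivative 2) (at t)"
        by (simp add: has_vector_derivative_def has_derivative_def bounded_linear_mult_left)
      moreover have "(p2 has_vector_derivative vector_derivative p2 (at (2 * t - 1))) (at (2 * t - 1))"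
        using S2 that by auto
      ultimately show ?thesis by (intro vector_diff_chain_at [simplified o_def])
    qed
    then have "((p1 +++ p2) has_vector_derivative 2 *\<^sub>R vector_derivative p2 (at (2 * t - 1))) (at t)"
      by (rule has_vector_derivative_transform_within[where d = "\<bar>t - 1/2\<bar>"])
        (use that in \<open>auto simp: joinpaths_def dist_real_def abs_if split: if_split_asm\<close>)
    then show ?thesis using that by (auto simp: speed_def vector_derivative_at sp joinpaths_def)
  qed
  have "(speed (p1 +++ p2) has_integral L1) {0..1/2}"
    by (rule has_integral_spike_finite[where S = "insert (1/2) ((*) 2 -` S1)", OF _ e1 i1])
      (auto intro!: finite_vimageI inj_onI S1(1))
  moreover have "(speed (p1 +++ p2) has_integral L2) {1/2..1}"
    by (rule has_integral_spike_finite[where S = "insert (1/2) ((\<lambda>t. 2 * t - 1) -` S2)", OF _ e2 i2])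
      (auto intro!: finite_vimageI inj_onI S2(1))
  ultimately have "(speed (p1 +++ p2) has_integral (L1 + L2)) {0..1}"
    by (intro has_integral_combine[where c = "1/2"]) auto
  then show ?thesis using v1 v2 assms(3) by (simp add: has_length_def valid_path_join)
qed

text \<open>A function whose differential is bounded by \<open>B\<close> in the metric changes along a path by at most \<open>B\<close> times
  its length. The derivative of a piecewise smooth path at a break point has an unspecified value,
  but the pointwise bound holds for any value.\<close>

lemma length_lower_bound:
  assumes L: "has_length p L"
    and f: "\<And>z. (f has_derivative f' z) (at z)" and b: "\<And>z u. \<bar>f' z u\<bar> \<le> B * sqrt (g z u u)"
  shows "\<bar>f (pathfinish p) - f (pathstart p)\<bar> \<le> B * L"
proof -
  from L have v: "valid_path p" and I: "(speed p has_integral L) {0..1}" by (auto simp: has_length_def)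
  from valid_path_finite_bad[OF v] obtain S where S: "finite S"
    "\<And>t. t \<in> {0..1} - S \<Longrightarrow> (p has_vector_derivative vector_derivative p (at t)) (at t)"
    and c: "continuous_on {0..1} p" by metis
  have cf: "continuous_on UNIV f" using f by (meson continuous_at_imp_continuous_on has_derivative_continuous)
  have I1: "((\<lambda>t. f' (p t) (vector_derivative p (at t))) has_integral (f (p 1) - f (p 0))) {0..1}"
  proof (rule fundamental_theorem_of_calculus_interior_strong[OF S(1)])
    show "((\<lambda>t. f (p t)) has_vector_derivative f' (p t) (vector_derivative p (at t))) (at t)" if "t \<in> {0<..<1} - S" for t
    proof -
      have "(p has_vector_derivative vector_derivative p (at t)) (at t)" using S(2) that by simp
      then show ?thesis
        unfolding has_vector_derivative_def
        using has_derivative_compose[OF _ f, of p "\<lambda>x. x *\<^sub>R vector_derivative p (at t)" t UNIV]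
          linear_cmul[OF has_derivative_linear[OF f[of "p t"]]] by simp
    qed
    show "continuous_on {0..1} (\<lambda>t. f (p t))" by (rule continuous_on_compose2[OF cf c]) simp
  qed simp
  have I2: "((\<lambda>t. B * speed p t) has_integral B * L) {0..1}" using has_integral_mult_right[OF I] .
  have "norm (integral {0..1} (\<lambda>t. f' (p t) (vector_derivative p (at t)))) \<le> integral {0..1} (\<lambda>t. B * speed p t)"
    using b by (intro integral_norm_bound_integral has_integral_integrable[OF I1] has_integral_integrable[OF I2]) (simp add: speed_def)
  then have "norm (f (p 1) - f (p 0)) \<le> B * L" by (simp only: integral_unique[OF I1] integral_unique[OF I2])
  then show ?thesis by (simp add: pathfinish_def pathstart_def)
qed

lemma g_upper_on_ball: "\<exists>B\<ge>0. \<forall>z u. norm z \<le> R \<longrightarrow> g z u u \<le> B\<^sup>2 * (norm u)\<^sup>2"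
proof -
  define T where "T z u v = (if norm z \<le> R then g z u v else 0)" for z u v
  have "\<exists>b. \<forall>z. \<bar>T z (axis i 1) (axis j 1)\<bar> \<le> b * 1" for i j
  proof -
    have "compact ((\<lambda>z. g z (axis i 1) (axis j 1)) ` cball 0 R)"
      using continuous_on_subset[OF C_inf_on_continuous[OF smooth]] by (intro compact_continuous_image) auto
    then obtain b where b: "\<And>z. z \<in> cball 0 R \<Longrightarrow> \<bar>g z (axis i 1) (axis j 1)\<bar> \<le> b"
      using compact_imp_bounded bounded_iff by (metis imageI real_norm_def)
    have "\<bar>T z (axis i 1) (axis j 1)\<bar> \<le> max b 0" for z
      using b[of z] by (auto simp: T_def le_max_iff_disj)
    then show ?thesis by (intro exI[of _ "max b 0"]) simp
  qed
  moreover have "linear (\<lambda>u. T z u v)" "linear (T z u)" for z u v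
  proof -
    have "T z = (if norm z \<le> R then g z else (\<lambda>u v. 0))" by (simp add: T_def fun_eq_iff)
    then show "linear (\<lambda>u. T z u v)" "linear (T z u)" using lin1[of z v] lin2[of z u] by (simp_all add: linear_zero)
  qed
  ultimately have "\<exists>B. \<forall>z u v. \<bar>T z u v\<bar> \<le> B * 1 * norm u * norm v"
    by (intro bilinear_family_bound) auto
  then obtain B where B: "\<And>z u v. \<bar>T z u v\<bar> \<le> B * norm u * norm v" by auto
  have "g z u u \<le> (sqrt (max B 0))\<^sup>2 * (norm u)\<^sup>2" if "norm z \<le> R" for z u
  proof -
    have "g z u u \<le> B * (norm u)\<^sup>2" using B[of z u u] that by (simp add: T_def power2_eq_square mult.assoc)
    also have "\<dots> \<le> max B 0 * (norm u)\<^sup>2" by (intro mult_right_mono) auto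
    finally show ?thesis by simp
  qed
  then show ?thesis by (intro exI[of _ "sqrt (max B 0)"]) auto
qed

lemma linepath_length:
  assumes B: "\<And>z u. norm z \<le> R \<Longrightarrow> g z u u \<le> B\<^sup>2 * (norm u)\<^sup>2" "0 \<le> B" and "norm x \<le> R" "norm y \<le> R"
  shows "\<exists>L\<in>lengths x y. L \<le> B * norm (y - x)"
proof -
  have s: "speed (linepath x y) = (\<lambda>t. sqrt (g (linepath x y t) (y - x) (y - x)))"
    by (rule ext) (simp add: speed_def)
  have "continuous_on {0..1} (\<lambda>t. g (linepath x y t) (y - x) (y - x))"
    by (rule continuous_on_compose2[OF C_inf_on_continuous[OF smooth]]) (auto intro: continuous_on_linepath)
  then have "speed (linepath x y) integrable_on {0..1}"
    unfolding s by (intro integrable_continuous_real continuous_intros)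
  then obtain L where L: "(speed (linepath x y) has_integral L) {0..1}" by (auto simp: integrable_on_def)
  then have "has_length (linepath x y) L" by (simp add: has_length_def)
  then have "L \<in> lengths x y" unfolding lengths_def by (intro CollectI exI[of _ "linepath x y"]) simp
  moreover have "L \<le> B * norm (y - x)"
  proof -
    have "speed (linepath x y) t \<le> B * norm (y - x)" if "t \<in> {0..1}" for t
    proof -
      have "linepath x y t \<in> cball 0 R"
      proof -
        have "linepath x y t \<in> closed_segment x y" using that by (auto simp: linepath_image_01[symmetric])
        also have "closed_segment x y \<subseteq> cball 0 R" using assms by (intro closed_segment_subset) auto
        finally show ?thesis .
      qed
      then have "g (linepath x y t) (y - x) (y - x) \<le> (B * norm (y - x))\<^sup>2"
        using B(1) by (simp add: power_mult_distrib)
      then show ?thesis unfolding s using B(2) by (intro real_le_lsqrt) auto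
    qed
    then show ?thesis
      using has_integral_le[OF L has_integral_const_real[of "B * norm (y - x)" 0 1]] by simp
  qed
  ultimately show ?thesis by blast
qed

lemma lengths_nonempty: "lengths x y \<noteq> {}"
proof -
  from g_upper_on_ball[of "max (norm x) (norm y)"] obtain B where
    "0 \<le> B" "\<And>z u. norm z \<le> max (norm x) (norm y) \<Longrightarrow> g z u u \<le> B\<^sup>2 * (norm u)\<^sup>2" by blast
  from linepath_length[where R = "max (norm x) (norm y)", OF this(2,1), where x = x and y = y] show ?thesis by auto
qed

lemma lengths_nonneg: "L \<in> lengths x y \<Longrightarrow> 0 \<le> L"
  using length_nonneg by (auto simp: lengths_def)

lemma lengths_bdd: "bdd_below (lengths x y)"
  using lengths_nonneg by (meson bdd_belowI)

lemma d_le: "L \<in> lengths x y \<Longrightarrow> d x y \<le> L"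
  unfolding d_eq by (rule cInf_lower[OF _ lengths_bdd])

lemma d_ge: "(\<And>L. L \<in> lengths x y \<Longrightarrow> B \<le> L) \<Longrightarrow> B \<le> d x y"
  unfolding d_eq by (rule cInf_greatest[OF lengths_nonempty])

lemma d_nonneg: "0 \<le> d x y" by (rule d_ge[OF lengths_nonneg])

lemma d_commute: "d x y = d y x"
proof -
  have "lengths x y \<subseteq> lengths y x" for x y
  proof
    fix L assume "L \<in> lengths x y"
    then obtain p where "pathstart p = x" "pathfinish p = y" "has_length p L" by (auto simp: lengths_def)
    then show "L \<in> lengths y x" unfolding lengths_def using length_reverse
      by (intro CollectI exI[of _ "reversepath p"]) auto
  qed
  then show ?thesis unfolding d_eq by (metis subset_antisym)
qed

lemma d_triangle: "d x z \<le> d x y + d y z"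
proof -
  have "d x z - d y z \<le> d x y"
  proof (rule d_ge)
    fix L1 assume L1: "L1 \<in> lengths x y"
    have "d x z - L1 \<le> d y z"
    proof (rule d_ge)
      fix L2 assume L2: "L2 \<in> lengths y z"
      from L1 L2 obtain p1 p2 where p: "pathstart p1 = x" "pathfinish p1 = y" "has_length p1 L1"
        "pathstart p2 = y" "pathfinish p2 = z" "has_length p2 L2" by (auto simp: lengths_def)
      then have "L1 + L2 \<in> lengths x z"
        unfolding lengths_def using length_join[of p1 L1 p2 L2] by (intro CollectI exI[of _ "p1 +++ p2"]) auto
      then show "d x z - L1 \<le> L2" using d_le by force
    qed
    then show "d x z - d y z \<le> L1" by linarith
  qed
  then show ?thesis by linarith
qed

text \<open>The gradient of this function decays like \<open>1 / \<bar>y\<bar>\<close>, just as fast as the metric may shrink. For every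
  \<open>a\<close> the bound separates \<open>a\<close> from other points, which makes the distance a metric; it also bounds
  Cauchy sequences in the Euclidean norm.\<close>

lemma d_log_bound:
  assumes k: "0 < k" and lower: "\<And>x u. k / (1 + (norm x)\<^sup>2) * (norm u)\<^sup>2 \<le> g x u u"
  shows "\<exists>B>0. \<forall>y. ln (1 + (norm (y - a))\<^sup>2) \<le> B * d a y"
proof -
  define f where "f y = ln (1 + (norm (y - a))\<^sup>2)" for y
  define f' where "f' y u = 2 * ((y - a) \<bullet> u) / (1 + (norm (y - a))\<^sup>2)" for y u
  have f: "(f has_derivative f' y) (at y)" for y
  proof -
    have "((\<lambda>y. 1 + (y - a) \<bullet> (y - a)) has_derivative (\<lambda>u. 2 * ((y - a) \<bullet> u))) (at y)"
      by (auto intro!: derivative_eq_intros simp: inner_commute)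
    moreover have "0 < 1 + (y - a) \<bullet> (y - a)" by (simp add: add_pos_nonneg)
    ultimately have "((\<lambda>y. ln (1 + (y - a) \<bullet> (y - a))) has_derivative
        (\<lambda>u. 2 * ((y - a) \<bullet> u) * inverse (1 + (y - a) \<bullet> (y - a)))) (at y)"
      by (rule has_derivative_ln[rotated])
    then show ?thesis by (simp add: f_def[abs_def] f'_def[abs_def] power2_norm_eq_inner divide_inverse)
  qed
  define B where "B = 2 * (1 + norm a) / sqrt k"
  have B: "0 < B" using k by (simp add: B_def add_pos_nonneg)
  have b: "\<bar>f' y u\<bar> \<le> B * sqrt (g y u u)" for y u
  proof -
    define s where "s = norm (y - a)"
    have "norm y \<le> s + norm a" unfolding s_def using norm_triangle_ineq[of "y - a" a] by simp
    then have "(norm y)\<^sup>2 \<le> (s + norm a)\<^sup>2" by (intro power_mono) auto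
    also have "1 + (s + norm a)\<^sup>2 \<le> (1 + norm a)\<^sup>2 * (1 + s\<^sup>2)"
    proof -
      have "0 \<le> norm a * (1 - s)\<^sup>2" "0 \<le> (norm a)\<^sup>2 * s\<^sup>2" "0 \<le> norm a * s\<^sup>2" "0 \<le> norm a" by simp_all
      moreover have "(1 + norm a)\<^sup>2 * (1 + s\<^sup>2)
          = 1 + (s + norm a)\<^sup>2 + (norm a * (1 - s)\<^sup>2 + (norm a)\<^sup>2 * s\<^sup>2 + norm a * s\<^sup>2 + norm a)"
        by (simp add: power2_eq_square algebra_simps)
      ultimately show ?thesis by linarith
    qed
    finally have y: "1 + (norm y)\<^sup>2 \<le> (1 + norm a)\<^sup>2 * (1 + s\<^sup>2)" by simp
    have s2: "2 * s \<le> 1 + s\<^sup>2" using zero_le_power2[of "1 - s"] by (simp add: power2_eq_square algebra_simps)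
    have y0: "0 < 1 + (norm y)\<^sup>2" "0 < 1 + s\<^sup>2" by (simp_all add: add_pos_nonneg)
    have "(norm u)\<^sup>2 \<le> (1 + (norm y)\<^sup>2) / k * g y u u"
      using lower[of y u] k y0 by (simp add: field_simps)
    also have "\<dots> \<le> (1 + norm a)\<^sup>2 * (1 + s\<^sup>2) / k * g y u u"
      using y k g_nonneg by (intro mult_right_mono divide_right_mono) auto
    finally have u: "(norm u)\<^sup>2 \<le> (1 + norm a)\<^sup>2 * (1 + s\<^sup>2) / k * g y u u" .
    have "\<bar>f' y u\<bar> \<le> 2 * (s * norm u) / (1 + s\<^sup>2)"
      unfolding f'_def abs_divide s_def[symmetric] using Cauchy_Schwarz_ineq2[of "y - a" u] y0
      by (auto intro!: divide_right_mono simp: s_def abs_mult)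
    then have "\<bar>f' y u\<bar>\<^sup>2 \<le> (2 * (s * norm u) / (1 + s\<^sup>2))\<^sup>2" by (intro power_mono) auto
    also have "\<dots> = (4 * s\<^sup>2 / (1 + s\<^sup>2)\<^sup>2) * (norm u)\<^sup>2" by (simp add: power_mult_distrib power_divide)
    also have "\<dots> \<le> (4 * s\<^sup>2 / (1 + s\<^sup>2)\<^sup>2) * ((1 + norm a)\<^sup>2 * (1 + s\<^sup>2) / k * g y u u)"
      using u by (intro mult_left_mono) auto
    also have "\<dots> = (s\<^sup>2 / (1 + s\<^sup>2)) * (4 * (1 + norm a)\<^sup>2 / k * g y u u)"
    proof -
      have "(4 * r / e\<^sup>2) * (A * e / k * j) = (r / e) * (4 * A / k * j)" if "0 < e" for r e A j :: real
        using that by (simp add: power2_eq_square)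
      then show ?thesis using y0(2) .
    qed
    also have "\<dots> \<le> 1 * (4 * (1 + norm a)\<^sup>2 / k * g y u u)"
      using y0 k g_nonneg by (intro mult_right_mono) auto
    also have "\<dots> = (B * sqrt (g y u u))\<^sup>2"
      using k g_nonneg by (simp add: B_def power_mult_distrib power_divide) (simp add: power2_eq_square algebra_simps)
    finally show ?thesis by (rule power2_le_imp_le) (use B g_nonneg[of y u] in simp)
  qed
  have "f y / B \<le> d a y" for y
  proof (rule d_ge)
    fix L assume "L \<in> lengths a y"
    then obtain p where "pathstart p = a" "pathfinish p = y" "has_length p L" by (auto simp: lengths_def)
    then have "f y - f a \<le> B * L" using length_lower_bound[OF _ f b, of p L] by simp
    then show "f y / B \<le> L" using B by (simp add: f_def field_simps)
  qed
  then show ?thesis using B by (intro exI[of _ B]) (auto simp: f_def field_simps)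
qed

text \<open>A Cauchy sequence is bounded, hence has a subsequence that converges in the Euclidean sense. Segments
  show that it converges in the distance as well.\<close>

lemma complete_metric:
  assumes k: "0 < k" and lower: "\<And>x u. k / (1 + (norm x)\<^sup>2) * (norm u)\<^sup>2 \<le> g x u u"
  shows "complete_metric g"
proof -
  have d0: "d x y = 0 \<longleftrightarrow> x = y" for x y
  proof
    assume "d x y = 0"
    with d_log_bound[OF k lower, of x] have "ln (1 + (norm (y - x))\<^sup>2) \<le> 0" by (metis mult_zero_right)
    then have "1 + (norm (y - x))\<^sup>2 \<le> 1" by (simp add: add_pos_nonneg ln_le_zero_iff)
    then show "x = y" by simp
  next
    assume "x = y"
    from g_upper_on_ball[of "norm x"] obtain B where
      "0 \<le> B" "\<And>z u. norm z \<le> norm x \<Longrightarrow> g z u u \<le> B\<^sup>2 * (norm u)\<^sup>2" by blast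
    from linepath_length[where R = "norm x", OF this(2,1), where x = x and y = x] d_le[of _ x x] d_nonneg[of x x] \<open>x = y\<close>
    show "d x y = 0" by force
  qed
  interpret M: Metric_space UNIV d
    by unfold_locales (auto simp: d_nonneg d_commute d0 d_triangle)
  show ?thesis unfolding complete_metric_def M.mcomplete_def
  proof (intro allI impI)
    fix \<sigma> assume C: "M.MCauchy \<sigma>"
    then have C: "\<And>e. 0 < e \<Longrightarrow> \<exists>N. \<forall>n n'. N \<le> n \<longrightarrow> N \<le> n' \<longrightarrow> d (\<sigma> n) (\<sigma> n') < e"
      unfolding M.MCauchy_def by blast
    from C[of 1] obtain N where N: "\<And>n. N \<le> n \<Longrightarrow> d (\<sigma> N) (\<sigma> n) < 1" by auto
    from d_log_bound[OF k lower, of "\<sigma> N"] obtain B where B: "0 < B" "\<And>y. ln (1 + (norm (y - \<sigma> N))\<^sup>2) \<le> B * d (\<sigma> N) y" by blast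
    have bd: "norm (\<sigma> n) \<le> norm (\<sigma> N) + exp B" if "N \<le> n" for n
    proof -
      have "ln (1 + (norm (\<sigma> n - \<sigma> N))\<^sup>2) \<le> B"
      proof -
        have "B * d (\<sigma> N) (\<sigma> n) \<le> B * 1"
          using N[OF that] B(1) by (intro mult_left_mono) auto
        then show ?thesis using B(2)[of "\<sigma> n"] by linarith
      qed
      then have "exp (ln (1 + (norm (\<sigma> n - \<sigma> N))\<^sup>2)) \<le> exp B" by (simp only: exp_le_cancel_iff)
      moreover have "exp (ln (1 + (norm (\<sigma> n - \<sigma> N))\<^sup>2)) = 1 + (norm (\<sigma> n - \<sigma> N))\<^sup>2"
        by (rule exp_ln) (simp add: add_pos_nonneg)
      ultimately have "1 + (norm (\<sigma> n - \<sigma> N))\<^sup>2 \<le> exp B" by linarith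
      moreover have "2 * norm (\<sigma> n - \<sigma> N) \<le> 1 + (norm (\<sigma> n - \<sigma> N))\<^sup>2"
        using zero_le_power2[of "1 - norm (\<sigma> n - \<sigma> N)"] by (simp add: power2_eq_square algebra_simps)
      ultimately have "norm (\<sigma> n - \<sigma> N) \<le> exp B" using norm_ge_zero[of "\<sigma> n - \<sigma> N"] by linarith
      then show ?thesis using norm_triangle_ineq[of "\<sigma> n - \<sigma> N" "\<sigma> N"] by simp
    qed
    define R where "R = norm (\<sigma> N) + exp B"
    have "\<forall>n. \<sigma> (N + n) \<in> cball 0 R" using bd by (auto simp: R_def)
    then obtain l r where r: "l \<in> cball 0 R" "strict_mono r" "((\<lambda>n. \<sigma> (N + n)) \<circ> r) \<longlonglongrightarrow> l"
      using compact_cball[of "0 :: real^'m" R] unfolding compact_def by meson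
    from g_upper_on_ball[of R] obtain B' where
      B': "0 \<le> B'" "\<And>z u. norm z \<le> R \<Longrightarrow> g z u u \<le> B'\<^sup>2 * (norm u)\<^sup>2" by blast
    have dB: "d x y \<le> B' * norm (y - x)" if "norm x \<le> R" "norm y \<le> R" for x y
      using linepath_length[OF B'(2,1) that] d_le[of _ x y] by force
    have "\<exists>n0. \<forall>n\<ge>n0. d (\<sigma> n) l < e" if e: "0 < e" for e
    proof -
      from C[of "e/2"] e obtain n1 where n1: "\<And>n n'. n1 \<le> n \<Longrightarrow> n1 \<le> n' \<Longrightarrow> d (\<sigma> n) (\<sigma> n') < e/2" by auto
      have "0 < e / (2 * (B' + 1))" using e B' by simp
      with r(3) obtain n2 where n2: "\<And>n. n2 \<le> n \<Longrightarrow> norm (\<sigma> (N + r n) - l) < e / (2 * (B' + 1))"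
        unfolding LIMSEQ_iff by (metis comp_apply)
      define m where "m = N + r (max n1 n2)"
      have "n1 \<le> m" using seq_suble[OF r(2), of "max n1 n2"] by (simp add: m_def)
      have "d (\<sigma> m) l \<le> B' * norm (l - \<sigma> m)" using r(1) bd[of m] by (intro dB) (auto simp: m_def R_def)
      also have "\<dots> \<le> (B' + 1) * norm (\<sigma> m - l)" by (simp add: norm_minus_commute distrib_right)
      also have "\<dots> < (B' + 1) * (e / (2 * (B' + 1)))"
        using n2[of "max n1 n2"] B' by (intro mult_strict_left_mono) (auto simp: m_def)
      also have "\<dots> = e / 2"
      proof -
        have "0 < B' + 1" using B'(1) by simp
        then show ?thesis by (simp add: field_simps)
      qed
      finally have "d (\<sigma> m) l < e / 2" .
      then have "d (\<sigma> n) l < e" if "n1 \<le> n" for n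
        using n1[OF that \<open>n1 \<le> m\<close>] d_triangle[of "\<sigma> n" l "\<sigma> m"] by linarith
      then show ?thesis by blast
    qed
    then have "limitin M.mtopology \<sigma> l sequentially"
      unfolding M.limit_metric_sequentially by auto
    then show "\<exists>x. limitin M.mtopology \<sigma> x sequentially" by blast
  qed
qed

end

lemma (in perturbed) complete_G:
  assumes "\<epsilon> \<le> 1" shows "complete_metric G"
proof (rule complete_metric)
  show "0 < c * \<epsilon>\<^sup>2" using c \<epsilon> by simp
  show "c * \<epsilon>\<^sup>2 / (1 + (norm x)\<^sup>2) * (norm u)\<^sup>2 \<le> G x u u" for x u
  proof -
    have "\<epsilon>\<^sup>2 \<le> 1" using assms \<epsilon> by (simp add: power_le_one)
    then have "c * \<epsilon>\<^sup>2 / (1 + (norm x)\<^sup>2) \<le> c * \<epsilon>\<^sup>2 / q x"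
      using c q_pos[of x] by (intro divide_left_mono) (auto simp: q_def power2_norm_eq_inner add_pos_nonneg)
    then have "c * \<epsilon>\<^sup>2 / (1 + (norm x)\<^sup>2) * (norm u)\<^sup>2 \<le> c * \<epsilon>\<^sup>2 / q x * (u \<bullet> u)"
      unfolding power2_norm_eq_inner by (intro mult_right_mono) auto
    also have "\<dots> \<le> G x u u" by (rule G_lower)
    finally show ?thesis .
  qed
qed

section \<open>A smooth bump function\<close>

text \<open>The powers of \<open>1 / t\<close> make the family closed under differentiation, so that one induction proves all of
  its members smooth.\<close>

definition flat :: "nat \<Rightarrow> real \<Rightarrow> real" where
  "flat n t = (if 0 < t then (1 / t) ^ n * exp (- (1 / t)) else 0)"

lemma flat_tendsto_0: "(flat n \<longlongrightarrow> 0) (at_right 0)"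
proof -
  have "((\<lambda>t. (inverse t) ^ n / exp (inverse t)) \<longlongrightarrow> (0::real)) (at_right 0)"
    by (rule filterlim_compose[OF tendsto_power_div_exp_0 filterlim_inverse_at_top_right])
  moreover have "\<forall>\<^sub>F t in at_right 0. (inverse t) ^ n / exp (inverse t) = flat n t"
    unfolding eventually_at_right_field
    by (intro exI[of _ 1]) (simp add: flat_def exp_minus divide_inverse)
  ultimately show ?thesis by (rule Lim_transform_eventually)
qed

lemma flat_has_derivative:
  "(flat n has_field_derivative flat (n + 2) t - real n * flat (n + 1) t) (at t)"
proof -
  consider "0 < t" | "t < 0" | "t = 0" by linarith
  then show ?thesis
  proof cases
    case 1
    have "((\<lambda>t. (1 / t) ^ n * exp (- (1 / t))) has_field_derivative flat (n + 2) t - real n * flat (n + 1) t) (at t)"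
    proof -
      have d1: "((\<lambda>t. 1 / t) has_field_derivative - (1 / t)\<^sup>2) (at t)"
        using 1 by (auto intro!: derivative_eq_intros simp: power2_eq_square)
      have d2: "((\<lambda>z. z ^ n * exp (- z)) has_field_derivative (real n * z ^ (n - 1) - z ^ n) * exp (- z)) (at z)" for z :: real
        by (auto intro!: derivative_eq_intros simp: algebra_simps)
      have "(real n * z ^ (n - 1) - z ^ n) * exp (- z) * (- z\<^sup>2)
          = z ^ (n + 2) * exp (- z) - real n * (z ^ (n + 1) * exp (- z))" for z :: real
        by (cases n) (simp_all add: power2_eq_square algebra_simps)
      then show ?thesis using DERIV_chain2[OF d2 d1] 1 by (simp only: flat_def if_True)
    qed
    then show ?thesis
      by (rule has_field_derivative_transform_within_open[of _ _ _ "{0<..}"]) (use 1 in \<open>auto simp: flat_def\<close>)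
  next
    case 2
    have "((\<lambda>t. 0) has_field_derivative flat (n + 2) t - real n * flat (n + 1) t) (at t)"
      using 2 by (simp add: flat_def)
    then show ?thesis
      by (rule has_field_derivative_transform_within_open[of _ _ _ "{..<0}"]) (use 2 in \<open>auto simp: flat_def\<close>)
  next
    case 3
    have "((\<lambda>t. (flat n t - flat n 0) / (t - 0)) \<longlongrightarrow> 0) (at 0)"
      unfolding filterlim_at_split
    proof
      have "\<forall>\<^sub>F t in at_left 0. 0 = (flat n t - flat n 0) / (t - 0)"
        unfolding eventually_at_left_field by (intro exI[of _ "-1"]) (simp add: flat_def)
      then show "((\<lambda>t. (flat n t - flat n 0) / (t - 0)) \<longlongrightarrow> 0) (at_left 0)"
        by (rule Lim_transform_eventually[OF tendsto_const])
      have "\<forall>\<^sub>F t in at_right 0. flat (n + 1) t = (flat n t - flat n 0) / (t - 0)"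
        unfolding eventually_at_right_field by (intro exI[of _ 1]) (simp add: flat_def)
      then show "((\<lambda>t. (flat n t - flat n 0) / (t - 0)) \<longlongrightarrow> 0) (at_right 0)"
        by (rule Lim_transform_eventually[OF flat_tendsto_0])
    qed
    then show ?thesis using 3 by (simp add: has_field_derivative_iff flat_def)
  qed
qed

lemma C_inf_on_flat: "C_inf_on (flat n) UNIV"
  unfolding C_inf_on_def
proof
  fix k show "C_k_on k (flat n) UNIV"
  proof (induction k arbitrary: n)
    case 0
    show ?case using DERIV_isCont[OF flat_has_derivative] by (simp add: continuous_at_imp_continuous_on)
  next
    case (Suc k)
    have "C_k_on k (\<lambda>t. flat (n + 2) t + (- real n) * flat (n + 1) t) UNIV"
      by (intro C_k_on_add C_k_on_bilinear[OF bounded_bilinear_mult] C_k_on_const Suc open_UNIV)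
    then have "C_k_on k (\<lambda>t. flat (n + 2) t - real n * flat (n + 1) t) UNIV" by simp
    then show ?case by (rule C_k_on_SucI_field[OF open_UNIV flat_has_derivative])
  qed
qed

definition bump :: "real \<Rightarrow> real" where "bump t = exp 1 * flat 0 (1 - t\<^sup>2)"

lemma C_inf_on_bump: "C_inf_on bump UNIV"
proof -
  have "C_inf_on (\<lambda>t::real. 1 - t * t) UNIV"
    by (intro C_inf_on_diff C_inf_on_mult C_inf_on_const C_inf_on_id open_UNIV)
  then have "C_inf_on (\<lambda>t::real. flat 0 (1 - t * t)) UNIV"
    by (rule C_inf_on_compose[OF C_inf_on_flat open_UNIV]) simp
  then have "C_inf_on (\<lambda>t::real. exp 1 * flat 0 (1 - t * t)) UNIV"
    by (rule C_inf_on_mult[OF open_UNIV C_inf_on_const])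
  then show ?thesis unfolding bump_def[abs_def] power2_eq_square .
qed

lemma bump_0: "bump 0 = 1"
  by (simp add: bump_def flat_def flip: exp_add)

lemma bump_eq_0: "1 \<le> \<bar>t\<bar> \<Longrightarrow> bump t = 0"
  using abs_le_square_iff[of 1 t] by (simp add: bump_def flat_def)

lemma bump_nonneg: "0 \<le> bump t" by (simp add: bump_def flat_def)

lemma bump_le_1: "bump t \<le> 1"
proof (cases "0 < 1 - t\<^sup>2")
  case True
  then have "1 \<le> 1 / (1 - t\<^sup>2)" by simp
  moreover have "bump t = exp (1 - 1 / (1 - t\<^sup>2))" using True by (simp add: bump_def flat_def flip: exp_add)
  ultimately show ?thesis by simp
qed (simp add: bump_def flat_def)

lemma D1_DERIV:
  fixes f :: "real \<Rightarrow> real"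
  assumes "C_inf_on f UNIV" shows "(f has_field_derivative D 1 f t) (at t)"
proof -
  have d: "(f has_derivative (\<lambda>v. D v f t)) (at t)" by (rule C_inf_on_has_derivative[OF assms UNIV_I])
  have "D v f t = D 1 f t * v" for v
    using linear_cmul[OF has_derivative_linear[OF d], of v 1] by simp
  then have "(\<lambda>v. D v f t) = (*) (D 1 f t)" by (intro ext)
  then show ?thesis using d by (simp only: has_field_derivative_def)
qed

lemma D_bump_0: "D 1 bump 0 = 0"
  by (rule DERIV_local_max[OF D1_DERIV[OF C_inf_on_bump], of 1]) (auto simp: bump_0 bump_le_1)

lemma bump_derivatives_bounded:
  "\<exists>K. \<forall>t. \<bar>D 1 bump t\<bar> \<le> K" "\<exists>K. \<forall>t. \<bar>D 1 (D 1 bump) t\<bar> \<le> K"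
proof -
  have o: "open {t::real. 1 < norm t}" by (intro open_Collect_less continuous_intros)
  have 1: "D 1 bump t = 0" if "1 < norm t" for t
    using D_cong[OF o, of t bump "\<lambda>_. 0" 1] that by (simp add: bump_eq_0 D_const)
  have 2: "D 1 (D 1 bump) t = 0" if "1 < norm t" for t
    using D_cong[OF o, of t "D 1 bump" "\<lambda>_. 0" 1] that 1 by (simp add: D_const)
  show "\<exists>K. \<forall>t. \<bar>D 1 bump t\<bar> \<le> K"
    by (rule compact_support_bound[OF C_inf_on_continuous[OF C_inf_on_D[OF C_inf_on_bump]] 1])
  show "\<exists>K. \<forall>t. \<bar>D 1 (D 1 bump) t\<bar> \<le> K"
    by (rule compact_support_bound[OF C_inf_on_continuous[OF C_inf_on_D[OF C_inf_on_D[OF C_inf_on_bump]]] 2])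
qed

section \<open>The perturbation given by a metric on the sphere\<close>

lemma C_inf_on_normalize: "C_inf_on (\<lambda>x :: 'a::euclidean_space. (1 / norm x) *\<^sub>R x) (- {0})"
  by (intro C_inf_on_scaleR C_inf_on_divide C_inf_on_norm C_inf_on_const C_inf_on_id) (auto simp: open_Compl)

text \<open>Local extensions of \<open>f\<close> become extensions that are constant along rays after composition with the
  radial projection.\<close>

lemma C_inf_on_of_sphere:
  fixes f :: "'a::euclidean_space \<Rightarrow> real"
  assumes "smooth_map unit_sphere f"
  shows "C_inf_on (\<lambda>x. f ((1 / norm x) *\<^sub>R x)) (- {0})"
proof (rule C_inf_on_local)
  fix x :: 'a assume x: "x \<in> - {0}"
  have n: "(1 / norm y) *\<^sub>R y \<in> unit_sphere" if "y \<noteq> 0" for y :: 'a using that by simp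
  from assms n[of x] x obtain U F where F: "open U" "(1 / norm x) *\<^sub>R x \<in> U" "C_inf_on F U"
    "\<And>y. y \<in> unit_sphere \<inter> U \<Longrightarrow> F y = f y"
    unfolding smooth_map_def by (metis ComplD singletonI)
  define V where "V = - {0} \<inter> (\<lambda>x. (1 / norm x) *\<^sub>R x) -` U"
  have V: "open V" unfolding V_def
    by (rule continuous_open_preimage[OF C_inf_on_continuous[OF C_inf_on_normalize] _ F(1)]) auto
  have "C_inf_on (\<lambda>x. F ((1 / norm x) *\<^sub>R x)) V"
    by (rule C_inf_on_compose[OF F(3) V C_inf_on_subset[OF C_inf_on_normalize]]) (auto simp: V_def)
  then have "C_inf_on (\<lambda>x. f ((1 / norm x) *\<^sub>R x)) V"
    by (rule C_inf_on_cong[OF V, rotated]) (use F(4) n in \<open>auto simp: V_def\<close>)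
  then show "\<exists>V. open V \<and> x \<in> V \<and> C_inf_on (\<lambda>x. f ((1 / norm x) *\<^sub>R x)) V"
    using V F(2) x by (auto simp: V_def)
qed

definition proj :: "'a::real_inner \<Rightarrow> 'a \<Rightarrow> 'a" where "proj \<theta> u = u - (\<theta> \<bullet> u) *\<^sub>R \<theta>"

lemma proj_linear: "proj \<theta> (a *\<^sub>R u + b *\<^sub>R v) = a *\<^sub>R proj \<theta> u + b *\<^sub>R proj \<theta> v"
  by (simp add: proj_def inner_add_right algebra_simps)

lemma proj_tangent: "\<theta> \<in> unit_sphere \<Longrightarrow> proj \<theta> u \<in> sphere_tangent \<theta>"
  by (simp add: proj_def sphere_tangent_def inner_diff_left norm_eq_1 inner_commute[of u])

locale metric_on_sphere =
  fixes \<gamma> :: "real^'m \<Rightarrow> real^'m \<Rightarrow> real^'m \<Rightarrow> real"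
  assumes \<gamma>: "sphere_metric \<gamma>"
begin

text \<open>The difference of \<open>\<gamma>\<close> and the round metric, extended to be constant along rays and zero on radial
  vectors. Its value at 0 is set to 0, so that it is defined and homogeneous everywhere.\<close>

definition tensor where
  "tensor x u v = (if x = 0 then 0 else let \<theta> = (1 / norm x) *\<^sub>R x in
     \<gamma> \<theta> (proj \<theta> u) (proj \<theta> v) - proj \<theta> u \<bullet> proj \<theta> v)"

lemma unit: "x \<noteq> 0 \<Longrightarrow> (1 / norm x) *\<^sub>R x \<in> unit_sphere" for x :: "real^'m" by simp

lemma \<gamma>_lin: "\<theta> \<in> unit_sphere \<Longrightarrow> u \<in> sphere_tangent \<theta> \<Longrightarrow> v \<in> sphere_tangent \<theta> \<Longrightarrow> w \<in> sphere_tangent \<theta> \<Longrightarrow>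
   \<gamma> \<theta> (a *\<^sub>R u + b *\<^sub>R v) w = a * \<gamma> \<theta> u w + b * \<gamma> \<theta> v w"
  and \<gamma>_sym: "\<theta> \<in> unit_sphere \<Longrightarrow> u \<in> sphere_tangent \<theta> \<Longrightarrow> v \<in> sphere_tangent \<theta> \<Longrightarrow> \<gamma> \<theta> u v = \<gamma> \<theta> v u"
  and \<gamma>_pos: "\<theta> \<in> unit_sphere \<Longrightarrow> u \<in> sphere_tangent \<theta> \<Longrightarrow> u \<noteq> 0 \<Longrightarrow> 0 < \<gamma> \<theta> u u"
  using \<gamma> unfolding riemannian_metric_def by blast+

lemma smooth_map_\<gamma>_proj: "smooth_map unit_sphere (\<lambda>\<theta>. \<gamma> \<theta> (proj \<theta> u) (proj \<theta> v))"
proof -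
  have "tangent_field unit_sphere sphere_tangent (\<lambda>\<theta>. proj \<theta> u)" for u :: "real^'m"
  proof -
    have "C_inf_on (\<lambda>\<theta>. proj \<theta> u) UNIV" unfolding proj_def
      by (intro C_inf_on_diff C_inf_on_scaleR C_inf_on_inner C_inf_on_const C_inf_on_id open_UNIV)
    then have "smooth_map unit_sphere (\<lambda>\<theta>. proj \<theta> u)"
      unfolding smooth_map_def by (intro ballI exI[of _ UNIV] exI[of _ "\<lambda>\<theta>. proj \<theta> u"]) simp
    then show ?thesis using proj_tangent by (auto simp: tangent_field_def)
  qed
  then show ?thesis using \<gamma> unfolding riemannian_metric_def by blast
qed

lemma \<gamma>_proj_lin: "\<theta> \<in> unit_sphere \<Longrightarrow> linear (\<lambda>u. \<gamma> \<theta> (proj \<theta> u) (proj \<theta> v))"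
proof (rule linearI)
  fix a b :: "real^'m" and r assume \<theta>: "\<theta> \<in> unit_sphere"
  note l = \<gamma>_lin[OF \<theta> proj_tangent[OF \<theta>] proj_tangent[OF \<theta>] proj_tangent[OF \<theta>]]
  show "\<gamma> \<theta> (proj \<theta> (a + b)) (proj \<theta> v) = \<gamma> \<theta> (proj \<theta> a) (proj \<theta> v) + \<gamma> \<theta> (proj \<theta> b) (proj \<theta> v)"
    using proj_linear[of \<theta> 1 a 1 b] l[of 1 a 1 b v] by simp
  show "\<gamma> \<theta> (proj \<theta> (r *\<^sub>R b)) (proj \<theta> v) = r *\<^sub>R \<gamma> \<theta> (proj \<theta> b) (proj \<theta> v)"
    using proj_linear[of \<theta> r b 0 b] l[of r b 0 b v] by simp
qed

lemma tensor_sym: "tensor x u v = tensor x v u"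
proof (cases "x = 0")
  case False
  then show ?thesis
    using \<gamma>_sym[OF unit[OF False] proj_tangent[OF unit[OF False]] proj_tangent[OF unit[OF False]]]
    by (simp add: tensor_def Let_def inner_commute)
qed (simp add: tensor_def)

lemma tensor_lin1: "linear (\<lambda>u. tensor x u v)"
proof (cases "x = 0")
  case True
  then show ?thesis by (simp add: tensor_def linear_zero)
next
  case False
  define \<theta> where "\<theta> = (1 / norm x) *\<^sub>R x"
  have "linear (\<lambda>u. proj \<theta> u \<bullet> proj \<theta> v)"
    by (rule linearI) (simp_all add: proj_def inner_add_left inner_add_right inner_diff_left algebra_simps)
  then have "linear (\<lambda>u. \<gamma> \<theta> (proj \<theta> u) (proj \<theta> v) - proj \<theta> u \<bullet> proj \<theta> v)"
    using unit[OF False] by (intro linear_compose_sub \<gamma>_proj_lin) (simp_all add: \<theta>_def)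
  then show ?thesis using False by (simp add: tensor_def Let_def \<theta>_def)
qed

lemma tensor_lin2: "linear (tensor x u)"
proof -
  have "tensor x u = (\<lambda>w. tensor x w u)" by (rule ext) (rule tensor_sym)
  then show ?thesis using tensor_lin1[of x u] by (simp only:)
qed

lemma tensor_smooth: "C_inf_on (\<lambda>x. tensor x u v) (- {0})"
proof -
  have "C_inf_on (\<lambda>\<theta>. proj \<theta> u \<bullet> proj \<theta> v) UNIV" unfolding proj_def
    by (intro C_inf_on_inner C_inf_on_diff C_inf_on_scaleR C_inf_on_const C_inf_on_id open_UNIV)
  from C_inf_on_compose[OF this _ C_inf_on_normalize]
  have "C_inf_on (\<lambda>x. proj ((1 / norm x) *\<^sub>R x) u \<bullet> proj ((1 / norm x) *\<^sub>R x) v) (- {0})" by auto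
  from C_inf_on_diff[OF _ C_inf_on_of_sphere[OF smooth_map_\<gamma>_proj[of u v]] this]
  have "C_inf_on (\<lambda>x. \<gamma> ((1 / norm x) *\<^sub>R x) (proj ((1 / norm x) *\<^sub>R x) u) (proj ((1 / norm x) *\<^sub>R x) v)
      - proj ((1 / norm x) *\<^sub>R x) u \<bullet> proj ((1 / norm x) *\<^sub>R x) v) (- {0})" by auto
  then show ?thesis
    by (rule C_inf_on_cong[rotated 2]) (auto simp: tensor_def Let_def open_Compl)
qed

lemma tensor_homogeneous: "0 < t \<Longrightarrow> tensor (t *\<^sub>R x) u v = tensor x u v"
  by (simp add: tensor_def)

lemma tensor_rad: "tensor x x v = 0"
proof (cases "x = 0")
  case False
  define \<theta> where "\<theta> = (1 / norm x) *\<^sub>R x"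
  have "(x \<bullet> x) / (norm x * norm x) = 1" using False by (simp add: power2_norm_eq_inner[symmetric] power2_eq_square)
  then have p: "proj \<theta> x = 0" using False by (simp add: proj_def \<theta>_def)
  have "\<gamma> \<theta> (proj \<theta> 0) (proj \<theta> v) = 0"
    using unit[OF False] linear_0[OF \<gamma>_proj_lin[of \<theta> v]] by (simp add: \<theta>_def)
  moreover have "proj \<theta> 0 = 0" by (simp add: proj_def)
  ultimately show ?thesis using False p by (simp add: tensor_def Let_def \<theta>_def[symmetric])
qed (simp add: tensor_def)

lemma tensor_tangent: "x \<noteq> 0 \<Longrightarrow> u \<bullet> x = 0 \<Longrightarrow> v \<bullet> x = 0 \<Longrightarrow> tensor x u v = \<gamma> ((1 / norm x) *\<^sub>R x) u v - u \<bullet> v"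
  by (simp add: tensor_def Let_def proj_def inner_commute)

lemma sphere_continuous: "continuous_on unit_sphere (\<lambda>x. tensor x u v)"
  by (rule continuous_on_subset[OF C_inf_on_continuous[OF tensor_smooth]]) auto

lemma tensor_bound_ex: "\<exists>M>0. \<forall>x u v. \<bar>tensor x u v\<bar> \<le> M * norm u * norm v"
proof -
  have 0: "\<exists>B. \<forall>x. \<bar>tensor x (axis i 1) (axis j 1)\<bar> \<le> B * 1" for i j
  proof -
    have "compact ((\<lambda>x. tensor x (axis i 1) (axis j 1)) ` unit_sphere)"
      by (rule compact_continuous_image[OF sphere_continuous compact_sphere])
    then obtain B where B: "\<And>x. x \<in> unit_sphere \<Longrightarrow> \<bar>tensor x (axis i 1) (axis j 1)\<bar> \<le> B"
      using compact_imp_bounded bounded_iff by (metis imageI real_norm_def)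
    have "\<bar>tensor x (axis i 1) (axis j 1)\<bar> \<le> max B 0" for x
    proof (cases "x = 0")
      case False
      then have "tensor x (axis i 1) (axis j 1) = tensor ((1 / norm x) *\<^sub>R x) (axis i 1) (axis j 1)"
        by (simp add: tensor_homogeneous)
      then show ?thesis using B[OF unit[OF False]] by simp
    qed (simp add: tensor_def)
    then show ?thesis by (intro exI[of _ "max B 0"]) simp
  qed
  from bilinear_family_bound[where N = "\<lambda>_. 1", OF tensor_lin1 tensor_lin2 0]
  have "\<exists>B. \<forall>x u v. \<bar>tensor x u v\<bar> \<le> B * norm u * norm v" by simp
  then obtain B where B: "\<And>x u v. \<bar>tensor x u v\<bar> \<le> B * norm u * norm v" by auto
  have "\<bar>tensor x u v\<bar> \<le> max B 1 * norm u * norm v" for x u v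
    using B[of x u v] by (rule order_trans) (intro mult_right_mono, auto)
  then show ?thesis by (intro exI[of _ "max B 1"]) auto
qed

text \<open>By homogeneity it is enough to consider the unit tangent bundle of the sphere, which is compact, and
  there the right-hand side is \<open>\<gamma>(a, a)\<close>.\<close>

lemma ellipticity_ex: "\<exists>c>0. c \<le> 1 \<and> (\<forall>x a. x \<noteq> 0 \<longrightarrow> a \<bullet> x = 0 \<longrightarrow> c * (a \<bullet> a) \<le> a \<bullet> a + tensor x a a)"
proof -
  define S where "S = {p :: (real^'m) \<times> (real^'m). fst p \<in> unit_sphere \<and> snd p \<in> unit_sphere \<and> snd p \<bullet> fst p = 0}"
  define F where "F p = snd p \<bullet> snd p + tensor (fst p) (snd p) (snd p)" for p
  have S: "compact S"
  proof -
    have "S = (unit_sphere \<times> unit_sphere) \<inter> {p. snd p \<bullet> fst p = 0}" by (auto simp: S_def)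
    moreover have "closed {p :: (real^'m) \<times> (real^'m). snd p \<bullet> fst p = 0}"
      by (intro closed_Collect_eq continuous_intros)
    ultimately show ?thesis by (simp add: compact_Int_closed compact_Times)
  qed
  have Fexp: "F p = snd p \<bullet> snd p + (\<Sum>i\<in>UNIV. snd p $ i * (\<Sum>j\<in>UNIV. snd p $ j * tensor (fst p) (axis i 1) (axis j 1)))" for p
    unfolding F_def
    by (subst linear_of_axes[OF tensor_lin1], subst linear_of_axes[OF tensor_lin2]) (rule refl)
  have "continuous_on S F" unfolding Fexp[abs_def]
    by (intro continuous_intros continuous_on_compose2[OF sphere_continuous]) (auto simp: S_def)
  moreover have Fpos: "0 < F p" if "p \<in> S" for p
  proof -
    have t: "fst p \<in> unit_sphere" "snd p \<noteq> 0" "snd p \<bullet> fst p = 0" using that by (auto simp: S_def)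
    then have "F p = \<gamma> (fst p) (snd p) (snd p)" unfolding F_def
      by (subst tensor_tangent) auto
    then show ?thesis using \<gamma>_pos[OF t(1) _ t(2)] t(3) by (simp add: sphere_tangent_def)
  qed
  ultimately have "\<exists>c>0. \<forall>p\<in>S. c \<le> F p"
  proof (cases "S = {}")
    case False
    from continuous_attains_inf[OF S False \<open>continuous_on S F\<close>] Fpos show ?thesis by blast
  qed (auto intro: exI[of _ 1])
  then obtain c where c: "0 < c" "\<And>p. p \<in> S \<Longrightarrow> c \<le> F p" by blast
  have "min c 1 * (a \<bullet> a) \<le> a \<bullet> a + tensor x a a" if "x \<noteq> 0" "a \<bullet> x = 0" for x a
  proof (cases "a = 0")
    case True
    then show ?thesis using linear_0[OF tensor_lin2] by simp
  next
    case False
    define b where "b = (1 / norm a) *\<^sub>R a"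
    have a: "a = norm a *\<^sub>R b" using False by (simp add: b_def)
    have h: "tensor ((1 / norm x) *\<^sub>R x) b b = tensor x b b" using that(1) by (simp add: tensor_homogeneous)
    have "((1 / norm x) *\<^sub>R x, b) \<in> S" using False that by (simp add: S_def b_def)
    from c(2)[OF this] have "c \<le> b \<bullet> b + tensor x b b" by (simp add: F_def h)
    then have "min c 1 \<le> b \<bullet> b + tensor x b b" by simp
    then have "(norm a)\<^sup>2 * min c 1 \<le> (norm a)\<^sup>2 * (b \<bullet> b + tensor x b b)" by (rule mult_left_mono) simp
    moreover have "a \<bullet> a + tensor x a a = (norm a)\<^sup>2 * (b \<bullet> b + tensor x b b)"
      by (subst (1 2 3 4) a) (simp add: linear_cmul[OF tensor_lin1] linear_cmul[OF tensor_lin2] power2_eq_square algebra_simps)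
    ultimately show ?thesis by (simp add: power2_norm_eq_inner mult.commute)
  qed
  then show ?thesis using c(1) by (intro exI[of _ "min c 1"]) auto
qed

text \<open>Along a ray \<open>ln (norm x) / L\<close> grows with speed \<open>1 / L\<close> with respect to the logarithm of the radius.\<close>

definition cutoff where "cutoff L x u v = bump (ln (norm x) / L) * tensor x u v"

text \<open>Only the factor \<open>\<psi>\<close> changes along a ray. The lemma is applied to the cut-off tensor and, with the
  derivative of the bump function, to its radial derivative.\<close>

lemma ray_derivative:
  assumes H: "C_inf_on H UNIV" and \<psi>: "C_inf_on \<psi> UNIV" and L: "0 < L"
    and eq: "\<And>y. H y = \<psi> (ln (norm y) / L) * tensor y u v"
  shows "D x H x = D 1 \<psi> (ln (norm x) / L) / L * tensor x u v"
proof (cases "x = 0")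
  case True
  have "D 0 H x = 0" by (rule linear_0[OF D_linear_dir[OF H]])
  then show ?thesis using True by (simp add: tensor_def)
next
  case False
  have "((\<lambda>t. t *\<^sub>R x) has_derivative (\<lambda>r. r *\<^sub>R x)) (at 1)" by (auto intro!: derivative_eq_intros)
  from has_derivative_compose[OF this, of H "\<lambda>w. D w H x"] C_inf_on_has_derivative[OF H, of x]
  have "((\<lambda>t. H (t *\<^sub>R x)) has_derivative (\<lambda>r. D (r *\<^sub>R x) H x)) (at 1)" by simp
  moreover have "(\<lambda>r. D (r *\<^sub>R x) H x) = (*) (D x H x)"
    using linear_cmul[OF D_linear_dir[OF H, of x]] by (intro ext) (simp add: mult.commute)
  ultimately have 1: "((\<lambda>t. H (t *\<^sub>R x)) has_field_derivative D x H x) (at 1)"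
    by (simp only: has_field_derivative_def)
  have "((\<lambda>t. (ln t + ln (norm x)) / L) has_field_derivative 1 / L) (at 1)"
    using L by (auto intro!: derivative_eq_intros)
  from DERIV_chain2[OF D1_DERIV[OF \<psi>] this]
  have "((\<lambda>t. \<psi> ((ln t + ln (norm x)) / L)) has_field_derivative D 1 \<psi> (ln (norm x) / L) * (1 / L)) (at 1)" by simp
  then have "((\<lambda>t. \<psi> ((ln t + ln (norm x)) / L) * tensor x u v) has_field_derivative
      D 1 \<psi> (ln (norm x) / L) * (1 / L) * tensor x u v) (at 1)" by (rule DERIV_cmult_right)
  then have "((\<lambda>t. H (t *\<^sub>R x)) has_field_derivative D 1 \<psi> (ln (norm x) / L) * (1 / L) * tensor x u v) (at 1)"
    by (rule has_field_derivative_transform_within_open[of _ _ _ "{0<..}"])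
      (use False in \<open>auto simp: eq tensor_homogeneous ln_mult\<close>)
  from DERIV_unique[OF 1 this] show ?thesis by simp
qed

lemma cutoff_supp:
  assumes L: "0 < L" and "norm x < exp (- L) \<or> exp L < norm x" shows "cutoff L x u v = 0"
proof (cases "x = 0")
  case False
  have "1 \<le> \<bar>ln (norm x) / L\<bar>" using assms(2)
  proof
    assume "norm x < exp (- L)"
    then have "ln (norm x) < - L" using False by (metis ln_exp ln_less_cancel_iff exp_gt_zero zero_less_norm_iff)
    then show ?thesis using L by (simp add: abs_if field_simps)
  next
    assume "exp L < norm x"
    then have "L < ln (norm x)" using False by (metis ln_exp ln_less_cancel_iff exp_gt_zero zero_less_norm_iff)
    then show ?thesis using L by (simp add: abs_if field_simps)
  qed
  then show ?thesis by (simp add: cutoff_def bump_eq_0)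
qed (simp add: cutoff_def tensor_def)

lemma cutoff_smooth:
  assumes L: "0 < L" shows "C_inf_on (\<lambda>x. cutoff L x u v) UNIV"
proof (rule C_inf_on_local)
  fix x :: "real^'m"
  show "\<exists>V. open V \<and> x \<in> V \<and> C_inf_on (\<lambda>x. cutoff L x u v) V"
  proof (cases "x = 0")
    case True
    have "C_inf_on (\<lambda>x. cutoff L x u v) (ball 0 (exp (- L)))"
      by (rule C_inf_on_cong[OF open_ball _ C_inf_on_const[of 0]]) (use cutoff_supp[OF L] in auto)
    then show ?thesis using True by (intro exI[of _ "ball 0 (exp (- L))"]) simp
  next
    case False
    have o: "open (- {0 :: real^'m})" by auto
    have "C_inf_on (\<lambda>x :: real^'m. ln (norm x)) (- {0})"
      by (rule C_inf_on_compose[OF C_inf_on_ln o C_inf_on_norm]) auto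
    then have "C_inf_on (\<lambda>x :: real^'m. ln (norm x) / L) (- {0})"
      by (intro C_inf_on_divide o C_inf_on_const) (use L in auto)
    then have "C_inf_on (\<lambda>x :: real^'m. bump (ln (norm x) / L)) (- {0})"
      by (rule C_inf_on_compose[OF C_inf_on_bump o]) simp
    then have "C_inf_on (\<lambda>x. cutoff L x u v) (- {0})"
      unfolding cutoff_def by (rule C_inf_on_mult[OF o _ tensor_smooth])
    then show ?thesis using False o by blast
  qed
qed

text \<open>Ellipticity survives the cutoff, since \<open>a \<bullet> a + cutoff L x a a\<close> is a convex combination of the round
  metric and the metric given by \<open>\<gamma>\<close>. Each radial derivative gains a factor \<open>1 / L\<close>.\<close>

lemma radial_perturbation_cutoff:
  assumes L: "1 \<le> L" and c: "0 < c" "c \<le> 1"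
    and ell: "\<And>x a. x \<noteq> 0 \<Longrightarrow> a \<bullet> x = 0 \<Longrightarrow> c * (a \<bullet> a) \<le> a \<bullet> a + tensor x a a"
    and M: "\<And>x u v. \<bar>tensor x u v\<bar> \<le> M * norm u * norm v"
    and K: "\<And>t. \<bar>D 1 bump t\<bar> \<le> K" "\<And>t. \<bar>D 1 (D 1 bump) t\<bar> \<le> K"
  shows "radial_perturbation (cutoff L) (exp (- L)) (exp L) c M (K / L * M)"
proof (rule radial_perturbation.intro)
  have L0: "0 < L" using L by simp
  have K0: "0 \<le> K" using K(1)[of 0] by simp
  note s = cutoff_smooth[OF L0]
  have Q: "D x (\<lambda>y. cutoff L y u v) x = D 1 bump (ln (norm x) / L) / L * tensor x u v" for x u v
    by (rule ray_derivative[OF s C_inf_on_bump L0]) (simp add: cutoff_def)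
  have bd: "\<bar>k * tensor x u v\<bar> \<le> K / L * M * norm u * norm v" if "\<bar>k\<bar> \<le> K / L" for k x u v
  proof -
    have "\<bar>k\<bar> * \<bar>tensor x u v\<bar> \<le> (K / L) * (M * norm u * norm v)"
      using that M[of x u v] K0 L0 by (intro mult_mono) auto
    then show ?thesis by (simp add: abs_mult mult.assoc)
  qed
  fix x u v a :: "real^'m"
  show "linear (\<lambda>u. cutoff L x u v)" unfolding cutoff_def
    using linear_compose_scale_right[OF tensor_lin1[of x v], of "bump (ln (norm x) / L)"] by simp
  show "cutoff L x u v = cutoff L x v u" by (simp add: cutoff_def tensor_sym[of x u v])
  show "C_inf_on (\<lambda>y. cutoff L y u v) UNIV" by (rule s)
  show "cutoff L x x v = 0" by (simp add: cutoff_def tensor_rad)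
  show "0 < exp (- L)" "exp (- L) \<le> exp L" "0 < c" "c \<le> 1" using L0 c by auto
  show "cutoff L x u v = 0" if "norm x < exp (- L) \<or> exp L < norm x"
    using cutoff_supp[OF L0 that] .
  show "c * (a \<bullet> a) \<le> a \<bullet> a + cutoff L x a a" if "a \<bullet> x = 0"
  proof (cases "x = 0")
    case True
    then show ?thesis using mult_right_mono[OF c(2), of "a \<bullet> a"] by (simp add: cutoff_def tensor_def)
  next
    case False
    define b where "b = bump (ln (norm x) / L)"
    have b: "0 \<le> b" "b \<le> 1" unfolding b_def by (rule bump_nonneg bump_le_1)+
    have "c * (a \<bullet> a) = (1 - b) * (c * (a \<bullet> a)) + b * (c * (a \<bullet> a))" by (simp add: algebra_simps)
    also have "\<dots> \<le> (1 - b) * (1 * (a \<bullet> a)) + b * (a \<bullet> a + tensor x a a)"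
      using b c ell[OF False that] by (intro add_mono mult_left_mono mult_right_mono) auto
    also have "\<dots> = a \<bullet> a + cutoff L x a a" by (simp add: cutoff_def b_def[symmetric] algebra_simps)
    finally show ?thesis .
  qed
  show "\<bar>cutoff L x u v\<bar> \<le> M * norm u * norm v"
  proof -
    have "\<bar>cutoff L x u v\<bar> \<le> 1 * \<bar>tensor x u v\<bar>"
      unfolding cutoff_def abs_mult using bump_nonneg bump_le_1 by (intro mult_right_mono) auto
    then show ?thesis using M[of x u v] by simp
  qed
  show "\<bar>D x (\<lambda>y. cutoff L y u v) x\<bar> \<le> K / L * M * norm u * norm v"
    unfolding Q using K(1) L0 by (intro bd) (simp add: divide_right_mono)
  show "\<bar>D x (\<lambda>y. D y (\<lambda>z. cutoff L z u v) y) x\<bar> \<le> K / L * M * norm u * norm v"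
  proof -
    have sQ: "C_inf_on (\<lambda>y. D y (\<lambda>z. cutoff L z u v) y) UNIV"
      by (rule C_inf_on_param_linear_apply[OF D_linear_dir[OF s] C_inf_on_D[OF s] C_inf_on_id])
    have b1: "C_inf_on (D 1 bump) UNIV" by (rule C_inf_on_D[OF C_inf_on_bump])
    have s\<psi>: "C_inf_on (\<lambda>t. 1 / L * D 1 bump t) UNIV"
      by (rule C_inf_on_mult[OF open_UNIV C_inf_on_const b1])
    have "D x (\<lambda>y. D y (\<lambda>z. cutoff L z u v) y) x = D 1 (\<lambda>t. 1 / L * D 1 bump t) (ln (norm x) / L) / L * tensor x u v"
      by (rule ray_derivative[OF sQ s\<psi> L0]) (simp add: Q)
    also have "\<dots> = D 1 (D 1 bump) (ln (norm x) / L) / (L * L) * tensor x u v"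
      unfolding D_cmult[OF b1] by simp
    also have "\<bar>\<dots>\<bar> \<le> K / L * M * norm u * norm v"
    proof (rule bd)
      have "\<bar>D 1 (D 1 bump) (ln (norm x) / L)\<bar> / (L * L) \<le> K / L"
        using K(2) K0 L L0 by (intro frac_le) (auto simp: mult_le_cancel_right1)
      then show "\<bar>D 1 (D 1 bump) (ln (norm x) / L) / (L * L)\<bar> \<le> K / L" by simp
    qed
    finally show ?thesis .
  qed
qed

lemma cutoff_sphere: "norm x = 1 \<Longrightarrow> u \<bullet> x = 0 \<Longrightarrow> v \<bullet> x = 0 \<Longrightarrow> cutoff L x u v = \<gamma> x u v - u \<bullet> v"
  using tensor_tangent[of x u v] by (cases "x = 0") (auto simp: cutoff_def bump_0)

lemma cutoff_sphere_radial:
  assumes "0 < L" "norm x = 1" shows "D x (\<lambda>y. cutoff L y u v) x = 0"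
proof -
  have "D x (\<lambda>y. cutoff L y u v) x = D 1 bump (ln (norm x) / L) / L * tensor x u v"
    by (rule ray_derivative[OF cutoff_smooth[OF assms(1)] C_inf_on_bump assms(1)]) (simp add: cutoff_def)
  then show ?thesis using assms(2) by (simp add: D_bump_0)
qed

end

section \<open>The embedding theorem\<close>

theorem theorem1p13:
  fixes n :: nat and \<gamma> :: "real^'m \<Rightarrow> real^'m \<Rightarrow> real^'m \<Rightarrow> real"
  assumes "n \<ge> 1" and "CARD('m) = n + 1"
    and "sphere_metric \<gamma>"
  shows "\<exists>(g :: real^'m \<Rightarrow> real^'m \<Rightarrow> real^'m \<Rightarrow> real) (X :: real^'m \<Rightarrow> real^'m).
           space_metric g \<and> complete_metric g \<and> negative_curvature_operator g \<and>
           sphere_embedding X \<and> sphere_isometric \<gamma> g X \<and>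
           (\<exists>K \<kappa>. compact K \<and> \<kappa> < 0 \<and> constant_sectional_curvature_on (- K) g \<kappa>) \<and>
           (\<exists>\<nu>. (\<forall>x\<in>unit_sphere. inward_unit_normal g X x (\<nu> x)) \<and> positive_definite_II g X \<nu>)"
proof -
  interpret metric_on_sphere \<gamma> by (rule metric_on_sphere.intro[OF assms(3)])
  define m where "m = (real CARD('m))\<^sup>2"
  have m: "0 < m" by (simp add: m_def)
  (* The ellipticity constant and the size of the tensor do not depend on the cutoff. *)
  from ellipticity_ex obtain c where c: "0 < c" "c \<le> 1"
    "\<And>x a. x \<noteq> 0 \<Longrightarrow> a \<bullet> x = 0 \<Longrightarrow> c * (a \<bullet> a) \<le> a \<bullet> a + tensor x a a" by blast
  from tensor_bound_ex obtain M where M: "0 < M" "\<And>x u v. \<bar>tensor x u v\<bar> \<le> M * norm u * norm v" by blast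
  from bump_derivatives_bounded obtain K1 K2 where
    K12: "\<And>t. \<bar>D 1 bump t\<bar> \<le> K1" "\<And>t. \<bar>D 1 (D 1 bump) t\<bar> \<le> K2" by blast
  define K where "K = max (max K1 K2) 1"
  have "K1 \<le> K" "K2 \<le> K" and K0: "0 < K" by (simp_all add: K_def)
  then have K: "0 < K" "\<And>t. \<bar>D 1 bump t\<bar> \<le> K" "\<And>t. \<bar>D 1 (D 1 bump) t\<bar> \<le> K"
    using K12 order_trans by blast+
  have "\<forall>\<^sub>F \<delta> in at_right 0. eta0 c M \<delta> < 2 / m"
  proof (rule order_tendstoD(2))
    show "(eta0 c M \<longlongrightarrow> 0) (at_right 0)"
      using eta0_tendsto[of c M] unfolding filterlim_at_split by blast
  qed (use m in simp)
  then obtain b where b: "0 < b" "\<And>\<delta>. 0 < \<delta> \<Longrightarrow> \<delta> < b \<Longrightarrow> eta0 c M \<delta> < 2 / m"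
    unfolding eventually_at_right_field by blast
  (* This L makes the radial derivatives smaller than b, as K * M / L < b. *)
  define L where "L = 1 + K * M / b"
  have KM: "0 < K * M / b" using K M b by simp
  then have L: "1 \<le> L" "0 < L" by (simp_all add: L_def)
  define \<delta> where "\<delta> = K / L * M"
  have "K * M < b * L" using b KM by (simp add: L_def field_simps)
  then have \<delta>: "0 < \<delta>" "\<delta> < b" using K M L by (simp_all add: \<delta>_def field_simps)
  interpret radial_perturbation "cutoff L" "exp (- L)" "exp L" c M \<delta>
    unfolding \<delta>_def by (rule radial_perturbation_cutoff[OF L(1) c(1,2) c(3) M(2) K(2,3)])
  (* The bounds on the other derivatives depend on L; they only restrict the size of \<epsilon>. *)
  from dP_bound_ex obtain M1 where M1: "\<And>x a u v. \<bar>dP x a u v\<bar> \<le> M1 * norm a * norm u * norm v" by blast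
  from ddP_bound_ex obtain M2 where M2: "\<And>x b a u v. \<bar>ddP x b a u v\<bar> \<le> M2 * norm b * norm a * norm u * norm v" by blast
  have "\<forall>\<^sub>F \<epsilon> in at_right 0. eta_fun c M \<delta> (exp (- L)) (exp L) M1 M2 \<epsilon> < 2 / m"
    using order_tendstoD(2)[OF eta_fun_tendsto b(2)[OF \<delta>]] .
  moreover have "\<forall>\<^sub>F \<epsilon> in at_right 0. \<epsilon> < exp (- L)"
    unfolding eventually_at_right_field by (rule exI[of _ "exp (- L)"]) simp
  moreover have "\<forall>\<^sub>F \<epsilon> in at_right (0::real). 0 < \<epsilon>" by (rule eventually_at_right_less)
  ultimately have "\<forall>\<^sub>F \<epsilon> in at_right 0. eta_fun c M \<delta> (exp (- L)) (exp L) M1 M2 \<epsilon> < 2 / m \<and> \<epsilon> < exp (- L) \<and> 0 < \<epsilon>"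
    by eventually_elim simp
  then obtain \<epsilon> where eps: "eta_fun c M \<delta> (exp (- L)) (exp L) M1 M2 \<epsilon> < 2 / m" "\<epsilon> < exp (- L)" "0 < \<epsilon>"
    using eventually_happens trivial_limit_at_right_real by blast
  interpret perturbed "cutoff L" "exp (- L)" "exp L" c M \<delta> \<epsilon>
    by unfold_locales (rule eps(3))
  show ?thesis
  proof (rule exI[of _ G], rule exI[of _ "\<lambda>x. x"], intro conjI)
    show "space_metric G" by (rule space_metric)
    have "exp (- L) \<le> 1" using L by simp
    then have "\<epsilon> \<le> 1" using eps(2) by linarith
    then show "complete_metric G" by (rule complete_G)
    show "negative_curvature_operator G"
      by (rule negative_curvature[OF M1 M2]) (use eps m in \<open>simp_all add: m_def[symmetric] field_simps\<close>)
    show "sphere_embedding (\<lambda>x :: real^'m. x)" by (rule sphere_embedding_id)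
    show "sphere_isometric \<gamma> G (\<lambda>x. x)"
      unfolding sphere_isometric_def
    proof (intro ballI)
      fix x u v :: "real^'m"
      assume x: "x \<in> unit_sphere" and u: "u \<in> sphere_tangent x" and v: "v \<in> sphere_tangent x"
      then have t: "norm x = 1" "u \<bullet> x = 0" "v \<bullet> x = 0" "x \<bullet> u = 0" by (auto simp: sphere_tangent_def inner_commute)
      then show "G x (sphere_diff (\<lambda>x. x) x u) (sphere_diff (\<lambda>x. x) x v) = \<gamma> x u v"
        using x by (simp add: sphere_diff_id G_def cutoff_sphere)
    qed
    show "\<exists>K \<kappa>. compact K \<and> \<kappa> < 0 \<and> constant_sectional_curvature_on (- K) G \<kappa>"
      by (rule exI[of _ "cball 0 (exp L)"], rule exI[of _ "- \<kappa>"])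
        (use constant_curvature_outside \<kappa>_pos in auto)
    show "\<exists>\<nu>. (\<forall>x\<in>unit_sphere. inward_unit_normal G (\<lambda>x. x) x (\<nu> x)) \<and> positive_definite_II G (\<lambda>x. x) \<nu>"
    proof (intro exI[of _ inward_normal] conjI ballI)
      show "inward_unit_normal G (\<lambda>x. x) x (inward_normal x)" if "x \<in> unit_sphere" for x by (rule inward_unit_normal[OF that])
      show "positive_definite_II G (\<lambda>x. x) inward_normal"
        by (rule positive_definite_II) (simp add: Q_def dP_def cutoff_sphere_radial[OF L(2)])
    qed
  qed
qed

end
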